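(* Let $(R,\mathfrak m)$ be a reduced local or graded ring, and let $A\subseteq R$ be a subring. If $\mathrm{s}^{\mathrm{diff}}_A(R)>0$, then $R$ is a simple $D_{R|A}$-module (i.e. the only ideals of $R$ stable under $D_{R|A}$ are $0$ and $R$).
   Context: All rings are commutative with $1\ne 0$. Local rings are Noetherian; "graded" means $R$ is a Noetherian $\mathbb N$-graded ring with $R_0$ a field and $\mathfrak m=R_{>0}$ the homogeneous maximal ideal. Differential operators: $D^0_{R|A}=\operatorname{Hom}_R(R,R)$, $D^n_{R|A}=\{\delta\in\operatorname{Hom}_A(R,R) : [\delta,r]\in D^{n-1}_{R|A}\ \forall r\in R\}$, and $D_{R|A}=\bigcup_n D^n_{R|A}$, a ring under composition acting on $R$. Differential powers: $\mathfrak m^{\langle n\rangle_A}=\{f\in R : \delta(f)\in\mathfrak m \text{ for all }\delta\in D^{n-1}_{R|A}\}$. Differential signature: with $d=\dim R$ and $\lambda_R$ denoting length, $\mathrm{s}^{\mathrm{diff}}_A(R)=\limsup_{n\to\infty}\dfrac{\lambda_R(R/\mathfrak m^{\langle n\rangle_A})}{n^d/d!}$.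
   Formalization: In the graded case the claim fails for some inhomogeneous A (R=Q(t)[x], A=Q[t(1-x)]); so R is shown to be a simple D_{R|A}-module there when A is a homogeneous subring, and for arbitrary A only homogeneous stable ideals are shown to be 0 or R. The local case is unchanged. *)

theory Defs
  imports "HOL-Algebra.Algebra" "HOL-Library.Extended_Real" "HOL-Library.Liminf_Limsup"
begin

section \<open>Local and graded rings\<close>

locale noetherian_local_ring = cring R + noetherian_ring R + maximalideal M R
  for R (structure) and M +
  assumes maximal_unique: "maximalideal J R \<Longrightarrow> J = M"

definition reduced_ring :: "('a, 'm) ring_scheme \<Rightarrow> bool" where
  "reduced_ring R \<longleftrightarrow>
     (\<forall>x\<in>carrier R. \<forall>n::nat. x [^]\<^bsub>R\<^esub> n = \<zero>\<^bsub>R\<^esub> \<longrightarrow> x = \<zero>\<^bsub>R\<^esub>)"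

definition hdecomp :: "('a, 'm) ring_scheme \<Rightarrow> (nat \<Rightarrow> 'a set) \<Rightarrow> 'a \<Rightarrow> (nat \<Rightarrow> 'a) \<Rightarrow> bool" where
  "hdecomp R G r f \<longleftrightarrow>
     (\<forall>i. f i \<in> G i) \<and> finite {i. f i \<noteq> \<zero>\<^bsub>R\<^esub>} \<and>
     r = (\<Oplus>\<^bsub>R\<^esub>i\<in>{i. f i \<noteq> \<zero>\<^bsub>R\<^esub>}. f i)"

definition hcomp :: "('a, 'm) ring_scheme \<Rightarrow> (nat \<Rightarrow> 'a set) \<Rightarrow> 'a \<Rightarrow> nat \<Rightarrow> 'a" where
  "hcomp R G r = (THE f. hdecomp R G r f)"

text \<open>For a subring or an ideal \<open>S\<close>, this says that \<open>S\<close> is the direct sum of the \<open>S \<inter> G i\<close>.\<close>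

definition homogeneous :: "('a, 'm) ring_scheme \<Rightarrow> (nat \<Rightarrow> 'a set) \<Rightarrow> 'a set \<Rightarrow> bool" where
  "homogeneous R G S \<longleftrightarrow> (\<forall>s\<in>S. \<forall>i. hcomp R G s i \<in> S)"

text \<open>\<open>G i\<close> is the degree \<open>i\<close> part of \<open>R\<close>, and \<open>M\<close> is the ideal of elements of positive degree.\<close>

locale noetherian_graded_ring = cring R + noetherian_ring R
  for R :: "('a, 'm) ring_scheme" (structure) and G :: "nat \<Rightarrow> 'a set" and M :: "'a set" +
  assumes degree_subgroup: "subgroup (G i) (add_monoid R)"
    and degree_mult: "\<lbrakk>x \<in> G i; y \<in> G j\<rbrakk> \<Longrightarrow> x \<otimes> y \<in> G (i + j)"
    and direct_sum: "r \<in> carrier R \<Longrightarrow> \<exists>!f. hdecomp R G r f"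
    and degree_zero_field: "subfield (G 0) R"
    and positive_part: "M = {r \<in> carrier R. hcomp R G r 0 = \<zero>}"

section \<open>Krull dimension and length\<close>

definition krull_dim :: "('a, 'm) ring_scheme \<Rightarrow> enat" where
  "krull_dim R = Sup {enat n | n. \<exists>P :: nat \<Rightarrow> 'a set.
     (\<forall>i\<le>n. primeideal (P i) R) \<and> (\<forall>i<n. P i \<subset> P (Suc i))}"

definition module_length :: "('a, 'm) ring_scheme \<Rightarrow> ('a, 'b, 'k) module_scheme \<Rightarrow> enat" where
  "module_length R N = Sup {enat n | n. \<exists>H :: nat \<Rightarrow> 'b set.
     (\<forall>i\<le>n. submodule (H i) R N) \<and> (\<forall>i<n. H i \<subset> H (Suc i))}"

text \<open>\<open>R Quot I\<close> with its \<open>R\<close>-module structure.\<close>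

definition quot_module :: "('a, 'm) ring_scheme \<Rightarrow> 'a set \<Rightarrow> ('a, 'a set) module" where
  "quot_module R I = ring.extend (R Quot I)
     (module.fields (\<lambda>r Y. (I +>\<^bsub>R\<^esub> r) \<otimes>\<^bsub>R Quot I\<^esub> Y))"

section \<open>Differential operators\<close>

text \<open>
  Operators are functions on the whole type, of which only the values on \<open>carrier R\<close> matter;
  as with \<^const>\<open>hom\<close>, the values elsewhere are left arbitrary.
\<close>

definition lin_end :: "('a, 'm) ring_scheme \<Rightarrow> 'a set \<Rightarrow> ('a \<Rightarrow> 'a) set" where
  "lin_end R A = {\<delta> \<in> hom (add_monoid R) (add_monoid R).
     \<forall>a\<in>A. \<forall>x\<in>carrier R. \<delta> (a \<otimes>\<^bsub>R\<^esub> x) = a \<otimes>\<^bsub>R\<^esub> \<delta> x}"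

primrec diff_op_le :: "('a, 'm) ring_scheme \<Rightarrow> 'a set \<Rightarrow> nat \<Rightarrow> ('a \<Rightarrow> 'a) set" where
  "diff_op_le R A 0 = lin_end R (carrier R)"
| "diff_op_le R A (Suc n) = {\<delta> \<in> lin_end R A.
     \<forall>r\<in>carrier R. (\<lambda>x. \<delta> (r \<otimes>\<^bsub>R\<^esub> x) \<ominus>\<^bsub>R\<^esub> r \<otimes>\<^bsub>R\<^esub> \<delta> x) \<in> diff_op_le R A n}"

definition diff_op :: "('a, 'm) ring_scheme \<Rightarrow> 'a set \<Rightarrow> ('a \<Rightarrow> 'a) set" where
  "diff_op R A = (\<Union>n. diff_op_le R A n)"

text \<open>The \<open>0\<close>-th differential power is \<open>R\<close>, as there are no nonzero operators of order \<open>-1\<close>.\<close>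

primrec diff_power :: "('a, 'm) ring_scheme \<Rightarrow> 'a set \<Rightarrow> 'a set \<Rightarrow> nat \<Rightarrow> 'a set" where
  "diff_power R A M 0 = carrier R"
| "diff_power R A M (Suc n) = {f \<in> carrier R. \<forall>\<delta>\<in>diff_op_le R A n. \<delta> f \<in> M}"

text \<open>
  The Krull dimension of a Noetherian local ring, or of a Noetherian graded ring over a field, is
  finite, so \<^const>\<open>the_enat\<close> is applied only to finite values. The term at \<open>n = 0\<close> has no
  influence on the limit superior.
\<close>

definition diff_signature :: "('a, 'm) ring_scheme \<Rightarrow> 'a set \<Rightarrow> 'a set \<Rightarrow> ereal" where
  "diff_signature R A M =
     (let d = the_enat (krull_dim R) in
      limsup (\<lambda>n. ereal_of_enat (module_length R (quot_module R (diff_power R A M n)))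
                    / ereal (real n ^ d / fact d)))"

definition diff_stable :: "('a, 'm) ring_scheme \<Rightarrow> 'a set \<Rightarrow> 'a set \<Rightarrow> bool" where
  "diff_stable R A I \<longleftrightarrow> (\<forall>\<delta>\<in>diff_op R A. \<forall>x\<in>I. \<delta> x \<in> I)"

text \<open>
  Multiplications by elements of \<open>R\<close> are differential operators of order \<open>0\<close>, so the
  \<open>D\<close>-submodules of \<open>R\<close> are the ideals stable under all differential operators.
\<close>

definition diff_simple :: "('a, 'm) ring_scheme \<Rightarrow> 'a set \<Rightarrow> bool" where
  "diff_simple R A \<longleftrightarrow>
     carrier R \<noteq> {\<zero>\<^bsub>R\<^esub>} \<and>
     (\<forall>I. ideal I R \<and> diff_stable R A I \<longrightarrow> I = {\<zero>\<^bsub>R\<^esub>} \<or> I = carrier R)"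

text \<open>
  Over a graded ring, simplicity with respect to all ideals presupposes that the subring \<open>A\<close> is
  homogeneous. Otherwise it can fail: for \<open>R = K[x]\<close> with \<open>K = \<rat>(t)\<close>, the usual grading and
  \<open>A = \<rat>[a]\<close>, \<open>a = t(1 - x)\<close>, the derivation \<open>(1 - x) \<partial>/\<partial>x + t \<partial>/\<partial>t\<close> shows that the signature
  is \<open>1\<close>, but \<open>aR\<close> is a proper nonzero ideal stable under all (\<open>A\<close>-linear) operators. It is not
  homogeneous: for an arbitrary subring \<open>A\<close>, simplicity can only refer to homogeneous ideals.
\<close>

end

theory Submission
  imports Defs
begin

text \<open>
  Let \<open>P\<close> be the intersection of all differential powers of \<open>M\<close>; it consists of the \<open>f\<close> with
  \<open>\<delta> f \<in> M\<close> for all differential operators \<open>\<delta>\<close>. Minimal primes of a reduced ring are stable under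
  differential operators, so those in \<open>M\<close> lie in \<open>P\<close>. If \<open>P\<close> is nonzero, it is therefore contained in
  no minimal prime, so chains of primes between \<open>P\<close> and \<open>M\<close> are shorter than \<open>d = dim R\<close>, and
  the length of \<open>R / (P + M^n)\<close>, which dominates that of \<open>R\<close> modulo the \<open>n\<close>-th differential power, is
  \<open>O(n^(d-1))\<close>. This contradicts the positivity of the signature; so \<open>P = 0\<close>, which
  means that some operator maps a given nonzero \<open>f\<close> outside \<open>M\<close>. In the local case this is a unit.
  In the graded case with \<open>A\<close> homogeneous, the degree \<open>-e\<close> part of an operator
  for the leading component of \<open>f\<close>, of degree \<open>e\<close>, maps \<open>f\<close> itself to a nonzero constant.

  All of this needs \<open>d\<close> to be finite. In the local case this is Krull's height theorem, with
  localisation replaced by saturation of ideals; in the graded case, chains of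
  primes give algebraically independent elements, whose monomials outgrow \<open>R / M^n\<close> if there
  are more of them than generators of \<open>M\<close>.
\<close>

section \<open>Ideals, powers and saturation\<close>

text \<open>The arguments on primes take place among the ideals of \<open>R\<close> itself. Two
  devices make this possible. An ideal of the localisation at a prime \<open>p\<close> is
  represented by its saturation \<open>ideal_sat R p J\<close>. An upper bound for a length is
  represented by \<open>residue_steps\<close>: a chain of ideals, each obtained from the last by
  adjoining one element that \<open>p\<close> multiplies into it. Such chains are easily
  concatenated and pushed forward along multiplication by an element. One count of jumps then bounds
  chains of submodules, of ideals of a localisation, and of vector spaces over the degree zero
  field; it serves the growth estimate, the principal ideal theorem and the finiteness of
  \<open>d\<close> in the graded case. The obstacle to treating both cases alike is that in a graded
  ring elements outside \<open>M\<close> need not be units. Two facts compensate: they are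
  nonzerodivisors, so \<open>R\<close> embeds in its localisation at \<open>M\<close>, and they
  become invertible modulo every power of \<open>M\<close>, so saturation at \<open>M\<close> is
  invisible in the quotients whose length is measured.\<close>

no_notation Sum_Type.Plus (infixr "<+>" 65)

locale noetherian_cring = cring R + noetherian_ring R for R (structure)

text \<open>A nonempty chain of ideals of a Noetherian ring contains its own union, so Zorn's lemma
  yields a maximal member of the set of counterexamples, to which the step applies.\<close>

lemma (in noetherian_ring) ideal_noetherian_induct [consumes 1, case_names step]:
  assumes "ideal I R"
    and step: "\<And>I. ideal I R \<Longrightarrow> (\<And>J. ideal J R \<Longrightarrow> I \<subset> J \<Longrightarrow> Q J) \<Longrightarrow> Q I"
  shows "Q I"
proof (rule ccontr)
  assume "\<not> Q I"
  let ?S = "{I. ideal I R \<and> \<not> Q I}"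
  have "\<exists>N\<in>?S. \<forall>L\<in>?S. N \<subseteq> L \<longrightarrow> L = N"
  proof (rule subset_Zorn_nonempty)
    show "?S \<noteq> {}" using assms(1) \<open>\<not> Q I\<close> by blast
    fix C assume C: "C \<noteq> {}" "subset.chain ?S C"
    then have "subset.chain {I. ideal I R} C"
      by (auto simp: subset.chain_def)
    then have "\<Union>C \<in> C"
      using ideal_chain_is_trivial C(1) by blast
    then show "\<Union>C \<in> ?S"
      using C(2) by (auto simp: subset.chain_def)
  qed
  then obtain N where N: "ideal N R" "\<not> Q N" "\<And>L. ideal L R \<Longrightarrow> \<not> Q L \<Longrightarrow> N \<subseteq> L \<Longrightarrow> L = N"
    by blast
  have "Q N"
    by (rule step[OF N(1)]) (use N(3) in blast)
  with N(2) show False by simp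
qed

lemma (in ring) ideal_simps:
  assumes "ideal I R"
  shows "\<zero> \<in> I" "x \<in> I \<Longrightarrow> x \<in> carrier R"
    "x \<in> I \<Longrightarrow> y \<in> I \<Longrightarrow> x \<oplus> y \<in> I"
    "x \<in> I \<Longrightarrow> \<ominus> x \<in> I"
    "x \<in> I \<Longrightarrow> y \<in> I \<Longrightarrow> x \<ominus> y \<in> I"
    "x \<in> I \<Longrightarrow> a \<in> carrier R \<Longrightarrow> a \<otimes> x \<in> I"
    "x \<in> I \<Longrightarrow> a \<in> carrier R \<Longrightarrow> x \<otimes> a \<in> I"
proof -
  interpret ideal I R by fact
  show "\<zero> \<in> I" "x \<in> I \<Longrightarrow> x \<in> carrier R"
    "x \<in> I \<Longrightarrow> y \<in> I \<Longrightarrow> x \<oplus> y \<in> I" "x \<in> I \<Longrightarrow> \<ominus> x \<in> I"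
    "x \<in> I \<Longrightarrow> a \<in> carrier R \<Longrightarrow> a \<otimes> x \<in> I"
    "x \<in> I \<Longrightarrow> a \<in> carrier R \<Longrightarrow> x \<otimes> a \<in> I"
    by (auto simp: I_l_closed I_r_closed)
  then show "x \<in> I \<Longrightarrow> y \<in> I \<Longrightarrow> x \<ominus> y \<in> I"
    by (simp add: a_minus_def)
qed

lemma (in ring) idealI':
  assumes "S \<subseteq> carrier R" "\<zero> \<in> S" "\<And>x y. x \<in> S \<Longrightarrow> y \<in> S \<Longrightarrow> x \<oplus> y \<in> S"
    and l: "\<And>a x. a \<in> carrier R \<Longrightarrow> x \<in> S \<Longrightarrow> a \<otimes> x \<in> S"
    and r: "\<And>a x. a \<in> carrier R \<Longrightarrow> x \<in> S \<Longrightarrow> x \<otimes> a \<in> S"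
  shows "ideal S R"
proof (rule idealI)
  show "ring R" ..
  have "\<ominus> x \<in> S" if "x \<in> S" for x
    using l[OF _ that, of "\<ominus> \<one>"] that assms(1) by (auto simp: l_minus)
  then show "subgroup S (add_monoid R)"
    using assms(1-3) by (auto intro!: add.subgroupI simp: a_inv_def)
qed (use l r in auto)

lemma (in ring) mem_set_add: "x \<in> I <+> J \<longleftrightarrow> (\<exists>i\<in>I. \<exists>j\<in>J. x = i \<oplus> j)"
  by (auto simp: set_add_def')

lemma (in cring) mem_adjoin: "x \<in> J <+> PIdl g \<longleftrightarrow> (\<exists>y\<in>J. \<exists>a\<in>carrier R. x = y \<oplus> a \<otimes> g)"
  by (auto simp: mem_set_add cgenideal_def)

lemma (in cring) adjoin_ideal: "ideal J R \<Longrightarrow> g \<in> carrier R \<Longrightarrow> ideal (J <+> PIdl g) R"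
  by (simp add: add_ideals cgenideal_ideal)

lemma (in ring) set_add_supset:
  assumes "ideal I R" "ideal J R"
  shows "I \<subseteq> I <+> J" "J \<subseteq> I <+> J"
proof -
  show "I \<subseteq> I <+> J"
    using ideal_simps(1,2)[OF assms(1)] ideal_simps(1,2)[OF assms(2)] unfolding mem_set_add subset_iff
    by (metis r_zero)
  show "J \<subseteq> I <+> J"
    using ideal_simps(1,2)[OF assms(1)] ideal_simps(1,2)[OF assms(2)] unfolding mem_set_add subset_iff
    by (metis l_zero)
qed

lemma (in ring) set_add_least:
  assumes "ideal L R" "I \<subseteq> L" "J \<subseteq> L"
  shows "I <+> J \<subseteq> L"
proof
  fix x assume "x \<in> I <+> J"
  then obtain i j where "i \<in> I" "j \<in> J" "x = i \<oplus> j" by (auto simp: mem_set_add)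
  then show "x \<in> L" using assms(2,3) ideal_simps(3)[OF assms(1), of i j] by blast
qed

lemma (in cring) adjoin_supset:
  assumes "ideal J R" "g \<in> carrier R"
  shows "J \<subseteq> J <+> PIdl g" "g \<in> J <+> PIdl g"
proof -
  note * = set_add_supset[OF assms(1) cgenideal_ideal[OF assms(2)]]
  show "J \<subseteq> J <+> PIdl g" by (rule *(1))
  show "g \<in> J <+> PIdl g" by (rule subsetD[OF *(2) cgenideal_self[OF assms(2)]])
qed

lemma (in ring) ideal_prod_least:
  assumes "ideal L R" "\<And>i j. i \<in> I \<Longrightarrow> j \<in> J \<Longrightarrow> i \<otimes> j \<in> L"
  shows "I \<cdot> J \<subseteq> L"
proof
  fix x assume "x \<in> I \<cdot> J"
  then show "x \<in> L"
    by induction (use assms ideal_simps(3)[OF assms(1)] in auto)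
qed

lemma (in cring) mem_prod_cgenideal:
  assumes I: "ideal I R" and g: "g \<in> carrier R"
  shows "x \<in> I \<cdot> (PIdl g) \<longleftrightarrow> (\<exists>a\<in>I. x = a \<otimes> g)"
proof
  assume "x \<in> I \<cdot> (PIdl g)"
  then show "\<exists>a\<in>I. x = a \<otimes> g"
  proof induction
    case (prod i j)
    then obtain b where b: "b \<in> carrier R" "j = b \<otimes> g" by (auto simp: cgenideal_def)
    then have "i \<otimes> j = (i \<otimes> b) \<otimes> g" using prod g ideal_simps(2)[OF I] by (simp add: m_assoc)
    then show ?case using ideal_simps(7)[OF I prod(1) b(1)] by blast
  next
    case (sum x y)
    then obtain a b where ab: "a \<in> I" "b \<in> I" "x = a \<otimes> g" "y = b \<otimes> g" by blast
    then have "x \<oplus> y = (a \<oplus> b) \<otimes> g" using g ideal_simps(2)[OF I] by (simp add: l_distr)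
    then show ?case using ideal_simps(3)[OF I ab(1,2)] by blast
  qed
next
  assume "\<exists>a\<in>I. x = a \<otimes> g"
  then show "x \<in> I \<cdot> (PIdl g)" using cgenideal_self[OF g] by (auto intro: ideal_prod.prod)
qed

lemma (in cring) mem_add_prod_cgenideal:
  assumes "ideal I R" "g \<in> carrier R"
  shows "x \<in> L <+> I \<cdot> (PIdl g) \<longleftrightarrow> (\<exists>l\<in>L. \<exists>a\<in>I. x = l \<oplus> a \<otimes> g)"
proof
  assume "x \<in> L <+> I \<cdot> (PIdl g)"
  then obtain l y where "l \<in> L" "y \<in> I \<cdot> (PIdl g)" "x = l \<oplus> y" by (auto simp: mem_set_add)
  then show "\<exists>l\<in>L. \<exists>a\<in>I. x = l \<oplus> a \<otimes> g" by (auto simp: mem_prod_cgenideal[OF assms])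
next
  assume "\<exists>l\<in>L. \<exists>a\<in>I. x = l \<oplus> a \<otimes> g"
  then obtain l a where "l \<in> L" "a \<in> I" "x = l \<oplus> a \<otimes> g" by blast
  moreover from this have "a \<otimes> g \<in> I \<cdot> (PIdl g)" by (auto simp: mem_prod_cgenideal[OF assms])
  ultimately show "x \<in> L <+> I \<cdot> (PIdl g)" by (auto simp: mem_set_add)
qed

primrec ideal_pow :: "('a, 'm) ring_scheme \<Rightarrow> 'a set \<Rightarrow> nat \<Rightarrow> 'a set" where
  "ideal_pow R I 0 = carrier R"
| "ideal_pow R I (Suc n) = I \<cdot>\<^bsub>R\<^esub> ideal_pow R I n"

lemma (in ring) ideal_pow_ideal: "ideal I R \<Longrightarrow> ideal (ideal_pow R I n) R"
  by (induction n) (auto simp: oneideal ideal_prod_is_ideal)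

lemma (in ring) ideal_pow_one: "ideal I R \<Longrightarrow> ideal_pow R I (Suc 0) = I"
  by (simp add: ideal_prod_one)

lemma (in cring) ideal_pow_add:
  assumes "ideal I R"
  shows "ideal_pow R I (i + j) = ideal_pow R I i \<cdot> ideal_pow R I j"
proof (induction i)
  case 0
  then show ?case
    using ideal_prod_one[OF ideal_pow_ideal[OF assms]] ideal_prod_commute oneideal ideal_pow_ideal[OF assms]
    by simp
next
  case (Suc i)
  then show ?case
    using assms by (simp add: ideal_prod_assoc ideal_pow_ideal)
qed

lemma (in cring) ideal_pow_antimono:
  assumes "ideal I R" "i \<le> j"
  shows "ideal_pow R I j \<subseteq> ideal_pow R I i"
proof -
  obtain k where "j = i + k" using assms(2) le_Suc_ex by blast
  then show ?thesis
    using ideal_prod_inter[OF ideal_pow_ideal ideal_pow_ideal] assms(1)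
    by (simp add: ideal_pow_add)
qed

lemma (in cring) nat_pow_mem_ideal_pow:
  assumes "ideal I R" "x \<in> I"
  shows "x [^] (n::nat) \<in> ideal_pow R I n"
proof (induction n)
  case (Suc n)
  have "x \<in> carrier R" using assms ideal_simps(2) by blast
  then show ?case
    using Suc assms nat_pow_Suc2[of x n] by (simp add: ideal_prod.prod del: nat_pow_Suc)
qed auto

text \<open>For a prime \<open>p\<close> this is the contraction to \<open>R\<close> of the ideal
  that \<open>J\<close> generates in the localisation at \<open>p\<close>.\<close>

definition ideal_sat :: "('a, 'm) ring_scheme \<Rightarrow> 'a set \<Rightarrow> 'a set \<Rightarrow> 'a set" where
  "ideal_sat R p J = {r \<in> carrier R. \<exists>s\<in>carrier R - p. s \<otimes>\<^bsub>R\<^esub> r \<in> J}"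

lemma ideal_satI:
  "s \<in> carrier R - p \<Longrightarrow> r \<in> carrier R \<Longrightarrow> s \<otimes>\<^bsub>R\<^esub> r \<in> J \<Longrightarrow> r \<in> ideal_sat R p J"
  by (auto simp: ideal_sat_def)

lemma ideal_satE:
  assumes "r \<in> ideal_sat R p J"
  obtains s where "s \<in> carrier R - p" "r \<in> carrier R" "s \<otimes>\<^bsub>R\<^esub> r \<in> J"
  using assms by (auto simp: ideal_sat_def)

lemma (in cring) prime_compl:
  assumes "primeideal p R"
  shows "s \<in> carrier R - p \<Longrightarrow> t \<in> carrier R - p \<Longrightarrow> s \<otimes> t \<in> carrier R - p"
    "\<one> \<in> carrier R - p"
proof -
  interpret primeideal p R by fact
  show "s \<in> carrier R - p \<Longrightarrow> t \<in> carrier R - p \<Longrightarrow> s \<otimes> t \<in> carrier R - p"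
    using I_prime by auto
  show "\<one> \<in> carrier R - p" using I_notcarr one_imp_carrier by auto
qed

lemma (in cring) ideal_sat_ideal:
  assumes p: "primeideal p R" and J: "ideal J R"
  shows "ideal (ideal_sat R p J) R"
proof (rule idealI')
  note S = ideal_simps[OF J]
  show "ideal_sat R p J \<subseteq> carrier R" by (auto simp: ideal_sat_def)
  show "\<zero> \<in> ideal_sat R p J"
    unfolding ideal_sat_def using S(1) prime_compl(2)[OF p] by auto
  fix x y assume "x \<in> ideal_sat R p J" "y \<in> ideal_sat R p J"
  then obtain s t where *: "x \<in> carrier R" "y \<in> carrier R" "s \<in> carrier R - p" "t \<in> carrier R - p"
    "s \<otimes> x \<in> J" "t \<otimes> y \<in> J" by (auto simp: ideal_sat_def)
  have "(s \<otimes> t) \<otimes> (x \<oplus> y) = t \<otimes> (s \<otimes> x) \<oplus> s \<otimes> (t \<otimes> y)"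
    using * by (simp, algebra)
  then have "(s \<otimes> t) \<otimes> (x \<oplus> y) \<in> J" using * S by auto
  then show "x \<oplus> y \<in> ideal_sat R p J"
    unfolding ideal_sat_def using prime_compl(1)[OF p *(3,4)] * by auto
next
  note S = ideal_simps[OF J]
  fix a x assume a: "a \<in> carrier R" and "x \<in> ideal_sat R p J"
  then obtain s where *: "x \<in> carrier R" "s \<in> carrier R - p" "s \<otimes> x \<in> J" by (auto simp: ideal_sat_def)
  have "s \<otimes> (a \<otimes> x) = a \<otimes> (s \<otimes> x)" using a * by (simp add: m_lcomm)
  then show "a \<otimes> x \<in> ideal_sat R p J"
    unfolding ideal_sat_def using a * S(6)[OF *(3) a] by (metis (mono_tags, lifting) m_closed mem_Collect_eq)
  then show "x \<otimes> a \<in> ideal_sat R p J" using a * by (simp add: m_comm)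
qed

lemma (in cring) ideal_sat_supset:
  assumes "primeideal p R" "J \<subseteq> carrier R"
  shows "J \<subseteq> ideal_sat R p J"
proof
  fix x assume "x \<in> J"
  then show "x \<in> ideal_sat R p J"
    using prime_compl(2)[OF assms(1)] assms(2) by (intro ideal_satI[of \<one>]) auto
qed

lemma ideal_sat_mono: "J \<subseteq> K \<Longrightarrow> ideal_sat R p J \<subseteq> ideal_sat R p K"
  by (auto simp: ideal_sat_def)

lemma (in cring) ideal_satD:
  assumes p: "primeideal p R" and s: "s \<in> carrier R - p" and r: "r \<in> carrier R"
    and "s \<otimes> r \<in> ideal_sat R p J"
  shows "r \<in> ideal_sat R p J"
proof -
  obtain t where t: "t \<in> carrier R - p" "t \<otimes> (s \<otimes> r) \<in> J"
    using assms(4) by (auto simp: ideal_sat_def)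
  then have "(t \<otimes> s) \<otimes> r \<in> J" using s r by (simp add: m_assoc)
  then show ?thesis
    unfolding ideal_sat_def using prime_compl(1)[OF p t(1) s] r by auto
qed

lemma (in cring) ideal_sat_idem:
  assumes "primeideal p R"
  shows "ideal_sat R p (ideal_sat R p J) \<subseteq> ideal_sat R p J"
proof
  fix r assume "r \<in> ideal_sat R p (ideal_sat R p J)"
  then show "r \<in> ideal_sat R p J"
    by (rule ideal_satE) (rule ideal_satD[OF assms])
qed

lemma (in cring) ideal_sat_prime:
  assumes "primeideal p R" "q \<subseteq> p" "primeideal q R"
  shows "ideal_sat R p q \<subseteq> q"
proof
  fix r assume "r \<in> ideal_sat R p q"
  then obtain s where "s \<in> carrier R - p" "r \<in> carrier R" "s \<otimes> r \<in> q" by (rule ideal_satE)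
  then show "r \<in> q" using primeideal.I_prime[OF assms(3), of s r] assms(2) by blast
qed

text \<open>Local form of the fact that an ideal contained in every prime over \<open>J\<close> has
  a power in \<open>J\<close>. Noetherian induction: if \<open>J\<close> is not prime, say with
  \<open>a b\<close> in \<open>J\<close>, the powers found for \<open>J + (a)\<close> and
  \<open>J + (b)\<close> multiply into the saturation of \<open>J\<close>.\<close>

lemma (in noetherian_cring) ideal_pow_subset_sat:
  assumes "ideal J R" and m: "primeideal m R" and p: "ideal p R"
    and "\<And>P. primeideal P R \<Longrightarrow> J \<subseteq> P \<Longrightarrow> P \<subseteq> m \<Longrightarrow> p \<subseteq> P"
  shows "\<exists>k. ideal_pow R p k \<subseteq> ideal_sat R m J"
  using assms(1,4)
proof (induction J rule: ideal_noetherian_induct)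
  case (step J)
  note J = step.hyps(1)
  note satJ = ideal_sat_ideal[OF m J]
  show ?case
  proof (cases "J \<subseteq> m")
    \<comment> \<open>An element of \<open>J\<close> outside \<open>m\<close> multiplies all of
      \<open>R\<close> into \<open>J\<close>, so the exponent 0 suffices.\<close>
    case False
    then obtain s where "s \<in> J" "s \<notin> m" by auto
    moreover have "s \<in> carrier R" using \<open>s \<in> J\<close> ideal_simps(2)[OF J] by blast
    ultimately have "ideal_pow R p 0 \<subseteq> ideal_sat R m J"
      using ideal_simps(7)[OF J] unfolding ideal_sat_def by auto
    then show ?thesis by blast
  next
    case Jm: True
    show ?thesis
    proof (cases "primeideal J R")
      case True
      then have "p \<subseteq> J" using step.prems(1) Jm by blast
      then have "ideal_pow R p (Suc 0) \<subseteq> ideal_sat R m J"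
        using ideal_pow_one[OF p] ideal_sat_supset[OF m] ideal_simps(2)[OF J] by blast
      then show ?thesis by blast
    next
      case False
      have "carrier R \<noteq> J" using Jm primeideal.I_notcarr[OF m] ideal_simps(2)[of m] m
        by (metis ideal_simps(2) primeideal.axioms(1) subset_antisym subset_iff)
      then obtain a b where ab: "a \<in> carrier R" "b \<in> carrier R" "a \<otimes> b \<in> J" "a \<notin> J" "b \<notin> J"
        using ideal.primeidealCD[OF J _ False] is_cring by blast
      have *: "\<exists>k. ideal_pow R p k \<subseteq> ideal_sat R m (J <+> PIdl c)" if "c \<in> carrier R" "c \<notin> J" for c
      proof (rule step.IH)
        show "ideal (J <+> PIdl c) R" by (rule adjoin_ideal[OF J that(1)])
        show "J \<subset> J <+> PIdl c" using adjoin_supset[OF J that(1)] that(2) by blast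
        show "p \<subseteq> P" if "primeideal P R" "J <+> PIdl c \<subseteq> P" "P \<subseteq> m" for P
          using step.prems(1) that adjoin_supset[OF J \<open>c \<in> carrier R\<close>] by blast
      qed
      obtain k where k: "ideal_pow R p k \<subseteq> ideal_sat R m (J <+> PIdl a)" using *[OF ab(1,4)] by blast
      obtain l where l: "ideal_pow R p l \<subseteq> ideal_sat R m (J <+> PIdl b)" using *[OF ab(2,5)] by blast
      have "ideal_pow R p k \<cdot> ideal_pow R p l \<subseteq> ideal_sat R m J"
      proof (rule ideal_prod_least[OF satJ])
        fix x y assume "x \<in> ideal_pow R p k" "y \<in> ideal_pow R p l"
        then have "x \<in> ideal_sat R m (J <+> PIdl a)" "y \<in> ideal_sat R m (J <+> PIdl b)"
          using k l by auto
        then obtain s t where st: "x \<in> carrier R" "y \<in> carrier R" "s \<in> carrier R - m"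
          "t \<in> carrier R - m" "s \<otimes> x \<in> J <+> PIdl a" "t \<otimes> y \<in> J <+> PIdl b"
          by (auto simp: ideal_sat_def)
        then obtain u v c d where uv: "u \<in> J" "v \<in> J" "c \<in> carrier R" "d \<in> carrier R"
          "s \<otimes> x = u \<oplus> c \<otimes> a" "t \<otimes> y = v \<oplus> d \<otimes> b" by (auto simp: mem_adjoin)
        have uvc: "u \<in> carrier R" "v \<in> carrier R" using uv ideal_simps(2)[OF J] by auto
        have "(s \<otimes> t) \<otimes> (x \<otimes> y) = (s \<otimes> x) \<otimes> (t \<otimes> y)"
          using st by (simp, algebra)
        also have "\<dots> = u \<otimes> (t \<otimes> y) \<oplus> ((c \<otimes> a) \<otimes> v \<oplus> (c \<otimes> d) \<otimes> (a \<otimes> b))"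
          unfolding uv(5,6) using uv(3,4) uvc ab by algebra
        also have "\<dots> \<in> J"
          using uv(1-4) uvc ab st ideal_simps(3,6)[OF J] ideal_simps(7)[OF J uv(1)] by simp
        finally show "x \<otimes> y \<in> ideal_sat R m J"
          unfolding ideal_sat_def using prime_compl(1)[OF m st(3,4)] st(1,2) by auto
      qed
      then show ?thesis using ideal_pow_add[OF p] by metis
    qed
  qed
qed

text \<open>By maximality of \<open>L\<close>, any \<open>n\<close> in \<open>N\<close> but not
  in \<open>L\<close> generates \<open>N\<close> modulo \<open>L\<close> locally, whence \<open>n \<in> L + p n\<close> locally.\<close>

lemma (in noetherian_cring) nakayama_sat:
  assumes p: "primeideal p R" and K: "ideal K R" and N: "ideal N R"
    and sub: "N \<subseteq> ideal_sat R p (K <+> p \<cdot> N)"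
  shows "N \<subseteq> ideal_sat R p K"
proof -
  have pI: "ideal p R" using p primeideal.axioms(1) by blast
  \<comment> \<open>The claim is made for every ideal over \<open>K\<close> so that Noetherian
    induction applies; the induction hypothesis at \<open>L + (n)\<close> plays the part of the
    maximality of \<open>L\<close>.\<close>
  have main: "N \<subseteq> ideal_sat R p L" if "ideal L R" "K \<subseteq> L" for L
    using that
  proof (induction L rule: ideal_noetherian_induct)
    case (step L)
    note L = step.hyps(1)
    note satL = ideal_sat_ideal[OF p L]
    show ?case
    proof (rule ccontr)
      assume "\<not> N \<subseteq> ideal_sat R p L"
      then obtain n where n: "n \<in> N" "n \<notin> ideal_sat R p L" by blast
      have nc: "n \<in> carrier R" using n ideal_simps(2)[OF N] by auto
      have nL: "n \<notin> L" using n ideal_sat_supset[OF p] ideal_simps(2)[OF L] by blast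
      note Ln = adjoin_ideal[OF L nc]
      have *: "N \<subseteq> ideal_sat R p (L <+> PIdl n)"
        using step.IH[OF Ln] adjoin_supset[OF L nc] nL step.prems(1) by blast
      let ?U = "L <+> p \<cdot> (PIdl n)"
      let ?T = "ideal_sat R p ?U"
      note pn = ideal_prod_is_ideal[OF pI cgenideal_ideal[OF nc]]
      note T0 = add_ideals[OF L pn]
      note T = ideal_sat_ideal[OF p T0]
      have "K \<subseteq> ?U" by (rule subset_trans[OF step.prems(1) set_add_supset(1)[OF L pn]])
      moreover have "?U \<subseteq> ?T" by (rule ideal_sat_supset[OF p]) (use ideal_simps(2)[OF T0] in blast)
      ultimately have "K \<subseteq> ?T" by (rule subset_trans)
      moreover have "p \<cdot> N \<subseteq> ?T"
      proof (rule ideal_prod_least[OF T])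
        fix a r assume ar: "a \<in> p" "r \<in> N"
        then obtain s where s: "s \<in> carrier R - p" "r \<in> carrier R" "s \<otimes> r \<in> L <+> PIdl n"
          using * ideal_satE[of r R p "L <+> PIdl n"] by blast
        then obtain l b where lb: "l \<in> L" "b \<in> carrier R" "s \<otimes> r = l \<oplus> b \<otimes> n"
          by (auto simp: mem_adjoin)
        have c: "l \<in> carrier R" "a \<in> carrier R" "s \<in> carrier R"
          using lb ar s ideal_simps(2)[OF L] ideal_simps(2)[OF pI] by auto
        have "s \<otimes> (a \<otimes> r) = a \<otimes> (s \<otimes> r)" using c s by (simp add: m_lcomm)
        also have "\<dots> = (a \<otimes> l) \<oplus> (a \<otimes> b) \<otimes> n"
          unfolding lb(3) using c lb(2) nc by algebra
        finally have "s \<otimes> (a \<otimes> r) \<in> ?U"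
          using ideal_simps(6)[OF L lb(1) c(2)] ideal_simps(7)[OF pI ar(1) lb(2)]
          by (auto simp: mem_add_prod_cgenideal[OF pI nc])
        then show "a \<otimes> r \<in> ?T"
          using c s(2) by (intro ideal_satI[OF s(1)]) auto
      qed
      ultimately have "K <+> p \<cdot> N \<subseteq> ?T" by (rule set_add_least[OF T])
      then have "N \<subseteq> ideal_sat R p ?T"
        by (rule subset_trans[OF sub ideal_sat_mono])
      then have "N \<subseteq> ?T"
        using ideal_sat_idem[OF p] by (rule subset_trans)
      then obtain s where s: "s \<in> carrier R - p" "s \<otimes> n \<in> ?U"
        using n(1) ideal_satE[of n R p ?U] by blast
      then obtain l a where la: "l \<in> L" "a \<in> p" "s \<otimes> n = l \<oplus> a \<otimes> n"
        by (auto simp: mem_add_prod_cgenideal[OF pI nc])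
      have c: "l \<in> carrier R" "a \<in> carrier R" "s \<in> carrier R"
        using la s ideal_simps(2)[OF L] ideal_simps(2)[OF pI] by auto
      \<comment> \<open>The factor \<open>s - a\<close> is outside \<open>p\<close>, since
        \<open>s\<close> is and \<open>a\<close> is in \<open>p\<close>; it multiplies
        \<open>n\<close> into \<open>L\<close>, against the choice of \<open>n\<close>.\<close>
      have "(s \<ominus> a) \<otimes> n = s \<otimes> n \<ominus> a \<otimes> n" using c nc by algebra
      also have "\<dots> = l" unfolding la(3) using c nc by algebra
      finally have "(s \<ominus> a) \<otimes> n \<in> L" using la by simp
      moreover have "s \<ominus> a \<notin> p"
      proof
        assume "s \<ominus> a \<in> p"
        then have "(s \<ominus> a) \<oplus> a \<in> p" using la ideal_simps(3)[OF pI] by blast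
        moreover have "(s \<ominus> a) \<oplus> a = s" using c by algebra
        ultimately show False using s by simp
      qed
      ultimately show False using n nc c unfolding ideal_sat_def by auto
    qed
  qed
  then show ?thesis using K by blast
qed

section \<open>Residue steps and Krull's height theorem\<close>

text \<open>A filtration from \<open>K\<close> up to \<open>J\<close> in \<open>n\<close> steps,
  each a cyclic module killed by \<open>p\<close>. For maximal \<open>p\<close> it shows that
  \<open>J/K\<close> has length at most \<open>n\<close>; for prime \<open>p\<close> it does so
  after localising at \<open>p\<close>. A step may be trivial, with \<open>g\<close> already in the
  ideal, so \<open>n\<close> is only an upper bound.\<close>

inductive residue_steps :: "('a, 'm) ring_scheme \<Rightarrow> 'a set \<Rightarrow> 'a set \<Rightarrow> 'a set \<Rightarrow> nat \<Rightarrow> bool"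
  for R p K where
  residue_steps_refl: "residue_steps R p K K 0"
| residue_steps_step: "residue_steps R p K J n \<Longrightarrow> g \<in> carrier R \<Longrightarrow> (\<And>a. a \<in> p \<Longrightarrow> a \<otimes>\<^bsub>R\<^esub> g \<in> J) \<Longrightarrow>
    residue_steps R p K (J <+>\<^bsub>R\<^esub> PIdl\<^bsub>R\<^esub> g) (Suc n)"

lemma (in cring) residue_steps_ideal:
  assumes "residue_steps R p K J n" "ideal K R"
  shows "ideal J R \<and> K \<subseteq> J"
  using assms(1)
proof induction
  case (residue_steps_step J n g)
  then have J: "ideal J R" "K \<subseteq> J" by auto
  show ?case
    using adjoin_ideal[OF J(1)] adjoin_supset(1)[OF J(1)] J(2) residue_steps_step.hyps(2)
    by (meson subset_trans)
qed (use assms in auto)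

lemma residue_steps_trans:
  assumes "residue_steps R p J L m" "residue_steps R p K J n"
  shows "residue_steps R p K L (n + m)"
  using assms(1)
proof induction
  case residue_steps_refl
  then show ?case using assms(2) by simp
next
  case (residue_steps_step L m g)
  then show ?case using residue_steps.residue_steps_step[of R p K L "n + m" g] by simp
qed

text \<open>Multiplication by \<open>x\<close> induces a map from \<open>R/K\<close> to
  \<open>R/K'\<close> because \<open>K x\<close> lies in \<open>K'\<close>, and it carries the
  filtration of \<open>J/K\<close> to one of the image. A layer of a larger filtration is bounded by
  recognising it as such an image.\<close>

lemma (in cring) residue_steps_scale:
  assumes "residue_steps R p K J n" and K: "ideal K R" and K': "ideal K' R" and x: "x \<in> carrier R"
    and sub: "\<And>k. k \<in> K \<Longrightarrow> k \<otimes> x \<in> K'" and p: "p \<subseteq> carrier R"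
  shows "residue_steps R p K' (K' <+> J \<cdot> (PIdl x)) n"
  using assms(1)
proof induction
  case residue_steps_refl
  have "K' <+> K \<cdot> (PIdl x) = K'"
  proof
    show "K' <+> K \<cdot> (PIdl x) \<subseteq> K'"
      using sub mem_prod_cgenideal[OF K x] by (intro set_add_least[OF K']) auto
    show "K' \<subseteq> K' <+> K \<cdot> (PIdl x)"
      by (rule set_add_supset(1)[OF K' ideal_prod_is_ideal[OF K cgenideal_ideal[OF x]]])
  qed
  then show ?case using residue_steps.residue_steps_refl by metis
next
  case (residue_steps_step J n g)
  then have J: "ideal J R" using residue_steps_ideal K by blast
  note Jg = adjoin_ideal[OF J residue_steps_step.hyps(2)]
  have gc: "g \<in> carrier R" by fact
  \<comment> \<open>Adjoining \<open>g\<close> to \<open>J\<close> in the source amounts to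
    adjoining \<open>g x\<close> in the target.\<close>
  have "K' <+> (J <+> PIdl g) \<cdot> (PIdl x) = (K' <+> J \<cdot> (PIdl x)) <+> PIdl (g \<otimes> x)"
  proof (rule equalityI; rule subsetI)
    fix y assume "y \<in> K' <+> (J <+> PIdl g) \<cdot> (PIdl x)"
    then obtain l j a where h: "l \<in> K'" "j \<in> J" "a \<in> carrier R" "y = l \<oplus> (j \<oplus> a \<otimes> g) \<otimes> x"
      unfolding mem_add_prod_cgenideal[OF Jg x] by (auto simp: mem_adjoin)
    have c: "l \<in> carrier R" "j \<in> carrier R" using h ideal_simps(2)[OF K'] ideal_simps(2)[OF J] by auto
    have "y = (l \<oplus> j \<otimes> x) \<oplus> a \<otimes> (g \<otimes> x)"
      unfolding h using c h(3) gc x by algebra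
    moreover have "l \<oplus> j \<otimes> x \<in> K' <+> J \<cdot> (PIdl x)"
      unfolding mem_add_prod_cgenideal[OF J x] using h by blast
    ultimately show "y \<in> (K' <+> J \<cdot> (PIdl x)) <+> PIdl (g \<otimes> x)"
      unfolding mem_adjoin using h(3) by blast
  next
    fix y assume "y \<in> (K' <+> J \<cdot> (PIdl x)) <+> PIdl (g \<otimes> x)"
    then obtain z a where z: "z \<in> K' <+> J \<cdot> (PIdl x)" "a \<in> carrier R" "y = z \<oplus> a \<otimes> (g \<otimes> x)"
      by (auto simp: mem_adjoin)
    then obtain l j where h: "l \<in> K'" "j \<in> J" "z = l \<oplus> j \<otimes> x"
      unfolding mem_add_prod_cgenideal[OF J x] by blast
    have c: "l \<in> carrier R" "j \<in> carrier R" using h ideal_simps(2)[OF K'] ideal_simps(2)[OF J] by auto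
    have "y = l \<oplus> (j \<oplus> a \<otimes> g) \<otimes> x"
      unfolding z(3) h(3) using c z(2) gc x by algebra
    moreover have "j \<oplus> a \<otimes> g \<in> J <+> PIdl g" unfolding mem_adjoin using h z by blast
    ultimately show "y \<in> K' <+> (J <+> PIdl g) \<cdot> (PIdl x)"
      unfolding mem_add_prod_cgenideal[OF Jg x] using h(1) by blast
  qed
  moreover have "residue_steps R p K' ((K' <+> J \<cdot> (PIdl x)) <+> PIdl (g \<otimes> x)) (Suc n)"
  proof (rule residue_steps.residue_steps_step)
    show "g \<otimes> x \<in> carrier R" using gc x by simp
    fix a assume a: "a \<in> p"
    have "a \<otimes> (g \<otimes> x) = \<zero> \<oplus> (a \<otimes> g) \<otimes> x" using a p gc x by (simp add: m_assoc subset_iff)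
    then show "a \<otimes> (g \<otimes> x) \<in> K' <+> J \<cdot> (PIdl x)"
      unfolding mem_add_prod_cgenideal[OF J x]
      using residue_steps_step.hyps(3)[OF a] ideal_simps(1)[OF K'] by blast
  qed fact
  ultimately show ?case by metis
qed

lemma (in cring) residue_steps_finite:
  assumes "finite A" "A \<subseteq> carrier R" and K: "ideal K R"
    and L: "ideal L R" "K \<subseteq> L" "A \<subseteq> L"
    and mult: "\<And>a g. a \<in> p \<Longrightarrow> g \<in> A \<Longrightarrow> a \<otimes> g \<in> K"
  shows "\<exists>J n. residue_steps R p K J n \<and> A \<subseteq> J \<and> J \<subseteq> L"
  using assms(1,2,6,7)
proof (induction A)
  case empty
  then show ?case using residue_steps_refl L(2) by blast
next
  case (insert g A)
  have "A \<subseteq> carrier R" "A \<subseteq> L" "\<And>a h. a \<in> p \<Longrightarrow> h \<in> A \<Longrightarrow> a \<otimes> h \<in> K"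
    using insert.prems by auto
  then obtain J n where J: "residue_steps R p K J n" "A \<subseteq> J" "J \<subseteq> L"
    using insert.IH by blast
  have JI: "ideal J R" "K \<subseteq> J" using residue_steps_ideal[OF J(1) K] by auto
  have g: "g \<in> carrier R" "g \<in> L" "\<And>a. a \<in> p \<Longrightarrow> a \<otimes> g \<in> K"
    using insert.prems by auto
  have "residue_steps R p K (J <+> PIdl g) (Suc n)"
    by (rule residue_steps_step[OF J(1) g(1)]) (use g(3) JI(2) in blast)
  moreover have "insert g A \<subseteq> J <+> PIdl g"
    using adjoin_supset[OF JI(1) g(1)] J(2) by (meson insert_subset subset_trans)
  moreover have "J <+> PIdl g \<subseteq> L"
    by (rule set_add_least[OF L(1) J(3) cgenideal_minimal[OF L(1) g(2)]])
  ultimately show ?case by blast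
qed

text \<open>Each layer between consecutive powers of \<open>p\<close> is killed by \<open>p\<close>
  and finitely generated; it costs one step per generator.\<close>

lemma (in noetherian_cring) residue_steps_pow:
  assumes p: "ideal p R"
  shows "\<exists>n. residue_steps R p (ideal_pow R p k) (carrier R) n"
proof (induction k)
  case 0
  then show ?case using residue_steps_refl by fastforce
next
  case (Suc k)
  then obtain n where n: "residue_steps R p (ideal_pow R p k) (carrier R) n" by blast
  obtain A where A: "A \<subseteq> carrier R" "finite A" "ideal_pow R p k = Idl A"
    using finetely_gen[OF ideal_pow_ideal[OF p]] by blast
  have AL: "A \<subseteq> ideal_pow R p k" using A genideal_self by blast
  have "\<exists>J n. residue_steps R p (ideal_pow R p (Suc k)) J n \<and> A \<subseteq> J \<and> J \<subseteq> ideal_pow R p k"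
    by (rule residue_steps_finite[OF A(2,1) ideal_pow_ideal[OF p] ideal_pow_ideal[OF p]
          ideal_pow_antimono[OF p] AL]) (use AL in \<open>auto intro: ideal_prod.prod\<close>)
  then obtain J m where J: "residue_steps R p (ideal_pow R p (Suc k)) J m" "A \<subseteq> J" "J \<subseteq> ideal_pow R p k"
    by blast
  have "ideal J R" using residue_steps_ideal[OF J(1) ideal_pow_ideal[OF p]] by blast
  then have "J = ideal_pow R p k" using J A genideal_minimal by blast
  then show ?case using residue_steps_trans[OF n] J(1) by blast
qed

section \<open>Counting jumps in chains of subgroups\<close>

definition saturated_sub :: "('a, 'm) ring_scheme \<Rightarrow> 'a set \<Rightarrow> 'a set \<Rightarrow> 'a set \<Rightarrow> bool" where
  "saturated_sub R B S H \<longleftrightarrow> additive_subgroup H R \<and> (\<forall>b\<in>B. \<forall>h\<in>H. b \<otimes>\<^bsub>R\<^esub> h \<in> H) \<and>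
     (\<forall>s\<in>S. \<forall>r\<in>carrier R. s \<otimes>\<^bsub>R\<^esub> r \<in> H \<longrightarrow> r \<in> H)"

text \<open>Each step contributes at most one to the length of a chain of saturated subgroups. This is used
  for ideals (\<open>B = R\<close>, \<open>S = {1}\<close>), ideals of the localisation at \<open>p\<close> (\<open>B = R\<close>, \<open>S = R - p\<close>) and
  subspaces over a field of representatives (\<open>S = B - {0}\<close>).\<close>

lemma (in cring) residue_steps_jumps:
  assumes "residue_steps R p K J n" and K: "ideal K R" and p: "ideal p R"
    and BS: "B \<subseteq> carrier R" "S \<subseteq> B"
    and quot: "\<And>a b. a \<in> carrier R \<Longrightarrow> b \<in> carrier R - p \<Longrightarrow> \<exists>s\<in>S. \<exists>c\<in>B. s \<otimes> a \<ominus> c \<otimes> b \<in> p"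
  shows "\<exists>\<sigma>. (\<forall>H. \<sigma> H \<subseteq> {..<n}) \<and>
    (\<forall>H H'. saturated_sub R B S H \<longrightarrow> saturated_sub R B S H' \<longrightarrow> K \<subseteq> H \<longrightarrow> H \<subseteq> H' \<longrightarrow>
       \<sigma> H \<subseteq> \<sigma> H' \<and> (\<sigma> H = \<sigma> H' \<longrightarrow> H \<inter> J = H' \<inter> J))"
  using assms(1)
proof induction
  case residue_steps_refl
  then show ?case by (intro exI[of _ "\<lambda>_. {}"]) blast
next
  case (residue_steps_step J n g)
  have J: "ideal J R" "K \<subseteq> J" using residue_steps_ideal[OF residue_steps_step.hyps(1) K] by auto
  have gc: "g \<in> carrier R" and pg: "\<And>a. a \<in> p \<Longrightarrow> a \<otimes> g \<in> J" by fact+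
  obtain \<sigma> where \<sigma>: "\<And>H. \<sigma> H \<subseteq> {..<n}"
    and mono: "\<And>H H'. saturated_sub R B S H \<Longrightarrow> saturated_sub R B S H' \<Longrightarrow> K \<subseteq> H \<Longrightarrow> H \<subseteq> H' \<Longrightarrow>
       \<sigma> H \<subseteq> \<sigma> H' \<and> (\<sigma> H = \<sigma> H' \<longrightarrow> H \<inter> J = H' \<inter> J)"
    using residue_steps_step.IH by metis
  let ?L = "J <+> PIdl g"
  \<comment> \<open>The set \<open>\<sigma> H\<close> collects the steps at which \<open>H\<close>
    acquires elements outside the previous ideal; the new step \<open>n\<close> is counted when
    \<open>H\<close> meets \<open>J + (g)\<close> outside \<open>J\<close>.\<close>
  define \<tau> where "\<tau> H = (if H \<inter> ?L \<subseteq> J then \<sigma> H else insert n (\<sigma> H))" for H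
  have JL: "J \<subseteq> ?L" by (rule adjoin_supset(1)[OF J(1) gc])
  show ?case
  proof (intro exI[of _ \<tau>] conjI allI impI)
    show "\<tau> H \<subseteq> {..<Suc n}" for H using \<sigma>[of H] by (auto simp: \<tau>_def)
    fix H H' assume H: "saturated_sub R B S H" "saturated_sub R B S H'" "K \<subseteq> H" "H \<subseteq> H'"
    have n: "n \<notin> \<sigma> H" "n \<notin> \<sigma> H'" using \<sigma> by auto
    show "\<tau> H \<subseteq> \<tau> H'" using mono[OF H] H(4) by (auto simp: \<tau>_def)
    assume eq: "\<tau> H = \<tau> H'"
    then have \<sigma>eq: "\<sigma> H = \<sigma> H'" using n unfolding \<tau>_def by (auto split: if_splits)
    then have IH: "H \<inter> J = H' \<inter> J" using mono[OF H] by blast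
    show "H \<inter> ?L = H' \<inter> ?L"
    proof (cases "H \<inter> ?L \<subseteq> J")
      case True
      then have "H' \<inter> ?L \<subseteq> J" using eq n \<sigma>eq unfolding \<tau>_def by (auto split: if_splits)
      then show ?thesis using True IH JL by blast
    next
      case False
      then obtain v where v: "v \<in> H" "v \<in> ?L" "v \<notin> J" by blast
      then obtain f' b where fb: "f' \<in> J" "b \<in> carrier R" "v = f' \<oplus> b \<otimes> g" by (auto simp: mem_adjoin)
      have bp: "b \<notin> p" using pg fb(1,3) v(3) ideal_simps(3)[OF J(1)] by blast
      \<comment> \<open>By \<open>quot\<close>, the element \<open>h\<close>, scaled by some
        \<open>s\<close> in \<open>S\<close>, differs from a multiple \<open>c v\<close> by an
        element of \<open>J\<close>. The difference lies in \<open>H'\<close>, hence in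
        \<open>H\<close> by the induction hypothesis; so \<open>s h\<close> is in \<open>H\<close>,
        and saturation removes \<open>s\<close>.\<close>
      have "h \<in> H" if h: "h \<in> H'" "h \<in> ?L" for h
      proof -
        obtain f a where fa: "f \<in> J" "a \<in> carrier R" "h = f \<oplus> a \<otimes> g" using h by (auto simp: mem_adjoin)
        obtain s c where sc: "s \<in> S" "c \<in> B" "s \<otimes> a \<ominus> c \<otimes> b \<in> p" using quot[OF fa(2)] fb(2) bp by blast
        have cc: "s \<in> carrier R" "c \<in> carrier R" "f \<in> carrier R" "f' \<in> carrier R"
          using sc BS fa(1) fb(1) ideal_simps(2)[OF J(1)] by auto
        have "s \<otimes> h \<ominus> c \<otimes> v = (s \<otimes> f \<ominus> c \<otimes> f') \<oplus> (s \<otimes> a \<ominus> c \<otimes> b) \<otimes> g"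
          unfolding fa(3) fb(3) using cc fa(2) fb(2) gc by algebra
        also have "\<dots> \<in> J"
          by (intro ideal_simps(3)[OF J(1)] ideal_simps(5)[OF J(1)] ideal_simps(6)[OF J(1)] pg sc cc fa fb)
        finally have d: "s \<otimes> h \<ominus> c \<otimes> v \<in> J" .
        interpret H: additive_subgroup H R using H(1) by (simp add: saturated_sub_def)
        interpret H': additive_subgroup H' R using H(2) by (simp add: saturated_sub_def)
        have hc: "h \<in> carrier R" "v \<in> carrier R" using h(1) v(1) by auto
        have sh: "s \<otimes> h \<in> H'" using H(2) sc(1) BS(2) h(1) unfolding saturated_sub_def by blast
        have cv: "c \<otimes> v \<in> H" using H(1) sc(2) v(1) unfolding saturated_sub_def by blast
        have "s \<otimes> h \<ominus> c \<otimes> v \<in> H'"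
          using sh cv H(4) unfolding a_minus_def by (intro H'.a_closed H'.a_inv_closed) auto
        then have "s \<otimes> h \<ominus> c \<otimes> v \<in> H" using d IH by blast
        then have "(s \<otimes> h \<ominus> c \<otimes> v) \<oplus> c \<otimes> v \<in> H" using cv by simp
        moreover have "(s \<otimes> h \<ominus> c \<otimes> v) \<oplus> c \<otimes> v = s \<otimes> h" using cc hc by algebra
        ultimately show ?thesis using H(1) sc(1) hc(1) unfolding saturated_sub_def by simp
      qed
      then show ?thesis using H(4) by blast
    qed
  qed
qed

lemma strict_chain_mono:
  fixes P :: "nat \<Rightarrow> 'b set"
  assumes "\<And>i. i < m \<Longrightarrow> P i \<subset> P (Suc i)" "i < j" "j \<le> m"
  shows "P i \<subset> P j"
  using assms(2,3)
proof (induction j)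
  case (Suc j)
  then show ?case using assms(1)[of j] by (cases "i = j") auto
qed simp

lemma strict_chain_card_le:
  fixes s :: "nat \<Rightarrow> nat set"
  assumes "\<And>i. i < t \<Longrightarrow> s i \<subset> s (Suc i)" "s t \<subseteq> {..<n}"
  shows "t \<le> n"
proof -
  have fin: "finite (s i)" if "i \<le> t" for i
    using that
  proof (induction i rule: inc_induct)
    case base
    then show ?case using assms(2) finite_subset by blast
  next
    case (step i)
    then show ?case using assms(1)[of i] by (meson finite_subset psubset_imp_subset)
  qed
  have "i \<le> card (s i)" if "i \<le> t" for i
    using that
  proof (induction i)
    case (Suc i)
    then have "card (s i) < card (s (Suc i))"
      using assms(1)[of i] fin[of "Suc i"] by (intro psubset_card_mono) auto
    then show ?case using Suc by simp
  qed simp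
  from this[of t] show ?thesis
    using card_mono[OF _ assms(2)] by simp
qed

text \<open>At the top ideal \<open>R\<close> the jump sets tell the members of a chain apart, so
  the chain maps to a strictly increasing chain of subsets of \<open>{..<n}\<close>.\<close>

lemma (in cring) residue_steps_chain:
  assumes st: "residue_steps R p K (carrier R) n" and K: "ideal K R" and p: "ideal p R"
    and BS: "B \<subseteq> carrier R" "S \<subseteq> B"
    and quot: "\<And>a b. a \<in> carrier R \<Longrightarrow> b \<in> carrier R - p \<Longrightarrow> \<exists>s\<in>S. \<exists>c\<in>B. s \<otimes> a \<ominus> c \<otimes> b \<in> p"
    and H: "\<And>i. i \<le> t \<Longrightarrow> saturated_sub R B S (H i)" "\<And>i. i \<le> t \<Longrightarrow> K \<subseteq> H i"
      "\<And>i. i < t \<Longrightarrow> H i \<subset> H (Suc i)"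
  shows "t \<le> n"
proof -
  obtain \<sigma> where \<sigma>: "\<And>H. \<sigma> H \<subseteq> {..<n}"
    and mono: "\<And>H H'. saturated_sub R B S H \<Longrightarrow> saturated_sub R B S H' \<Longrightarrow> K \<subseteq> H \<Longrightarrow> H \<subseteq> H' \<Longrightarrow>
       \<sigma> H \<subseteq> \<sigma> H' \<and> (\<sigma> H = \<sigma> H' \<longrightarrow> H \<inter> carrier R = H' \<inter> carrier R)"
    using residue_steps_jumps[OF st K p BS quot] by metis
  have sub: "H i \<subseteq> carrier R" if "i \<le> t" for i
    using H(1)[OF that] additive_subgroup.a_subset by (auto simp: saturated_sub_def)
  show ?thesis
  proof (rule strict_chain_card_le)
    show "\<sigma> (H i) \<subset> \<sigma> (H (Suc i))" if "i < t" for i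
    proof -
      have *: "\<sigma> (H i) \<subseteq> \<sigma> (H (Suc i)) \<and>
        (\<sigma> (H i) = \<sigma> (H (Suc i)) \<longrightarrow> H i \<inter> carrier R = H (Suc i) \<inter> carrier R)"
        using that H(1)[of i] H(1)[of "Suc i"] H(2)[of i] H(3)[OF that]
        by (intro mono) auto
      then show ?thesis using H(3)[OF that] sub[of i] sub[of "Suc i"] that by auto
    qed
  qed (rule \<sigma>)
qed

text \<open>The localisation of \<open>R/p^k\<close> at \<open>p\<close> has finite length, so a
  descending sequence of its ideals must repeat.\<close>

lemma (in noetherian_cring) saturated_antitone_stable:
  assumes p: "primeideal p R" and J: "\<And>n. ideal (J n) R" "\<And>n. J (Suc n) \<subseteq> J n"
    and sat: "\<And>n. ideal_sat R p (J n) \<subseteq> J n" and k: "\<And>n. ideal_pow R p k \<subseteq> J n"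
  shows "\<exists>n. J n = J (Suc n)"
proof (rule ccontr)
  assume "\<not> ?thesis"
  then have neq: "J (Suc n) \<subset> J n" for n using J(2) by blast
  have pI: "ideal p R" using p primeideal.axioms(1) by blast
  obtain T where T: "residue_steps R p (ideal_pow R p k) (carrier R) T"
    using residue_steps_pow[OF pI] by blast
  \<comment> \<open>The count is for ascending chains, so the first \<open>T + 2\<close> ideals are
    read backwards.\<close>
  have "Suc T \<le> T"
  proof (rule residue_steps_chain[OF T ideal_pow_ideal[OF pI] pI, where H = "\<lambda>i. J (Suc T - i)"
        and B = "carrier R" and S = "carrier R - p"])
    show "\<exists>s\<in>carrier R - p. \<exists>c\<in>carrier R. s \<otimes> a \<ominus> c \<otimes> b \<in> p"
      if "a \<in> carrier R" "b \<in> carrier R - p" for a b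
    proof (intro bexI)
      have "b \<otimes> a \<ominus> a \<otimes> b = \<zero>" using that by (simp, algebra)
      then show "b \<otimes> a \<ominus> a \<otimes> b \<in> p" using ideal_simps(1)[OF pI] by simp
    qed (use that in auto)
    show "saturated_sub R (carrier R) (carrier R - p) (J (Suc T - i))" for i
      unfolding saturated_sub_def
    proof (intro conjI ballI impI)
      show "additive_subgroup (J (Suc T - i)) R" using J(1) ideal.axioms(1) by blast
      show "b \<otimes> h \<in> J (Suc T - i)" if "b \<in> carrier R" "h \<in> J (Suc T - i)" for b h
        using ideal_simps(6)[OF J(1)] that by blast
      show "r \<in> J (Suc T - i)"
        if "s \<in> carrier R - p" "r \<in> carrier R" "s \<otimes> r \<in> J (Suc T - i)" for s r
        using ideal_satI[of s R p r, OF that] sat by blast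
    qed
    show "J (Suc T - i) \<subset> J (Suc T - Suc i)" if "i < Suc T" for i
      using neq[of "T - i"] that by (simp add: Suc_diff_le)
  qed (use k in auto)
  then show False by simp
qed

section \<open>Krull's principal ideal theorem and height theorem\<close>

lemma (in cring) prime_nat_pow:
  assumes "primeideal P R" "y \<in> carrier R" "y [^] (n::nat) \<in> P"
  shows "y \<in> P"
  using assms(3)
proof (induction n)
  case 0
  then show ?case using prime_compl(2)[OF assms(1)] by simp
next
  case (Suc n)
  then show ?case using primeideal.I_prime[OF assms(1), of "y [^] n" y] assms(2) by auto
qed

text \<open>The ideals \<open>Q n\<close> in the proof are the symbolic powers of \<open>q\<close> modulo \<open>q0\<close>.\<close>

lemma (in noetherian_cring) krull_principal_ideal:
  assumes p: "primeideal p R" and q: "primeideal q R" and q0: "primeideal q0 R"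
    and sub: "q0 \<subset> q" "q \<subset> p" and x: "x \<in> p"
    and min: "\<And>P. primeideal P R \<Longrightarrow> q0 \<subseteq> P \<Longrightarrow> x \<in> P \<Longrightarrow> P \<subseteq> p \<Longrightarrow> P = p"
  shows False
proof -
  have pI: "ideal p R" and qI: "ideal q R" and q0I: "ideal q0 R"
    using p q q0 primeideal.axioms(1) by blast+
  have xc: "x \<in> carrier R" using x ideal_simps(2)[OF pI] by blast
  have xq: "x \<notin> q" using min[OF q] sub by blast
  define Q where "Q n = ideal_sat R q (q0 <+> ideal_pow R q n)" for n
  define J where "J n = ideal_sat R p (Q n <+> PIdl x)" for n
  note qpI = ideal_pow_ideal[OF qI]
  note sumI = add_ideals[OF q0I qpI]
  have QI: "ideal (Q n) R" for n unfolding Q_def by (rule ideal_sat_ideal[OF q sumI])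
  have QxI: "ideal (Q n <+> PIdl x) R" for n by (rule adjoin_ideal[OF QI xc])
  have JI: "ideal (J n) R" for n unfolding J_def by (rule ideal_sat_ideal[OF p QxI])
  have q0Q: "q0 \<subseteq> Q n" and powQ: "ideal_pow R q n \<subseteq> Q n" for n
  proof -
    have "q0 <+> ideal_pow R q n \<subseteq> Q n" unfolding Q_def
      by (rule ideal_sat_supset[OF q]) (use ideal_simps(2)[OF sumI] in blast)
    then show "q0 \<subseteq> Q n" "ideal_pow R q n \<subseteq> Q n"
      using set_add_supset[OF q0I qpI] by blast+
  qed
  have Qmono: "Q (Suc n) \<subseteq> Q n" for n unfolding Q_def
    by (intro ideal_sat_mono set_add_least[OF sumI] set_add_supset(1)[OF q0I qpI]
        subset_trans[OF ideal_pow_antimono[OF qI] set_add_supset(2)[OF q0I qpI]]) simp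
  have Jmono: "J (Suc n) \<subseteq> J n" for n unfolding J_def
    by (intro ideal_sat_mono set_add_least[OF QxI] subset_trans[OF Qmono]
        set_add_supset[OF QI cgenideal_ideal[OF xc]])
  note q0xI = adjoin_ideal[OF q0I xc]
  \<comment> \<open>By \<open>min\<close>, \<open>p\<close> is the only prime inside
    \<open>p\<close> over \<open>q0 + (x)\<close>. So all \<open>J n\<close> contain one fixed power
    of \<open>p\<close>, and the descending sequence \<open>J\<close> repeats.\<close>
  have "\<exists>k. ideal_pow R p k \<subseteq> ideal_sat R p (q0 <+> PIdl x)"
  proof (rule ideal_pow_subset_sat[OF q0xI p pI])
    fix P assume P: "primeideal P R" "q0 <+> PIdl x \<subseteq> P" "P \<subseteq> p"
    then have "P = p" using min[OF P(1)] adjoin_supset[OF q0I xc] by blast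
    then show "p \<subseteq> P" by simp
  qed
  then obtain k where k: "ideal_pow R p k \<subseteq> ideal_sat R p (q0 <+> PIdl x)" by blast
  have "q0 <+> PIdl x \<subseteq> Q n <+> PIdl x" for n
    using set_add_supset[OF QI cgenideal_ideal[OF xc], of n] subset_trans[OF q0Q[of n]]
    by (intro set_add_least[OF QxI])
  then have kJ: "ideal_pow R p k \<subseteq> J n" for n
    unfolding J_def using k ideal_sat_mono by (meson subset_trans)
  obtain n where n: "J n = J (Suc n)"
    using saturated_antitone_stable[of p J k, OF p JI Jmono _ kJ] ideal_sat_idem[OF p]
    unfolding J_def by blast
  \<comment> \<open>From \<open>J n = J (Suc n)\<close>: locally at \<open>p\<close>, an element of
    \<open>Q n\<close> is \<open>w + a x\<close> with \<open>w\<close> in \<open>Q (Suc n)\<close>.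
    Then \<open>a x\<close> is in \<open>Q n\<close>, and \<open>x\<close> being outside
    \<open>q\<close> forces \<open>a\<close> into \<open>Q n\<close>; so the element lies in
    \<open>Q (Suc n) + p Q n\<close>, and Nakayama applies at \<open>p\<close>.\<close>
  have "Q n \<subseteq> ideal_sat R p (Q (Suc n) <+> p \<cdot> Q n)"
  proof
    fix r assume r: "r \<in> Q n"
    then have "r \<in> Q n <+> PIdl x" using adjoin_supset(1)[OF QI xc] by blast
    then have "r \<in> J n"
      unfolding J_def using ideal_sat_supset[OF p] ideal_simps(2)[OF QxI] by blast
    then have "r \<in> J (Suc n)" using n by simp
    then obtain s where s: "s \<in> carrier R - p" "r \<in> carrier R" "s \<otimes> r \<in> Q (Suc n) <+> PIdl x"
      unfolding J_def by (rule ideal_satE)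
    then obtain w a where w: "w \<in> Q (Suc n)" "a \<in> carrier R" "s \<otimes> r = w \<oplus> a \<otimes> x"
      by (auto simp: mem_adjoin)
    have wc: "w \<in> carrier R" using w ideal_simps(2)[OF QI] by blast
    have "x \<otimes> a = s \<otimes> r \<ominus> w" unfolding w(3) using wc w(2) xc by algebra
    also have "\<dots> \<in> Q n"
      using ideal_simps(5)[OF QI] ideal_simps(6)[OF QI r] w(1) Qmono s(1) by blast
    finally have "a \<in> Q n"
      unfolding Q_def using ideal_satD[OF q _ w(2), of x] xq xc by blast
    then have "x \<otimes> a \<in> p \<cdot> Q n" using x by (intro ideal_prod.prod)
    then have "a \<otimes> x \<in> p \<cdot> Q n" using w(2) xc by (simp add: m_comm)
    then have "s \<otimes> r \<in> Q (Suc n) <+> p \<cdot> Q n" using w by (auto simp: mem_set_add)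
    then show "r \<in> ideal_sat R p (Q (Suc n) <+> p \<cdot> Q n)" using s(1,2) by (intro ideal_satI[of s])
  qed
  then have *: "Q n \<subseteq> ideal_sat R p (Q (Suc n))" by (rule nakayama_sat[OF p QI QI])
  \<comment> \<open>Elements outside \<open>p\<close> are also outside \<open>q\<close>, at which
    \<open>Q (Suc n)\<close> is saturated.\<close>
  have "Q n \<subseteq> Q (Suc n)"
  proof
    fix r assume "r \<in> Q n"
    with * have "r \<in> ideal_sat R p (Q (Suc n))" by (rule subsetD)
    then obtain s where "s \<in> carrier R - p" "r \<in> carrier R" "s \<otimes> r \<in> Q (Suc n)"
      by (rule ideal_satE)
    then show "r \<in> Q (Suc n)"
      unfolding Q_def using ideal_satD[OF q, of s r] sub(2) by blast
  qed
  with powQ have "ideal_pow R q n \<subseteq> Q (Suc n)" by (rule subset_trans)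
  \<comment> \<open>A second use of Nakayama, now at \<open>q\<close>, puts a power of
    \<open>q\<close> into the prime \<open>q0\<close>, which is strictly smaller than
    \<open>q\<close>.\<close>
  then have "ideal_pow R q n \<subseteq> ideal_sat R q (q0 <+> q \<cdot> ideal_pow R q n)"
    by (simp add: Q_def)
  then have "ideal_pow R q n \<subseteq> ideal_sat R q q0" by (rule nakayama_sat[OF q q0I qpI])
  also have "\<dots> \<subseteq> q0" by (rule ideal_sat_prime[OF q _ q0]) (use sub in blast)
  finally have pow: "ideal_pow R q n \<subseteq> q0" .
  have "q \<subseteq> q0"
  proof
    fix y assume y: "y \<in> q"
    then have yc: "y \<in> carrier R" using ideal_simps(2)[OF qI] by blast
    then show "y \<in> q0"
      using prime_nat_pow[OF q0 yc] nat_pow_mem_ideal_pow[OF qI y, of n] pow by blast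
  qed
  then show False using sub(1) by blast
qed

lemma (in noetherian_cring) exists_maximal_prime_between:
  assumes "primeideal q R" "q \<subset> p"
  shows "\<exists>q'. primeideal q' R \<and> q \<subseteq> q' \<and> q' \<subset> p \<and>
    (\<forall>P. primeideal P R \<longrightarrow> q' \<subseteq> P \<longrightarrow> P \<subset> p \<longrightarrow> P = q')"
proof -
  have "primeideal q R \<longrightarrow> q \<subset> p \<longrightarrow> ?thesis"
    using primeideal.axioms(1)[OF assms(1)]
  proof (induction q rule: ideal_noetherian_induct)
    case (step I)
    show ?case
    proof (intro impI)
      assume I: "primeideal I R" "I \<subset> p"
      show "\<exists>q'. primeideal q' R \<and> I \<subseteq> q' \<and> q' \<subset> p \<and>
        (\<forall>P. primeideal P R \<longrightarrow> q' \<subseteq> P \<longrightarrow> P \<subset> p \<longrightarrow> P = q')"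
      proof (cases "\<forall>P. primeideal P R \<longrightarrow> I \<subseteq> P \<longrightarrow> P \<subset> p \<longrightarrow> P = I")
        case True
        then show ?thesis using I by blast
      next
        case False
        then obtain P where P: "primeideal P R" "I \<subset> P" "P \<subset> p" by blast
        then show ?thesis
          using step.IH[OF primeideal.axioms(1)[OF P(1)] P(2)] by (meson P psubset_imp_subset subset_trans)
      qed
    qed
  qed
  then show ?thesis using assms by blast
qed

text \<open>The chain may start at any prime \<open>P 0\<close>, which saves passing to the quotient
  by it. Induction on the number of generators: a prime \<open>q\<close> just below the top turns
  out to be minimal over \<open>P 0\<close> together with one element fewer.\<close>

lemma (in noetherian_cring) krull_height:
  assumes "\<And>i. i \<le> m \<Longrightarrow> primeideal (P i) R" "\<And>i. i < m \<Longrightarrow> P i \<subset> P (Suc i)"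
    and "set xs \<subseteq> P m"
    and "\<And>Q. primeideal Q R \<Longrightarrow> P 0 \<subseteq> Q \<Longrightarrow> set xs \<subseteq> Q \<Longrightarrow> Q \<subseteq> P m \<Longrightarrow> Q = P m"
  shows "m \<le> length xs"
  using assms
proof (induction "length xs" arbitrary: m P xs)
  case 0
  then have "P 0 = P m"
    using strict_chain_mono[of m P 0 m] by (cases "m = 0") auto
  then show ?case using strict_chain_mono[of m P 0 m] "0.prems"(2) by (cases "m = 0") auto
next
  case (Suc r)
  show ?case
  proof (cases "m \<le> 1")
    case True
    then show ?thesis using Suc.hyps(2) by simp
  next
    case False
    then obtain l where m: "m = Suc l" "l > 0" by (cases m) auto
    let ?p = "P m"
    have p: "primeideal ?p R" using Suc.prems(1) by simp
    have pI: "ideal ?p R" using p primeideal.axioms(1) by blast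
    \<comment> \<open>A maximal prime \<open>q\<close> below the top replaces \<open>P l\<close>;
      any generator \<open>x\<close> outside it makes the top minimal over
      \<open>q + (x)\<close>.\<close>
    obtain q where q: "primeideal q R" "P l \<subseteq> q" "q \<subset> ?p"
      and qmax: "\<And>Q. primeideal Q R \<Longrightarrow> q \<subseteq> Q \<Longrightarrow> Q \<subset> ?p \<Longrightarrow> Q = q"
      using exists_maximal_prime_between[of "P l" ?p] Suc.prems(1)[of l] Suc.prems(2)[of l] m by auto
    have qI: "ideal q R" using q primeideal.axioms(1) by blast
    have P0: "P 0 \<subseteq> q" using strict_chain_mono[of m P 0 l] Suc.prems(2) q(2) m by auto
    have "\<not> set xs \<subseteq> q" using Suc.prems(4)[OF q(1) P0] q(3) by blast
    then obtain x where x: "x \<in> set xs" "x \<notin> q" by blast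
    have xp: "x \<in> ?p" using x Suc.prems(3) by blast
    have xc: "x \<in> carrier R" using xp ideal_simps(2)[OF pI] by blast
    define ys where "ys = remove1 x xs"
    have ys: "length ys = r" "set ys \<subseteq> set xs" "set xs \<subseteq> insert x (set ys)"
    proof -
      show "length ys = r" using Suc.hyps(2) x(1) by (simp add: ys_def length_remove1)
      show "set ys \<subseteq> set xs" unfolding ys_def by (rule set_remove1_subset)
      show "set xs \<subseteq> insert x (set ys)"
      proof
        fix y assume "y \<in> set xs"
        then show "y \<in> insert x (set ys)" unfolding ys_def by (cases "y = x") auto
      qed
    qed
    note qxI = adjoin_ideal[OF qI xc]
    have "\<exists>k. ideal_pow R ?p k \<subseteq> ideal_sat R ?p (q <+> PIdl x)"
    proof (rule ideal_pow_subset_sat[OF qxI p pI])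
      fix Q assume Q: "primeideal Q R" "q <+> PIdl x \<subseteq> Q" "Q \<subseteq> ?p"
      then have "q \<subseteq> Q" "x \<in> Q" using adjoin_supset[OF qI xc] by blast+
      then have "Q = ?p" using qmax[OF Q(1)] Q(3) x(2) by blast
      then show "?p \<subseteq> Q" by simp
    qed
    then obtain k where k: "ideal_pow R ?p k \<subseteq> ideal_sat R ?p (q <+> PIdl x)" by blast
    \<comment> \<open>Modulo \<open>x\<close> and up to factors outside the top, a power of each
      remaining generator \<open>y\<close> is an element of \<open>q\<close>. These elements take
      over as generators one level lower.\<close>
    have "\<exists>z\<in>q. \<exists>s\<in>carrier R - ?p. \<exists>a\<in>carrier R. s \<otimes> y [^] k = z \<oplus> a \<otimes> x" if "y \<in> set ys" for y
    proof -
      have "y \<in> ?p" using that ys(2) Suc.prems(3) by blast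
      then have "y [^] k \<in> ideal_sat R ?p (q <+> PIdl x)"
        using nat_pow_mem_ideal_pow[OF pI] k by blast
      then show ?thesis by (rule ideal_satE) (auto simp: mem_adjoin)
    qed
    then obtain z where z: "\<And>y. y \<in> set ys \<Longrightarrow> z y \<in> q"
      "\<And>y. y \<in> set ys \<Longrightarrow> \<exists>s\<in>carrier R - ?p. \<exists>a\<in>carrier R. s \<otimes> y [^] k = z y \<oplus> a \<otimes> x"
      by metis
    have "l \<le> length (map z ys)"
    proof (rule Suc.hyps(1)[of "map z ys" l "P(l := q)"])
      show "r = length (map z ys)" using ys by simp
      show "primeideal ((P(l := q)) i) R" if "i \<le> l" for i using Suc.prems(1) that m q by auto
      show "(P(l := q)) i \<subset> (P(l := q)) (Suc i)" if "i < l" for i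
        using Suc.prems(2)[of i] that m q(2) by (auto simp: fun_upd_def)
      show "set (map z ys) \<subseteq> (P(l := q)) l" using z(1) by auto
      fix Q assume Q: "primeideal Q R" "(P(l := q)) 0 \<subseteq> Q" "set (map z ys) \<subseteq> Q" "Q \<subseteq> (P(l := q)) l"
      show "Q = (P(l := q)) l"
      proof (rule ccontr)
        assume "Q \<noteq> (P(l := q)) l"
        then have Qq: "Q \<subset> q" using Q(4) by auto
        have P0Q: "P 0 \<subseteq> Q" using Q(2) m(2) by auto
        \<comment> \<open>A prime \<open>Q\<close> strictly inside \<open>q\<close> and containing
          all \<open>z y\<close> would make the top minimal over \<open>Q + (x)\<close> with
          \<open>q\<close> strictly in between, which the principal ideal theorem forbids.\<close>
        show False
        proof (rule krull_principal_ideal[OF p q(1) Q(1) Qq q(3) xp])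
          fix W assume W: "primeideal W R" "Q \<subseteq> W" "x \<in> W" "W \<subseteq> ?p"
          have WI: "ideal W R" using W primeideal.axioms(1) by blast
          have "y \<in> W" if y: "y \<in> set ys" for y
          proof -
            have yc: "y \<in> carrier R" using y ys(2) Suc.prems(3) ideal_simps(2)[OF pI] by blast
            obtain s a where sa: "s \<in> carrier R - ?p" "a \<in> carrier R" "s \<otimes> y [^] k = z y \<oplus> a \<otimes> x"
              using z(2)[OF y] by blast
            have "z y \<in> W" using Q(3) W(2) y by auto
            then have "s \<otimes> y [^] k \<in> W"
              unfolding sa(3) using ideal_simps(3,6)[OF WI] W(3) sa(2) by blast
            then have "y [^] k \<in> W"
              using primeideal.I_prime[OF W(1), of s "y [^] k"] sa(1) yc W(4) by auto
            then show "y \<in> W" by (rule prime_nat_pow[OF W(1) yc])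
          qed
          then have "set xs \<subseteq> W" using ys(3) W(3) by blast
          then show "W = ?p" using Suc.prems(4)[OF W(1)] P0Q W by blast
        qed
      qed
    qed
    then show ?thesis using ys m Suc.hyps(2) by simp
  qed
qed

section \<open>Finite dimension of local rings\<close>

lemma (in ring) krull_dim_leI:
  assumes "\<And>n P. (\<And>i. i \<le> n \<Longrightarrow> primeideal (P i) R) \<Longrightarrow> (\<And>i. i < n \<Longrightarrow> P i \<subset> P (Suc i)) \<Longrightarrow> n \<le> r"
  shows "krull_dim R \<le> enat r"
  unfolding krull_dim_def
proof (rule Sup_least, clarify)
  fix n and P :: "nat \<Rightarrow> 'a set"
  assume "\<forall>i\<le>n. primeideal (P i) R" "\<forall>i<n. P i \<subset> P (Suc i)"
  then show "enat n \<le> enat r" using assms[of n P] by simp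
qed

lemma (in noetherian_cring) ideal_subset_maximal:
  assumes "ideal I R" "carrier R \<noteq> I"
  shows "\<exists>J. maximalideal J R \<and> I \<subseteq> J"
proof -
  have "carrier R \<noteq> I \<longrightarrow> ?thesis"
    using assms(1)
  proof (induction I rule: ideal_noetherian_induct)
    case (step I)
    show ?case
    proof (cases "\<exists>J. ideal J R \<and> I \<subset> J \<and> carrier R \<noteq> J")
      case True
      then show ?thesis using step.IH by (meson psubset_imp_subset subset_trans)
    next
      case False
      then have "maximalideal I R" if "carrier R \<noteq> I"
        using that step.hyps by (intro maximalidealI) auto
      then show ?thesis by blast
    qed
  qed
  then show ?thesis using assms(2) by blast
qed

text \<open>The height bound for a finite set of generators of \<open>M\<close>: all primes lie in
  \<open>M\<close>, and \<open>M\<close> is the only prime containing these generators.\<close>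

lemma (in noetherian_local_ring) krull_dim_finite:
  "\<exists>r. krull_dim R \<le> enat r"
proof -
  interpret noetherian_cring R ..
  have M: "primeideal M R" by (rule maximalideal_prime) (rule is_maximalideal)
  have MI: "ideal M R" by (rule is_ideal)
  obtain A where A: "A \<subseteq> carrier R" "finite A" "M = Idl A" using finetely_gen[OF MI] by blast
  obtain xs where xs: "set xs = A" using finite_list[OF A(2)] by blast
  have sub: "P \<subseteq> M" if "primeideal P R" for P
    using ideal_subset_maximal[OF primeideal.axioms(1)[OF that] primeideal.I_notcarr[OF that]]
      maximal_unique by blast
  have "n \<le> length xs"
    if P: "\<And>i. i \<le> n \<Longrightarrow> primeideal (P i) R" "\<And>i. i < n \<Longrightarrow> P i \<subset> P (Suc i)" for n and P :: "nat \<Rightarrow> 'a set"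
  proof -
    have gen: "Q = M" if "primeideal Q R" "set xs \<subseteq> Q" for Q
      using sub[OF that(1)] genideal_minimal[OF primeideal.axioms(1)[OF that(1)]] A(3) xs that(2) by blast
    have AM: "set xs \<subseteq> M" using A xs genideal_self by blast
    show ?thesis
    proof (cases "P n = M")
      case True
      show ?thesis
        by (rule krull_height[where P = P]) (use P True gen AM in auto)
    next
      \<comment> \<open>The height bound needs a chain ending at \<open>M\<close>, so
        \<open>M\<close> is put on top.\<close>
      case False
      have "Suc n \<le> length xs"
      proof (rule krull_height[where P = "P(Suc n := M)"])
        show "primeideal ((P(Suc n := M)) i) R" if "i \<le> Suc n" for i using P M that by auto
        show "(P(Suc n := M)) i \<subset> (P(Suc n := M)) (Suc i)" if "i < Suc n" for i
          using P(2)[of i] sub[OF P(1)[of n]] False that by (cases "i = n") (auto simp: fun_upd_def)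
      qed (use gen AM in auto)
      then show ?thesis by simp
    qed
  qed
  then show ?thesis using krull_dim_leI by blast
qed

section \<open>Growth of colengths\<close>

text \<open>For a prime \<open>M\<close> containing \<open>I\<close> this says, in terms of primes
  of \<open>R\<close>, that \<open>R/I\<close> localised at \<open>M\<close> has dimension at most
  \<open>e\<close>.\<close>

definition prime_chain_bound :: "('a, 'm) ring_scheme \<Rightarrow> 'a set \<Rightarrow> 'a set \<Rightarrow> nat \<Rightarrow> bool" where
  "prime_chain_bound R I M e \<longleftrightarrow> (\<forall>m P. (\<forall>i\<le>m. primeideal (P i) R) \<and> (\<forall>i<m. P i \<subset> P (Suc i)) \<and>
     I \<subseteq> P 0 \<and> P m \<subseteq> M \<longrightarrow> m \<le> e)"

text \<open>A prime over \<open>I\<close> contains \<open>a\<close> or \<open>b\<close> as soon as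
  \<open>a b\<close> is in \<open>I\<close>, so the primes found for \<open>I + (a)\<close> and
  \<open>I + (b)\<close> together serve for \<open>I\<close>. Some of them may fail to be
  minimal.\<close>

lemma (in noetherian_cring) finite_primes_below:
  assumes "ideal I R"
  shows "\<exists>\<Q>. finite \<Q> \<and> (\<forall>q\<in>\<Q>. primeideal q R \<and> I \<subseteq> q) \<and>
    (\<forall>P. primeideal P R \<longrightarrow> I \<subseteq> P \<longrightarrow> (\<exists>q\<in>\<Q>. q \<subseteq> P))"
  using assms
proof (induction I rule: ideal_noetherian_induct)
  case (step I)
  note I = step.hyps
  show ?case
  proof (cases "primeideal I R")
    case True
    then show ?thesis by (intro exI[of _ "{I}"]) auto
  next
    case False
    show ?thesis
    proof (cases "carrier R = I")
      case True
      have "\<not> I \<subseteq> P" if "primeideal P R" for P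
        using primeideal.I_notcarr[OF that] ideal_simps(2)[OF primeideal.axioms(1)[OF that]] True by blast
      then show ?thesis by (intro exI[of _ "{}"]) auto
    next
      case notc: False
      then obtain a b where ab: "a \<in> carrier R" "b \<in> carrier R" "a \<otimes> b \<in> I" "a \<notin> I" "b \<notin> I"
        using ideal.primeidealCD[OF I is_cring False] by blast
      have *: "\<exists>\<Q>. finite \<Q> \<and> (\<forall>q\<in>\<Q>. primeideal q R \<and> I \<subseteq> q) \<and>
        (\<forall>P. primeideal P R \<longrightarrow> I <+> PIdl c \<subseteq> P \<longrightarrow> (\<exists>q\<in>\<Q>. q \<subseteq> P))" if "c \<in> carrier R" "c \<notin> I" for c
      proof -
        note s = adjoin_supset[OF I that(1)]
        have "I \<subset> I <+> PIdl c" using s that(2) by blast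
        from step.IH[OF adjoin_ideal[OF I that(1)] this] show ?thesis
          using s(1) by (meson subset_trans)
      qed
      obtain \<A> where \<A>: "finite \<A>" "\<forall>q\<in>\<A>. primeideal q R \<and> I \<subseteq> q"
        "\<And>P. primeideal P R \<Longrightarrow> I <+> PIdl a \<subseteq> P \<Longrightarrow> \<exists>q\<in>\<A>. q \<subseteq> P" using *[OF ab(1,4)] by blast
      obtain \<B> where \<B>: "finite \<B>" "\<forall>q\<in>\<B>. primeideal q R \<and> I \<subseteq> q"
        "\<And>P. primeideal P R \<Longrightarrow> I <+> PIdl b \<subseteq> P \<Longrightarrow> \<exists>q\<in>\<B>. q \<subseteq> P" using *[OF ab(2,5)] by blast
      have "\<exists>q\<in>\<A> \<union> \<B>. q \<subseteq> P" if P: "primeideal P R" "I \<subseteq> P" for P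
      proof -
        have PI: "ideal P R" using P(1) primeideal.axioms(1) by blast
        have "a \<in> P \<or> b \<in> P" using primeideal.I_prime[OF P(1) ab(1,2)] ab(3) P(2) by blast
        then show ?thesis
        proof
          assume "a \<in> P"
          then have "I <+> PIdl a \<subseteq> P" by (intro set_add_least[OF PI P(2)] cgenideal_minimal[OF PI])
          then show ?thesis using \<A>(3)[OF P(1)] by blast
        next
          assume "b \<in> P"
          then have "I <+> PIdl b \<subseteq> P" by (intro set_add_least[OF PI P(2)] cgenideal_minimal[OF PI])
          then show ?thesis using \<B>(3)[OF P(1)] by blast
        qed
      qed
      then show ?thesis using \<A>(1,2) \<B>(1,2) by (intro exI[of _ "\<A> \<union> \<B>"]) auto
    qed
  qed
qed

lemma (in noetherian_cring) finite_minimal_primes: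
  assumes "ideal I R"
  obtains \<Q> where "finite \<Q>" "\<And>q. q \<in> \<Q> \<Longrightarrow> primeideal q R" "\<And>q. q \<in> \<Q> \<Longrightarrow> I \<subseteq> q"
    "\<And>P. primeideal P R \<Longrightarrow> I \<subseteq> P \<Longrightarrow> \<exists>q\<in>\<Q>. q \<subseteq> P"
    "\<And>q q'. q \<in> \<Q> \<Longrightarrow> q' \<in> \<Q> \<Longrightarrow> q' \<subseteq> q \<Longrightarrow> q' = q"
proof -
  obtain \<Q> where \<Q>: "finite \<Q>" "\<forall>q\<in>\<Q>. primeideal q R \<and> I \<subseteq> q"
    "\<And>P. primeideal P R \<Longrightarrow> I \<subseteq> P \<Longrightarrow> \<exists>q\<in>\<Q>. q \<subseteq> P"
    using finite_primes_below[OF assms] by blast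
  let ?\<M> = "{q \<in> \<Q>. \<forall>q'\<in>\<Q>. q' \<subseteq> q \<longrightarrow> q' = q}"
  show ?thesis
  proof (rule that[of ?\<M>])
    show "finite ?\<M>" using \<Q>(1) by simp
    fix P assume "primeideal P R" "I \<subseteq> P"
    then obtain q where q: "q \<in> \<Q>" "q \<subseteq> P" using \<Q>(3) by blast
    then obtain m where "m \<in> \<Q>" "m \<subseteq> q" "\<forall>q'\<in>\<Q>. q' \<subseteq> m \<longrightarrow> m = q'"
      using finite_has_minimal2[OF \<Q>(1) q(1)] by blast
    then show "\<exists>q\<in>?\<M>. q \<subseteq> P" using q(2) by (intro bexI[of _ m]) auto
  qed (use \<Q>(2) in auto)
qed

lemma (in cring) prime_not_contains_Inter:
  assumes q: "primeideal q R" and N: "ideal N R" "\<not> N \<subseteq> q" and "finite \<Q>"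
    and "\<And>q'. q' \<in> \<Q> \<Longrightarrow> ideal q' R \<and> \<not> q' \<subseteq> q"
  shows "\<exists>y\<in>N. y \<notin> q \<and> (\<forall>q'\<in>\<Q>. y \<in> q')"
  using assms(4,5)
proof (induction \<Q>)
  case empty
  then show ?case using N by blast
next
  case (insert r \<Q>)
  then obtain y where y: "y \<in> N" "y \<notin> q" "\<forall>q'\<in>\<Q>. y \<in> q'" by auto
  have rI: "ideal r R" using insert.prems by simp
  obtain z where z: "z \<in> r" "z \<notin> q" using insert.prems by auto
  have c: "y \<in> carrier R" "z \<in> carrier R"
    using y z ideal_simps(2)[OF N(1)] ideal_simps(2)[OF rI] by auto
  have "z \<otimes> y \<notin> q" using primeideal.I_prime[OF q c(2,1)] y z by blast
  moreover have "z \<otimes> y \<in> N" using ideal_simps(6)[OF N(1)] y c by blast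
  moreover have "z \<otimes> y \<in> r" using ideal_simps(7)[OF rI] z c by blast
  moreover have "z \<otimes> y \<in> q'" if "q' \<in> \<Q>" for q'
    using ideal_simps(6)[of q' y z] insert.prems that y(3) c by auto
  ultimately show ?case by blast
qed

text \<open>If \<open>x\<close> avoids all primes but \<open>q\<close>, it is corrected by a
  \<open>y\<close> that lies in the other primes and not in \<open>q\<close>: \<open>x + y\<close>
  avoids them all. Incomparability provides \<open>y\<close>.\<close>

lemma (in cring) prime_avoidance:
  assumes N: "ideal N R" and "finite \<Q>" "\<And>q. q \<in> \<Q> \<Longrightarrow> primeideal q R \<and> \<not> N \<subseteq> q"
    and "\<And>q q'. q \<in> \<Q> \<Longrightarrow> q' \<in> \<Q> \<Longrightarrow> q' \<subseteq> q \<Longrightarrow> q' = q"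
  shows "\<exists>x\<in>N. \<forall>q\<in>\<Q>. x \<notin> q"
  using assms(2-)
proof (induction \<Q>)
  case empty
  then show ?case using ideal_simps(1)[OF N] by blast
next
  case (insert q \<Q>)
  have "\<exists>x\<in>N. \<forall>q\<in>\<Q>. x \<notin> q"
    by (rule insert.IH) (use insert.prems in blast)+
  then obtain x where x: "x \<in> N" "\<And>q. q \<in> \<Q> \<Longrightarrow> x \<notin> q" by blast
  have q: "primeideal q R" "\<not> N \<subseteq> q" using insert.prems by auto
  have qI: "ideal q R" using q primeideal.axioms(1) by blast
  show ?case
  proof (cases "x \<in> q")
    case False
    then show ?thesis using x by blast
  next
    case True
    have "\<exists>y\<in>N. y \<notin> q \<and> (\<forall>q'\<in>\<Q>. y \<in> q')"
    proof (rule prime_not_contains_Inter[OF q(1) N q(2) insert.hyps(1)])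
      fix q' assume q': "q' \<in> \<Q>"
      then have "q' \<noteq> q" using insert.hyps(2) by blast
      moreover have "q' \<subseteq> q \<Longrightarrow> q' = q" by (rule insert.prems(2)) (use q' in auto)
      moreover have "primeideal q' R" using insert.prems(1) q' by simp
      ultimately show "ideal q' R \<and> \<not> q' \<subseteq> q" using primeideal.axioms(1) by blast
    qed
    then obtain y where y: "y \<in> N" "y \<notin> q" "\<And>q'. q' \<in> \<Q> \<Longrightarrow> y \<in> q'" by blast
    have c: "x \<in> carrier R" "y \<in> carrier R" using x y ideal_simps(2)[OF N] by auto
    have "x \<oplus> y \<notin> q"
    proof
      assume "x \<oplus> y \<in> q"
      then have "(x \<oplus> y) \<ominus> x \<in> q" using True ideal_simps(5)[OF qI] by blast
      moreover have "(x \<oplus> y) \<ominus> x = y" using c by algebra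
      ultimately show False using y by simp
    qed
    moreover have "x \<oplus> y \<notin> q'" if q': "q' \<in> \<Q>" for q'
    proof
      assume a: "x \<oplus> y \<in> q'"
      have "ideal q' R" using insert.prems(1) q' primeideal.axioms(1) by blast
      then have "(x \<oplus> y) \<ominus> y \<in> q'" using a y(3)[OF q'] ideal_simps(5) by blast
      moreover have "(x \<oplus> y) \<ominus> y = x" using c by algebra
      ultimately show False using x(2)[OF q'] by simp
    qed
    ultimately show ?thesis using ideal_simps(3)[OF N x(1) y(1)] by blast
  qed
qed

section \<open>Systems of parameters and the growth estimate\<close>

abbreviation (in ring) adjoin_list :: "'a set \<Rightarrow> 'a list \<Rightarrow> 'a set" where
  "adjoin_list \<equiv> foldl (\<lambda>J x. J <+> PIdl x)"

lemma (in cring) adjoin_list_ideal: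
  "ideal I R \<Longrightarrow> set xs \<subseteq> carrier R \<Longrightarrow> ideal (adjoin_list I xs) R \<and> I \<subseteq> adjoin_list I xs"
proof (induction xs arbitrary: I)
  case (Cons x xs)
  have x: "x \<in> carrier R" "set xs \<subseteq> carrier R" using Cons.prems(2) by auto
  show ?case
    using Cons.IH[OF adjoin_ideal[OF Cons.prems(1) x(1)] x(2)] adjoin_supset(1)[OF Cons.prems(1) x(1)]
    by auto
qed simp

lemma (in cring) set_add_mono: "I \<subseteq> I' \<Longrightarrow> J \<subseteq> J' \<Longrightarrow> I <+> J \<subseteq> I' <+> J'"
  unfolding subset_iff mem_set_add by blast

lemma (in cring) adjoin_list_mono: "I \<subseteq> I' \<Longrightarrow> adjoin_list I xs \<subseteq> adjoin_list I' xs"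
proof (induction xs arbitrary: I I')
  case (Cons x xs)
  then show ?case using Cons.IH[OF set_add_mono[OF Cons.prems subset_refl]] by simp
qed simp

text \<open>The list is a system of parameters of \<open>R/I\<close> localised at \<open>M\<close>.
  An \<open>x\<close> in \<open>M\<close> outside the minimal primes of \<open>I\<close> that do not
  contain \<open>M\<close> lowers the bound, because a nontrivial chain above \<open>I + (x)\<close>
  can be extended downwards by such a prime.\<close>

lemma (in noetherian_cring) exists_parameters:
  assumes M: "primeideal M R" and "ideal I R" "I \<subseteq> M" "prime_chain_bound R I M e"
  shows "\<exists>xs k. length xs \<le> e \<and> set xs \<subseteq> M \<and> ideal_pow R M k \<subseteq> ideal_sat R M (adjoin_list I xs)"
  using assms(2-)
proof (induction e arbitrary: I)
  case 0
  have MI: "ideal M R" using M primeideal.axioms(1) by blast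
  have "\<exists>k. ideal_pow R M k \<subseteq> ideal_sat R M I"
  proof (rule ideal_pow_subset_sat[OF 0(1) M MI], rule ccontr)
    fix P assume P: "primeideal P R" "I \<subseteq> P" "P \<subseteq> M" "\<not> M \<subseteq> P"
    \<comment> \<open>Otherwise \<open>P\<close> and \<open>M\<close> form a chain of length 1,
      above the bound 0.\<close>
    have "Suc 0 \<le> 0"
      by (rule 0(3)[unfolded prime_chain_bound_def, rule_format, of _ "\<lambda>i. if i = 0 then P else M"])
        (use P M in auto)
    then show False by simp
  qed
  then show ?case by (intro exI[of _ "[]"]) auto
next
  case (Suc e)
  note I = Suc.prems(1)
  have MI: "ideal M R" using M primeideal.axioms(1) by blast
  obtain \<Q> where \<Q>: "finite \<Q>" "\<And>q. q \<in> \<Q> \<Longrightarrow> primeideal q R" "\<And>q. q \<in> \<Q> \<Longrightarrow> I \<subseteq> q"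
    "\<And>P. primeideal P R \<Longrightarrow> I \<subseteq> P \<Longrightarrow> \<exists>q\<in>\<Q>. q \<subseteq> P"
    "\<And>q q'. q \<in> \<Q> \<Longrightarrow> q' \<in> \<Q> \<Longrightarrow> q' \<subseteq> q \<Longrightarrow> q' = q"
    using finite_minimal_primes[OF I] by blast
  have "\<exists>x\<in>M. \<forall>q\<in>{q \<in> \<Q>. \<not> M \<subseteq> q}. x \<notin> q"
    by (rule prime_avoidance[OF MI]) (use \<Q> in auto)
  then obtain x where x: "x \<in> M" "\<And>q. q \<in> \<Q> \<Longrightarrow> \<not> M \<subseteq> q \<Longrightarrow> x \<notin> q" by blast
  have xc: "x \<in> carrier R" using x ideal_simps(2)[OF MI] by blast
  note IxI = adjoin_ideal[OF I xc] and Ix = adjoin_supset[OF I xc]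
  have "prime_chain_bound R (I <+> PIdl x) M e"
    unfolding prime_chain_bound_def
  proof (intro allI impI, elim conjE)
    fix m and P :: "nat \<Rightarrow> 'a set"
    assume P: "\<forall>i\<le>m. primeideal (P i) R" "\<forall>i<m. P i \<subset> P (Suc i)" "I <+> PIdl x \<subseteq> P 0" "P m \<subseteq> M"
    have IP: "I \<subseteq> P 0" "x \<in> P 0" using P(3) Ix by auto
    obtain q where q: "q \<in> \<Q>" "q \<subseteq> P 0" using \<Q>(4) P(1) IP(1) by blast
    show "m \<le> e"
    \<comment> \<open>If \<open>q\<close> contains \<open>M\<close>, everything from
      \<open>q\<close> up to \<open>M\<close> coincides and the chain is trivial. Otherwise
      \<open>x\<close> separates \<open>q\<close> from \<open>P 0\<close>, and \<open>q\<close> goes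
      below the chain.\<close>
    proof (cases "M \<subseteq> q")
      case True
      have "m = 0"
      proof (rule ccontr)
        assume "m \<noteq> 0"
        then have "P 0 \<subset> P m" using strict_chain_mono[of m P 0 m] P(2) by auto
        then show False using True q(2) P(4) by blast
      qed
      then show ?thesis by simp
    next
      case False
      then have "q \<subset> P 0" using x(2)[OF q(1)] IP(2) q(2) by blast
      define P' where "P' i = (case i of 0 \<Rightarrow> q | Suc j \<Rightarrow> P j)" for i
      have "Suc m \<le> Suc e"
      proof (rule Suc.prems(3)[unfolded prime_chain_bound_def, rule_format, of _ P'], intro conjI allI impI)
        show "primeideal (P' i) R" if "i \<le> Suc m" for i
          using that P(1) \<Q>(2)[OF q(1)] by (auto simp: P'_def split: nat.split)
        show "P' i \<subset> P' (Suc i)" if "i < Suc m" for i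
          using that P(2) \<open>q \<subset> P 0\<close> by (auto simp: P'_def split: nat.split)
        show "I \<subseteq> P' 0" using \<Q>(3)[OF q(1)] by (simp add: P'_def)
        show "P' (Suc m) \<subseteq> M" using P(4) by (simp add: P'_def)
      qed
      then show ?thesis by simp
    qed
  qed
  moreover have "I <+> PIdl x \<subseteq> M"
    by (intro set_add_least[OF MI Suc.prems(2)] cgenideal_minimal[OF MI x(1)])
  ultimately obtain xs k where "length xs \<le> e" "set xs \<subseteq> M"
    "ideal_pow R M k \<subseteq> ideal_sat R M (adjoin_list (I <+> PIdl x) xs)"
    using Suc.IH[OF IxI] by blast
  then show ?case using x(1) by (intro exI[of _ "x # xs"] exI[of _ k]) auto
qed

text \<open>For the first element \<open>x\<close> of the list, the ideals \<open>K + (x^i)\<close>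
  with \<open>i\<close> from \<open>n\<close> down to 0 filter \<open>R/K\<close>, since
  \<open>x^n\<close> is in \<open>K\<close>; each layer is the image of \<open>R/(K + (x))\<close>
  under multiplication by \<open>x^i\<close>. So every element of the list costs a factor
  \<open>n\<close>, and \<open>C\<close> comes from \<open>R/M^k\<close>.\<close>

lemma (in cring) residue_steps_pow_le:
  assumes M: "ideal M R" and C: "residue_steps R M (ideal_pow R M k) (carrier R) C"
    and "ideal K R" "ideal_pow R M n \<subseteq> K" "set xs \<subseteq> M" "ideal_pow R M k \<subseteq> adjoin_list K xs"
  shows "residue_steps R M K (carrier R) (C * n ^ length xs)"
  using assms(3-)
proof (induction xs arbitrary: K)
  case Nil
  have MC: "M \<subseteq> carrier R" using ideal_simps(2)[OF M] by blast
  \<comment> \<open>With no elements left, \<open>M^k\<close> lies in \<open>K\<close>; scaling by 1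
    pushes the filtration of \<open>R/M^k\<close> to \<open>R/K\<close>.\<close>
  have "residue_steps R M K (K <+> carrier R \<cdot> (PIdl \<one>)) C"
  proof (rule residue_steps_scale[OF C ideal_pow_ideal[OF M] Nil(1) one_closed _ MC])
    fix y assume "y \<in> ideal_pow R M k"
    then show "y \<otimes> \<one> \<in> K" using Nil(4) ideal_simps(2)[OF Nil(1)] by auto
  qed
  moreover have "K <+> carrier R \<cdot> (PIdl \<one>) = carrier R"
  proof (rule equalityI; rule subsetI)
    fix y assume "y \<in> K <+> carrier R \<cdot> (PIdl \<one>)"
    then show "y \<in> carrier R"
      using ideal_simps(2)[OF Nil(1)] by (auto simp: mem_add_prod_cgenideal[OF oneideal one_closed])
  next
    fix y assume y: "y \<in> carrier R"
    then have "y = \<zero> \<oplus> y \<otimes> \<one>" by simp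
    then show "y \<in> K <+> carrier R \<cdot> (PIdl \<one>)"
      using y ideal_simps(1)[OF Nil(1)] unfolding mem_add_prod_cgenideal[OF oneideal one_closed] by blast
  qed
  ultimately show ?case by simp
next
  case (Cons x xs)
  note K = Cons.prems(1)
  have MC: "M \<subseteq> carrier R" using ideal_simps(2)[OF M] by blast
  have x: "x \<in> M" "x \<in> carrier R" using Cons.prems(3) ideal_simps(2)[OF M] by auto
  note Kx = adjoin_ideal[OF K x(2)]
  let ?T = "C * n ^ length xs"
  have IH: "residue_steps R M (K <+> PIdl x) (carrier R) ?T"
    by (rule Cons.IH[OF Kx]) (use Cons.prems adjoin_supset(1)[OF K x(2)] in auto)
  define L where "L i = K <+> PIdl (x [^] i)" for i :: nat
  have xi: "x [^] i \<in> carrier R" for i :: nat using x by simp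
  have L: "ideal (L i) R" for i unfolding L_def by (rule adjoin_ideal[OF K xi])
  have one: "residue_steps R M (L (Suc i)) (L i) ?T" for i
  proof -
    have "residue_steps R M (L (Suc i)) (L (Suc i) <+> carrier R \<cdot> (PIdl (x [^] i))) ?T"
    proof (rule residue_steps_scale[OF IH Kx L xi _ MC])
      fix y assume "y \<in> K <+> PIdl x"
      then obtain u a where u: "u \<in> K" "a \<in> carrier R" "y = u \<oplus> a \<otimes> x" by (auto simp: mem_adjoin)
      have uc: "u \<in> carrier R" using u ideal_simps(2)[OF K] by blast
      have "y \<otimes> x [^] i = u \<otimes> x [^] i \<oplus> a \<otimes> (x [^] i \<otimes> x)"
        unfolding u(3) using uc u(2) x(2) xi[of i] by algebra
      then have "y \<otimes> x [^] i = u \<otimes> x [^] i \<oplus> a \<otimes> x [^] Suc i" by simp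
      then show "y \<otimes> x [^] i \<in> L (Suc i)"
        unfolding L_def mem_adjoin using ideal_simps(7)[OF K u(1) xi] u(2) by blast
    qed
    moreover have "L (Suc i) <+> carrier R \<cdot> (PIdl (x [^] i)) = L i"
    proof (rule equalityI)
      show "L (Suc i) <+> carrier R \<cdot> (PIdl (x [^] i)) \<subseteq> L i"
      proof (rule set_add_least[OF L])
        have "PIdl (x [^] Suc i) \<subseteq> L i"
        proof (rule cgenideal_minimal[OF L])
          show "x [^] Suc i \<in> L i"
            using adjoin_supset(2)[OF K xi[of i]] ideal_simps(7)[OF L _ x(2)] by (simp add: L_def)
        qed
        then show "L (Suc i) \<subseteq> L i"
          using adjoin_supset(1)[OF K xi] unfolding L_def[of "Suc i"]
          by (intro set_add_least[OF L]) (simp_all add: L_def)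
        show "carrier R \<cdot> (PIdl (x [^] i)) \<subseteq> L i"
          using adjoin_supset(2)[OF K xi[of i]] ideal_simps(6)[OF L]
          by (auto simp: mem_prod_cgenideal[OF oneideal xi] L_def)
      qed
      show "L i \<subseteq> L (Suc i) <+> carrier R \<cdot> (PIdl (x [^] i))"
      proof
        fix y assume "y \<in> L i"
        then obtain u a where u: "u \<in> K" "a \<in> carrier R" "y = u \<oplus> a \<otimes> x [^] i"
          by (auto simp: L_def mem_adjoin)
        moreover have "u \<in> L (Suc i)" using adjoin_supset(1)[OF K xi[of "Suc i"]] u(1) unfolding L_def by blast
        ultimately show "y \<in> L (Suc i) <+> carrier R \<cdot> (PIdl (x [^] i))"
          unfolding mem_add_prod_cgenideal[OF oneideal xi] by blast
      qed
    qed
    ultimately show ?thesis by simp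
  qed
  have "residue_steps R M (L i) (L 0) (i * ?T)" for i
  proof (induction i)
    case 0
    then show ?case using residue_steps_refl[of R M "L 0"] by simp
  next
    case (Suc i)
    show ?case using residue_steps_trans[OF Suc one[of i]] by simp
  qed
  from this[of n] have "residue_steps R M (L n) (L 0) (C * n ^ length (x # xs))"
    by (simp add: mult.left_commute)
  moreover have "L n = K"
  proof
    have "x [^] n \<in> K" using nat_pow_mem_ideal_pow[OF M x(1)] Cons.prems(2) by blast
    then show "L n \<subseteq> K" unfolding L_def by (intro set_add_least[OF K] cgenideal_minimal[OF K]) auto
    show "K \<subseteq> L n" unfolding L_def by (rule adjoin_supset(1)[OF K xi])
  qed
  moreover have "L 0 = carrier R"
    using ideal.one_imp_carrier[OF L[of 0]] adjoin_supset(2)[OF K xi[of 0]] by (simp add: L_def)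
  ultimately show ?case by simp
qed

lemma (in cring) maximal_residue_quotient:
  assumes "maximalideal M R" "a \<in> carrier R" "b \<in> carrier R - M"
  shows "\<exists>c\<in>carrier R. a \<ominus> c \<otimes> b \<in> M"
proof -
  interpret maximalideal M R by fact
  have M: "ideal M R" by (rule is_ideal)
  have b: "b \<in> carrier R" using assms(3) by simp
  have Mb: "ideal (M <+> PIdl b) R" by (rule adjoin_ideal[OF M b])
  have "M <+> PIdl b = carrier R"
    using I_maximal[OF Mb adjoin_supset(1)[OF M b]] adjoin_supset(2)[OF M b] ideal_simps(2)[OF Mb] assms(3)
    by blast
  then have "a \<in> M <+> PIdl b" using assms(2) by simp
  then obtain m c where mc: "m \<in> M" "c \<in> carrier R" "a = m \<oplus> c \<otimes> b"
    by (auto simp: mem_adjoin)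
  have m: "m \<in> carrier R" using ideal_simps(2)[OF M mc(1)] .
  have "a \<ominus> c \<otimes> b = m" unfolding mc(3) using m mc(2) b by algebra
  then show ?thesis using mc(1,2) by (intro bexI[of _ c]) simp_all
qed

text \<open>Elements outside a maximal ideal are invertible modulo each of its powers. This lets
  parameters, which work only up to factors outside \<open>M\<close>, control the actual
  quotients.\<close>

lemma (in cring) maximal_sat_subset:
  assumes M: "maximalideal M R" and J: "ideal J R"
  shows "ideal_sat R M J \<subseteq> J <+> ideal_pow R M n"
proof -
  interpret maximalideal M R by fact
  have MI: "ideal M R" by (rule is_ideal)
  have Mp: "primeideal M R" by (rule maximalideal_prime[OF M])
  note pI = ideal_pow_ideal[OF MI]
  show ?thesis
  proof (induction n)
    case 0
    have "ideal_sat R M J \<subseteq> carrier R" by (auto simp: ideal_sat_def)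
    then show ?case using set_add_supset(2)[OF J oneideal] by simp
  next
    case (Suc n)
    show ?case
    proof
      fix r assume r: "r \<in> ideal_sat R M J"
      then obtain s where s: "s \<in> carrier R - M" "r \<in> carrier R" "s \<otimes> r \<in> J" by (rule ideal_satE)
      obtain c where c: "c \<in> carrier R" "\<one> \<ominus> c \<otimes> s \<in> M" using maximal_residue_quotient[OF M one_closed s(1)] by blast
      from Suc r have "r \<in> J <+> ideal_pow R M n" by (rule subsetD)
      then obtain j w where jw: "j \<in> J" "w \<in> ideal_pow R M n" "r = j \<oplus> w"
        by (auto simp: mem_set_add)
      have cs: "s \<in> carrier R" "j \<in> carrier R" "w \<in> carrier R"
        using s jw ideal_simps(2)[OF J] ideal_simps(2)[OF pI] by auto
      let ?m = "\<one> \<ominus> c \<otimes> s"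
      have m: "?m \<in> carrier R" using ideal_simps(2)[OF MI c(2)] .
      \<comment> \<open>Splitting \<open>1 = c s + m\<close> with \<open>m\<close> in
        \<open>M\<close> improves the exponent: \<open>c (s r)\<close> is in \<open>J\<close>, and
        \<open>m\<close> multiplies the remainder \<open>w\<close> into the next power.\<close>
      have "r = c \<otimes> (s \<otimes> r) \<oplus> ?m \<otimes> r" using c(1) cs(1) s(2) by algebra
      also have "?m \<otimes> r = ?m \<otimes> j \<oplus> ?m \<otimes> w" unfolding jw(3) using m cs by (simp add: r_distr)
      also have "c \<otimes> (s \<otimes> r) \<oplus> (?m \<otimes> j \<oplus> ?m \<otimes> w) = (c \<otimes> (s \<otimes> r) \<oplus> ?m \<otimes> j) \<oplus> ?m \<otimes> w"
        using m cs c(1) s(2) by (simp add: a_assoc)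
      finally have "r = (c \<otimes> (s \<otimes> r) \<oplus> ?m \<otimes> j) \<oplus> ?m \<otimes> w" .
      moreover have "c \<otimes> (s \<otimes> r) \<oplus> ?m \<otimes> j \<in> J"
        using ideal_simps(3)[OF J] ideal_simps(6)[OF J] s(3) jw(1) c(1) m by blast
      moreover have "?m \<otimes> w \<in> ideal_pow R M (Suc n)" using c(2) jw(2) by (auto intro: ideal_prod.prod)
      ultimately show "r \<in> J <+> ideal_pow R M (Suc n)" unfolding mem_set_add by blast
    qed
  qed
qed

text \<open>The exponent \<open>k\<close> and the parameters, and with them \<open>C\<close>, are
  chosen before \<open>n\<close>: adding \<open>M^n\<close> to \<open>I\<close> absorbs the
  saturation for every \<open>n\<close>.\<close>

lemma (in noetherian_cring) residue_steps_growth: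
  assumes M: "maximalideal M R" and I: "ideal I R" "I \<subseteq> M" and bd: "prime_chain_bound R I M e"
  shows "\<exists>C. \<forall>n\<ge>1. \<exists>T\<le>C * n ^ e. residue_steps R M (I <+> ideal_pow R M n) (carrier R) T"
proof -
  interpret maximalideal M R by fact
  have MI: "ideal M R" by (rule is_ideal)
  have Mp: "primeideal M R" by (rule maximalideal_prime[OF M])
  note pI = ideal_pow_ideal[OF MI]
  obtain xs k where xs: "length xs \<le> e" "set xs \<subseteq> M" "ideal_pow R M k \<subseteq> ideal_sat R M (adjoin_list I xs)"
    using exists_parameters[OF Mp I bd] by blast
  have xc: "set xs \<subseteq> carrier R" using xs(2) ideal_simps(2)[OF MI] by blast
  obtain C where C: "residue_steps R M (ideal_pow R M k) (carrier R) C" using residue_steps_pow[OF MI] by blast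
  show ?thesis
  proof (rule exI[of _ C], intro allI impI)
    fix n :: nat assume n: "n \<ge> 1"
    let ?K = "I <+> ideal_pow R M n"
    have K: "ideal ?K R" by (rule add_ideals[OF I(1) pI])
    note AI = adjoin_list_ideal[OF I(1) xc] and AK = adjoin_list_ideal[OF K xc]
    note sK = set_add_supset[OF I(1) pI, of n]
    have "adjoin_list I xs <+> ideal_pow R M n \<subseteq> adjoin_list ?K xs"
      using adjoin_list_mono[OF sK(1)] sK(2) AK by (intro set_add_least) auto
    then have "ideal_pow R M k \<subseteq> adjoin_list ?K xs"
      using xs(3) maximal_sat_subset[OF M, of "adjoin_list I xs" n] AI by blast
    then have "residue_steps R M ?K (carrier R) (C * n ^ length xs)"
      by (rule residue_steps_pow_le[OF MI C K sK(2) xs(2)])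
    \<comment> \<open>There may be fewer than \<open>e\<close> parameters; comparing the powers uses
      \<open>n >= 1\<close>.\<close>
    moreover have "C * n ^ length xs \<le> C * n ^ e" using xs(1) n by (simp add: power_increasing)
    ultimately show "\<exists>T\<le>C * n ^ e. residue_steps R M ?K (carrier R) T" by blast
  qed
qed

text \<open>Submodules of \<open>R/D\<close> pull back to ideals over \<open>D\<close>, hence over
  \<open>K\<close>, so the steps from \<open>K\<close> to \<open>R\<close> bound every chain of
  them.\<close>

lemma (in cring) length_quot_le:
  assumes M: "maximalideal M R" and K: "ideal K R" and D: "ideal D R" "K \<subseteq> D"
    and T: "residue_steps R M K (carrier R) T"
  shows "module_length R (quot_module R D) \<le> enat T"
  unfolding module_length_def
proof (rule Sup_least, clarify)
  fix t and H :: "nat \<Rightarrow> 'a set set"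
  assume H: "\<forall>i\<le>t. submodule (H i) R (quot_module R D)" "\<forall>i<t. H i \<subset> H (Suc i)"
  interpret D: ideal D R by fact
  interpret M: maximalideal M R by fact
  let ?Q = "quot_module R D"
  have Qc: "carrier ?Q = a_rcosets D" and Qz: "\<zero>\<^bsub>?Q\<^esub> = D"
    and Qa: "\<And>Y Z. Y \<oplus>\<^bsub>?Q\<^esub> Z = Y <+> Z"
    and Qm: "\<And>r Y. r \<odot>\<^bsub>?Q\<^esub> Y = (D +> r) \<otimes>\<^bsub>R Quot D\<^esub> Y"
    by (simp_all add: quot_module_def FactRing_def ring.defs module.defs)
  define L where "L i = {r \<in> carrier R. D +> r \<in> H i}" for i
  have sub: "H i \<subseteq> a_rcosets D" if "i \<le> t" for i
  proof -
    have "submodule (H i) R ?Q" using H(1) that by blast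
    from subgroup.subset[OF submodule.axioms(1)[OF this]] show ?thesis by (simp add: Qc)
  qed
  have LI: "ideal (L i) R" "D \<subseteq> L i" if i: "i \<le> t" for i
  proof -
    interpret S: submodule "H i" R ?Q using H(1) i by blast
    have Z: "D \<in> H i" using S.one_closed Qz by simp
    have D0: "D +> r = D" if "r \<in> D" for r using a_rcos_zero[OF D(1) that] .
    show "D \<subseteq> L i" using Z D0 D.a_subset by (auto simp: L_def)
    have mul: "a \<otimes> x \<in> L i" if "a \<in> carrier R" "x \<in> L i" for a x
    proof -
      have "a \<odot>\<^bsub>?Q\<^esub> (D +> x) \<in> H i" by (rule S.smult_closed) (use that in \<open>auto simp: L_def\<close>)
      then show ?thesis using that unfolding Qm L_def
        by (simp add: FactRing_def D.rcoset_mult_add)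
    qed
    show "ideal (L i) R"
    proof (rule idealI')
      show "\<zero> \<in> L i" using Z D0[of \<zero>] by (simp add: L_def)
      show "x \<oplus> y \<in> L i" if "x \<in> L i" "y \<in> L i" for x y
        using that S.m_closed[of "D +> x" "D +> y"] D.a_rcos_sum[of x y]
        by (simp add: L_def Qa)
      show "a \<otimes> x \<in> L i" if "a \<in> carrier R" "x \<in> L i" for a x using mul that .
      then show "x \<otimes> a \<in> L i" if "a \<in> carrier R" "x \<in> L i" for a x
        using mul[OF that] that m_comm[of a x] by (simp add: L_def)
    qed (auto simp: L_def)
  qed
  have "t \<le> T"
  proof (rule residue_steps_chain[OF T K M.is_ideal, where B = "carrier R" and S = "{\<one>}" and H = L])
    show "\<exists>s\<in>{\<one>}. \<exists>c\<in>carrier R. s \<otimes> a \<ominus> c \<otimes> b \<in> M" if "a \<in> carrier R" "b \<in> carrier R - M" for a b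
      using maximal_residue_quotient[OF M that] that by simp
    show "saturated_sub R (carrier R) {\<one>} (L i)" if "i \<le> t" for i
      using LI(1)[OF that] ideal_simps(6) unfolding saturated_sub_def
      by (auto intro: ideal.axioms(1))
    show "K \<subseteq> L i" if "i \<le> t" for i using LI(2)[OF that] D(2) by blast
    show "L i \<subset> L (Suc i)" if i: "i < t" for i
    proof -
      have s: "H i \<subset> H (Suc i)" using H(2) i by blast
      then obtain Y where Y: "Y \<in> H (Suc i)" "Y \<notin> H i" by blast
      then obtain r where "r \<in> carrier R" "Y = D +> r"
        using sub[of "Suc i"] i by (auto simp: A_RCOSETS_def')
      then have "r \<in> L (Suc i)" "r \<notin> L i" using Y by (auto simp: L_def)
      moreover have "L i \<subseteq> L (Suc i)" using s by (auto simp: L_def)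
      ultimately show ?thesis by blast
    qed
  qed auto
  then show "enat t \<le> enat T" by simp
qed

section \<open>Differential operators and differential powers\<close>

lemma (in ring) lin_end_simps:
  assumes "\<delta> \<in> lin_end R A"
  shows "x \<in> carrier R \<Longrightarrow> \<delta> x \<in> carrier R"
    "x \<in> carrier R \<Longrightarrow> y \<in> carrier R \<Longrightarrow> \<delta> (x \<oplus> y) = \<delta> x \<oplus> \<delta> y"
    "a \<in> A \<Longrightarrow> x \<in> carrier R \<Longrightarrow> \<delta> (a \<otimes> x) = a \<otimes> \<delta> x"
    "\<delta> \<zero> = \<zero>"
proof -
  show 1: "x \<in> carrier R \<Longrightarrow> \<delta> x \<in> carrier R" for x
    using assms by (auto simp: lin_end_def hom_def)
  show 2: "x \<in> carrier R \<Longrightarrow> y \<in> carrier R \<Longrightarrow> \<delta> (x \<oplus> y) = \<delta> x \<oplus> \<delta> y" for x y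
    using assms by (auto simp: lin_end_def hom_def)
  show "a \<in> A \<Longrightarrow> x \<in> carrier R \<Longrightarrow> \<delta> (a \<otimes> x) = a \<otimes> \<delta> x"
    using assms by (auto simp: lin_end_def)
  show "\<delta> \<zero> = \<zero>"
    using 2[of \<zero> \<zero>] 1[of \<zero>] by (simp add: add.l_cancel_one)
qed

lemma (in ring) lin_endI:
  assumes "\<And>x. x \<in> carrier R \<Longrightarrow> \<delta> x \<in> carrier R"
    "\<And>x y. x \<in> carrier R \<Longrightarrow> y \<in> carrier R \<Longrightarrow> \<delta> (x \<oplus> y) = \<delta> x \<oplus> \<delta> y"
    "\<And>a x. a \<in> A \<Longrightarrow> x \<in> carrier R \<Longrightarrow> \<delta> (a \<otimes> x) = a \<otimes> \<delta> x"
  shows "\<delta> \<in> lin_end R A"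
  using assms by (auto simp: lin_end_def hom_def)

lemma (in ring) diff_op_le_lin_end:
  assumes "\<delta> \<in> diff_op_le R A n" "A \<subseteq> carrier R"
  shows "\<delta> \<in> lin_end R A"
  using assms by (cases n) (auto simp: lin_end_def)

text \<open>Operators are arbitrary off the carrier, and algebraic identities between commutators
  hold only on it; this is how an operator is replaced by an equal one.\<close>

lemma (in ring) diff_op_le_ext:
  assumes "\<delta> \<in> diff_op_le R A n" "A \<subseteq> carrier R" "\<And>x. x \<in> carrier R \<Longrightarrow> \<delta>' x = \<delta> x"
  shows "\<delta>' \<in> diff_op_le R A n"
  using assms(1,3)
proof (induction n arbitrary: \<delta> \<delta>')
  case 0
  then have "\<delta> \<in> lin_end R (carrier R)" by simp
  note L = lin_end_simps[OF this]
  show ?case unfolding diff_op_le.simps using L 0(2) by (intro lin_endI) auto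
next
  case (Suc n)
  have "\<delta> \<in> lin_end R A" using Suc.prems by simp
  note L = lin_end_simps[OF this]
  have "\<delta>' \<in> lin_end R A"
    using L Suc.prems(2) assms(2) by (intro lin_endI) (auto simp: subset_iff)
  moreover have "(\<lambda>x. \<delta>' (r \<otimes> x) \<ominus> r \<otimes> \<delta>' x) \<in> diff_op_le R A n" if "r \<in> carrier R" for r
    by (rule Suc.IH[of "\<lambda>x. \<delta> (r \<otimes> x) \<ominus> r \<otimes> \<delta> x"]) (use Suc.prems that in auto)
  ultimately show ?case by simp
qed

text \<open>Multiplications commute, so the commutator of this operator with \<open>s\<close> is
  that of \<open>\<delta>\<close> with \<open>s\<close>, again preceded by multiplication by
  \<open>r\<close>. It makes differential powers ideals.\<close>

lemma (in cring) diff_op_le_mult: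
  assumes "\<delta> \<in> diff_op_le R A n" "A \<subseteq> carrier R" "r \<in> carrier R"
  shows "(\<lambda>x. \<delta> (r \<otimes> x)) \<in> diff_op_le R A n"
  using assms(1)
proof (induction n arbitrary: \<delta>)
  case 0
  then have "\<delta> \<in> lin_end R (carrier R)" by simp
  note L = lin_end_simps[OF this]
  show ?case unfolding diff_op_le.simps
    using L(1,2) assms(3) by (intro lin_endI) (auto simp: L(3) r_distr m_lcomm)
next
  case (Suc n)
  have "\<delta> \<in> lin_end R A" using Suc.prems by simp
  note L = lin_end_simps[OF this]
  have "(\<lambda>x. \<delta> (r \<otimes> x)) \<in> lin_end R A"
  proof (rule lin_endI)
    fix a x assume a: "a \<in> A" "x \<in> carrier R"
    have "r \<otimes> (a \<otimes> x) = a \<otimes> (r \<otimes> x)" using a assms(2,3) by (intro m_lcomm) auto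
    then show "\<delta> (r \<otimes> (a \<otimes> x)) = a \<otimes> \<delta> (r \<otimes> x)" using L(3)[of a "r \<otimes> x"] a assms(3) by simp
  qed (use L(1,2) assms(3) in \<open>auto simp: r_distr\<close>)
  moreover have "(\<lambda>x. \<delta> (r \<otimes> (s \<otimes> x)) \<ominus> s \<otimes> \<delta> (r \<otimes> x)) \<in> diff_op_le R A n" if s: "s \<in> carrier R" for s
  proof (rule diff_op_le_ext[OF Suc.IH[of "\<lambda>x. \<delta> (s \<otimes> x) \<ominus> s \<otimes> \<delta> x"] assms(2)])
    show "(\<lambda>x. \<delta> (s \<otimes> x) \<ominus> s \<otimes> \<delta> x) \<in> diff_op_le R A n" using Suc.prems s by simp
    show "\<delta> (r \<otimes> (s \<otimes> x)) \<ominus> s \<otimes> \<delta> (r \<otimes> x) = \<delta> (s \<otimes> (r \<otimes> x)) \<ominus> s \<otimes> \<delta> (r \<otimes> x)"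
      if "x \<in> carrier R" for x using that s assms(3) by (simp add: m_lcomm)
  qed
  ultimately show ?case by simp
qed

text \<open>Leibniz rule: \<open>\<delta> (a x)\<close> is \<open>a \<delta> x\<close> plus the
  value at \<open>x\<close> of the commutator with \<open>a\<close>, an operator of smaller
  order.\<close>

lemma (in cring) diff_op_le_prod_mem:
  assumes \<delta>: "\<delta> \<in> diff_op_le R A (Suc n)" and A: "A \<subseteq> carrier R" and I: "ideal I R"
    and ax: "a \<in> carrier R" "x \<in> carrier R" "a \<otimes> \<delta> x \<in> I"
    and c: "\<And>\<epsilon>. \<epsilon> \<in> diff_op_le R A n \<Longrightarrow> \<epsilon> x \<in> I"
  shows "\<delta> (a \<otimes> x) \<in> I"
proof -
  note L = lin_end_simps[OF diff_op_le_lin_end[OF \<delta> A]]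
  have "(\<lambda>x. \<delta> (a \<otimes> x) \<ominus> a \<otimes> \<delta> x) \<in> diff_op_le R A n" using \<delta> ax by simp
  then have "\<delta> (a \<otimes> x) \<ominus> a \<otimes> \<delta> x \<in> I" using c by blast
  then have "(\<delta> (a \<otimes> x) \<ominus> a \<otimes> \<delta> x) \<oplus> a \<otimes> \<delta> x \<in> I" using ideal_simps(3)[OF I] ax by blast
  moreover have "(\<delta> (a \<otimes> x) \<ominus> a \<otimes> \<delta> x) \<oplus> a \<otimes> \<delta> x = \<delta> (a \<otimes> x)"
    using L(1) ax by (simp add: a_minus_def a_assoc l_neg)
  ultimately show ?thesis by simp
qed

lemma (in cring) diff_power_ideal:
  assumes M: "ideal M R" and A: "A \<subseteq> carrier R"
  shows "ideal (diff_power R A M n) R"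
proof (cases n)
  case 0
  then show ?thesis by (simp add: oneideal)
next
  case (Suc m)
  have l: "a \<otimes> x \<in> diff_power R A M n" if "a \<in> carrier R" "x \<in> diff_power R A M n" for a x
    using that diff_op_le_mult[OF _ A that(1), of _ m] unfolding Suc by auto
  show ?thesis
  proof (rule idealI')
    have "\<delta> \<zero> \<in> M" if "\<delta> \<in> diff_op_le R A m" for \<delta>
      using lin_end_simps(4)[OF diff_op_le_lin_end[OF that A]] ideal_simps(1)[OF M] by simp
    then show "\<zero> \<in> diff_power R A M n" by (simp add: Suc)
    have "\<delta> (x \<oplus> y) \<in> M"
      if "x \<in> diff_power R A M n" "y \<in> diff_power R A M n" "\<delta> \<in> diff_op_le R A m" for x y \<delta>
      using that(1,2) lin_end_simps(2)[OF diff_op_le_lin_end[OF that(3) A]] ideal_simps(3)[OF M] that(3)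
      by (simp add: Suc)
    then show "x \<oplus> y \<in> diff_power R A M n" if "x \<in> diff_power R A M n" "y \<in> diff_power R A M n" for x y
      using that by (simp add: Suc)
    show "a \<otimes> x \<in> diff_power R A M n" if "a \<in> carrier R" "x \<in> diff_power R A M n" for a x
      using l that .
    then show "x \<otimes> a \<in> diff_power R A M n" if "a \<in> carrier R" "x \<in> diff_power R A M n" for a x
      using that m_comm[of x a] by (simp add: Suc)
  qed (auto simp: Suc)
qed

text \<open>By the Leibniz rule each factor from \<open>M\<close> absorbs one order of the
  operator.\<close>

lemma (in cring) ideal_pow_subset_diff_power:
  assumes M: "ideal M R" and A: "A \<subseteq> carrier R"
  shows "ideal_pow R M n \<subseteq> diff_power R A M n"
proof (induction n)
  case (Suc n)
  have "M \<cdot> ideal_pow R M n \<subseteq> diff_power R A M (Suc n)"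
  proof (rule ideal_prod_least[OF diff_power_ideal[OF M A]])
    fix a x assume a: "a \<in> M" and x: "x \<in> ideal_pow R M n"
    have ac: "a \<in> carrier R" and xc: "x \<in> carrier R"
      using a x ideal_simps(2)[OF M] ideal_simps(2)[OF ideal_pow_ideal[OF M]] by auto
    have xd: "x \<in> diff_power R A M n" using x Suc by blast
    have "\<delta> (a \<otimes> x) \<in> M" if \<delta>: "\<delta> \<in> diff_op_le R A n" for \<delta>
    proof (cases n)
      case 0
      then have "\<delta> \<in> lin_end R (carrier R)" using \<delta> by simp
      then show ?thesis using lin_end_simps(1,3) ac xc ideal_simps(7)[OF M a] by metis
    next
      case n: (Suc m)
      note L = lin_end_simps[OF diff_op_le_lin_end[OF \<delta> A]]
      show ?thesis
        by (rule diff_op_le_prod_mem[OF \<delta>[unfolded n] A M ac xc])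
          (use ideal_simps(7)[OF M a] L(1)[OF xc] xd n in auto)
    qed
    then show "a \<otimes> x \<in> diff_power R A M (Suc n)" using ac xc by simp
  qed
  then show ?case by simp
qed simp

text \<open>The ideal \<open>P\<close> of the overview; the theorem is reduced to its
  vanishing.\<close>

definition diff_core :: "('a, 'm) ring_scheme \<Rightarrow> 'a set \<Rightarrow> 'a set \<Rightarrow> 'a set" where
  "diff_core R A M = {f \<in> carrier R. \<forall>\<delta>\<in>diff_op R A. \<delta> f \<in> M}"

lemma (in cring) diff_core_subset_diff_power: "diff_core R A M \<subseteq> diff_power R A M n"
  by (cases n) (auto simp: diff_core_def diff_op_def)

lemma (in cring) diff_core_ideal:
  assumes M: "ideal M R" and A: "A \<subseteq> carrier R"
  shows "ideal (diff_core R A M) R"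
proof -
  have "diff_core R A M = (\<Inter>n. diff_power R A M n)"
  proof
    show "diff_core R A M \<subseteq> (\<Inter>n. diff_power R A M n)" using diff_core_subset_diff_power by blast
    show "(\<Inter>n. diff_power R A M n) \<subseteq> diff_core R A M"
    proof
      fix f assume f: "f \<in> (\<Inter>n. diff_power R A M n)"
      then have "f \<in> diff_power R A M 0" by blast
      moreover have "\<delta> f \<in> M" if "\<delta> \<in> diff_op_le R A n" for \<delta> n
      proof -
        have "f \<in> diff_power R A M (Suc n)" using f by blast
        then show ?thesis using that by simp
      qed
      ultimately show "f \<in> diff_core R A M" by (auto simp: diff_core_def diff_op_def)
    qed
  qed
  moreover have "ideal (\<Inter>n. diff_power R A M n) R"
    by (rule i_Intersect) (auto intro: diff_power_ideal[OF M A])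
  ultimately show ?thesis by simp
qed

lemma (in ring) diff_op_id: "A \<subseteq> carrier R \<Longrightarrow> (\<lambda>x. x) \<in> diff_op R A"
  unfolding diff_op_def by (rule UN_I[of 0]) (auto intro: lin_endI)

text \<open>The power \<open>(s y)^(k+1)\<close> is a multiple of \<open>s y^k\<close>.\<close>

lemma (in cring) reduced_annihilator:
  assumes red: "reduced_ring R" and y: "y \<in> carrier R" and s: "s \<in> carrier R"
    and "s \<otimes> y [^] (k::nat) = \<zero>"
  shows "s \<otimes> y = \<zero>"
proof -
  have "(s \<otimes> y) [^] Suc k = s [^] Suc k \<otimes> y [^] Suc k" using s y by (rule nat_pow_distrib)
  also have "\<dots> = s [^] k \<otimes> y \<otimes> (s \<otimes> y [^] k)"
    using s y nat_pow_closed[OF s, of k] nat_pow_closed[OF y, of k] by (simp, algebra)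
  also have "\<dots> = \<zero>" using assms s y by simp
  finally show ?thesis using red s y unfolding reduced_ring_def by blast
qed

text \<open>Every element of a minimal prime of a reduced ring is killed by some element outside it.\<close>

lemma (in noetherian_cring) minimal_prime_diff_stable:
  assumes red: "reduced_ring R" and A: "A \<subseteq> carrier R" and q: "primeideal q R"
    and min: "\<And>P. primeideal P R \<Longrightarrow> P \<subseteq> q \<Longrightarrow> P = q"
  shows "diff_stable R A q"
proof -
  have qI: "ideal q R" using q primeideal.axioms(1) by blast
  \<comment> \<open>By minimality \<open>q\<close> is the only prime inside \<open>q\<close>, so a
    power of \<open>q\<close> vanishes up to factors outside \<open>q\<close>.\<close>
  obtain k where k: "ideal_pow R q k \<subseteq> ideal_sat R q {\<zero>}"
    using ideal_pow_subset_sat[OF zeroideal q qI] min by blast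
  have "\<delta> y \<in> q" if "\<delta> \<in> diff_op_le R A n" and y: "y \<in> q" for \<delta> y n
  proof -
    have yc: "y \<in> carrier R" using y ideal_simps(2)[OF qI] by blast
    have "y [^] k \<in> ideal_sat R q {\<zero>}" using k nat_pow_mem_ideal_pow[OF qI y] by blast
    then obtain s where s: "s \<in> carrier R - q" "s \<otimes> y [^] k = \<zero>" by (auto simp: ideal_sat_def)
    then have sy: "s \<otimes> y = \<zero>" using reduced_annihilator[OF red yc] by blast
    show ?thesis
      using that(1)
    proof (induction n arbitrary: \<delta>)
      case 0
      then have "\<delta> \<in> lin_end R (carrier R)" by simp
      note L = lin_end_simps[OF this]
      have "\<delta> y = y \<otimes> \<delta> \<one>" using L(3)[of y \<one>] yc by simp
      then show ?case using ideal_simps(7)[OF qI y] L(1) by simp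
    next
      case (Suc n)
      note L = lin_end_simps[OF diff_op_le_lin_end[OF Suc.prems A]]
      \<comment> \<open>Since \<open>s y = 0\<close>, the commutator with \<open>s\<close> takes
        \<open>y\<close> to \<open>- s \<delta> y\<close>. It has smaller order, so this value is in
        \<open>q\<close>, while \<open>s\<close> is not.\<close>
      have "(\<lambda>x. \<delta> (s \<otimes> x) \<ominus> s \<otimes> \<delta> x) \<in> diff_op_le R A n" using Suc.prems s by simp
      then have "\<delta> (s \<otimes> y) \<ominus> s \<otimes> \<delta> y \<in> q" by (rule Suc.IH)
      then have "\<ominus> (\<delta> (s \<otimes> y) \<ominus> s \<otimes> \<delta> y) \<in> q" by (rule ideal_simps(4)[OF qI])
      moreover have "\<ominus> (\<delta> (s \<otimes> y) \<ominus> s \<otimes> \<delta> y) = s \<otimes> \<delta> y"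
        using L(1)[OF yc] L(4) s(1) by (simp add: sy a_minus_def)
      ultimately show ?case using primeideal.I_prime[OF q, of s "\<delta> y"] L(1)[OF yc] s(1) by auto
    qed
  qed
  then show ?thesis by (auto simp: diff_stable_def diff_op_def)
qed

text \<open>What the local and the graded case share. The first axiom says that \<open>R\<close>
  embeds in its localisation at \<open>M\<close>; the second gives \<open>the_enat\<close> in the
  signature its meaning.\<close>

locale local_like_ring = noetherian_cring R + maximalideal M R for R (structure) and M +
  assumes torsion_free: "\<lbrakk>s \<in> carrier R - M; y \<in> carrier R; s \<otimes> y = \<zero>\<rbrakk> \<Longrightarrow> y = \<zero>"
    and krull_dim_finite: "\<exists>r. krull_dim R \<le> enat r"

context local_like_ring
begin

text \<open>If \<open>p\<close> were a minimal prime, each minimal prime inside \<open>M\<close>,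
  being stable, would lie in the core and hence equal \<open>p\<close>. Then every prime inside
  \<open>M\<close> contains \<open>p\<close>, so a power of \<open>p\<close> vanishes up to factors
  outside \<open>M\<close>. As \<open>R\<close> is reduced and torsion free, \<open>p\<close> is
  zero, and the core with it.\<close>

lemma exists_smaller_prime:
  assumes red: "reduced_ring R" and A: "A \<subseteq> carrier R" and core: "diff_core R A M \<noteq> {\<zero>}"
    and p: "primeideal p R" "diff_core R A M \<subseteq> p"
  shows "\<exists>q. primeideal q R \<and> q \<subset> p"
proof (rule ccontr)
  assume "\<not> ?thesis"
  then have min: "P = p" if "primeideal P R" "P \<subseteq> p" for P using that by blast
  have MI: "ideal M R" by (rule is_ideal)
  have Mp: "primeideal M R" by (rule maximalideal_prime[OF is_maximalideal])
  have pI: "ideal p R" using p primeideal.axioms(1) by blast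
  obtain \<Q> where \<Q>: "\<And>q. q \<in> \<Q> \<Longrightarrow> primeideal q R"
    "\<And>P. primeideal P R \<Longrightarrow> {\<zero>} \<subseteq> P \<Longrightarrow> \<exists>q\<in>\<Q>. q \<subseteq> P"
    "\<And>q q'. q \<in> \<Q> \<Longrightarrow> q' \<in> \<Q> \<Longrightarrow> q' \<subseteq> q \<Longrightarrow> q' = q"
    using finite_minimal_primes[OF zeroideal] by metis
  have zero: "{\<zero>} \<subseteq> P" if "primeideal P R" for P
    using ideal_simps(1)[OF primeideal.axioms(1)[OF that]] by simp
  have "p \<subseteq> P" if P: "primeideal P R" "P \<subseteq> M" for P
  proof -
    obtain q where q: "q \<in> \<Q>" "q \<subseteq> P" using \<Q>(2)[OF P(1) zero[OF P(1)]] by blast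
    have "P' = q" if P': "primeideal P' R" "P' \<subseteq> q" for P'
      using \<Q>(2)[OF P'(1) zero[OF P'(1)]] \<Q>(3)[OF q(1)] P'(2) by blast
    then have "diff_stable R A q" by (intro minimal_prime_diff_stable[OF red A \<Q>(1)[OF q(1)]])
    moreover have "q \<subseteq> carrier R" using ideal_simps(2)[OF primeideal.axioms(1)[OF \<Q>(1)[OF q(1)]]] by blast
    ultimately have "q \<subseteq> diff_core R A M"
      using q(2) P(2) unfolding diff_core_def diff_stable_def by blast
    then have "q = p" using min[OF \<Q>(1)[OF q(1)]] p(2) by blast
    then show ?thesis using q(2) by simp
  qed
  then obtain k where k: "ideal_pow R p k \<subseteq> ideal_sat R M {\<zero>}"
    using ideal_pow_subset_sat[OF zeroideal Mp pI] by blast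
  have "y = \<zero>" if y: "y \<in> p" for y
  proof -
    have yc: "y \<in> carrier R" using y ideal_simps(2)[OF pI] by blast
    have "y [^] k \<in> ideal_sat R M {\<zero>}" using k nat_pow_mem_ideal_pow[OF pI y] by blast
    then obtain s where s: "s \<in> carrier R - M" "s \<otimes> y [^] k = \<zero>" by (auto simp: ideal_sat_def)
    then show ?thesis using reduced_annihilator[OF red yc] torsion_free[OF s(1) yc] by blast
  qed
  then show False using core p(2) ideal_simps(1)[OF diff_core_ideal[OF MI A]] by blast
qed

theorem diff_core_eq_zero:
  assumes red: "reduced_ring R" and A: "A \<subseteq> carrier R" and sig: "diff_signature R A M > 0"
  shows "diff_core R A M = {\<zero>}"
proof (rule ccontr)
  assume core: "diff_core R A M \<noteq> {\<zero>}"
  let ?I = "diff_core R A M"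
  have MI: "ideal M R" by (rule is_ideal)
  have Mp: "primeideal M R" by (rule maximalideal_prime[OF is_maximalideal])
  note I = diff_core_ideal[OF MI A]
  have IM: "?I \<subseteq> M" using diff_op_id[OF A] by (auto simp: diff_core_def)
  define d where "d = the_enat (krull_dim R)"
  have d: "krull_dim R = enat d"
    using krull_dim_finite unfolding d_def by (cases "krull_dim R") auto
  \<comment> \<open>A chain over the core can be extended at its lower end, so it falls short of
    \<open>d\<close> by one.\<close>
  have chain: "Suc m \<le> d"
    if P: "\<forall>i\<le>m. primeideal (P i) R" "\<forall>i<m. P i \<subset> P (Suc i)" "?I \<subseteq> P 0" for m and P :: "nat \<Rightarrow> 'a set"
  proof -
    obtain q where q: "primeideal q R" "q \<subset> P 0"
      using exists_smaller_prime[OF red A core, of "P 0"] P(1,3) by auto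
    define P' where "P' i = (case i of 0 \<Rightarrow> q | Suc j \<Rightarrow> P j)" for i
    have "\<forall>i\<le>Suc m. primeideal (P' i) R" "\<forall>i<Suc m. P' i \<subset> P' (Suc i)"
      using P q by (auto simp: P'_def split: nat.split)
    then have "enat (Suc m) \<le> krull_dim R"
      unfolding krull_dim_def by (intro Sup_upper) blast
    then show ?thesis by (simp add: d)
  qed
  \<comment> \<open>The chain consisting of \<open>M\<close> alone shows \<open>d >= 1\<close>, so
    that the exponent \<open>d - 1\<close> makes sense.\<close>
  have "d \<ge> 1" using chain[of 0 "\<lambda>_. M"] Mp IM by simp
  then obtain e where e: "d = Suc e" by (cases d) auto
  have "prime_chain_bound R ?I M e"
    unfolding prime_chain_bound_def using chain e by auto
  then obtain C where C: "\<And>n. n \<ge> 1 \<Longrightarrow> \<exists>T\<le>C * n ^ e. residue_steps R M (?I <+> ideal_pow R M n) (carrier R) T"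
    using residue_steps_growth[OF is_maximalideal I IM] by metis
  let ?len = "\<lambda>n. module_length R (quot_module R (diff_power R A M n))"
  have len: "?len n \<le> enat (C * n ^ e)" if n: "n \<ge> 1" for n
  proof -
    obtain T where T: "T \<le> C * n ^ e" "residue_steps R M (?I <+> ideal_pow R M n) (carrier R) T"
      using C[OF n] by blast
    have "?I <+> ideal_pow R M n \<subseteq> diff_power R A M n"
      by (intro set_add_least diff_power_ideal[OF MI A] diff_core_subset_diff_power
          ideal_pow_subset_diff_power[OF MI A])
    then have "?len n \<le> enat T"
      by (intro length_quot_le[OF is_maximalideal _ _ _ T(2)] add_ideals I ideal_pow_ideal[OF MI]
          diff_power_ideal[OF MI A])
    then show ?thesis using T(1) by (meson enat_ord_simps(1) order_trans)
  qed
  \<comment> \<open>The quotient of \<open>C n^(d-1)\<close> by \<open>n^d / d!\<close> is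
    \<open>C d! / n\<close>.\<close>
  have "ereal_of_enat (?len n) / ereal (real n ^ d / fact d) \<le> ereal (real C * fact d / real n)"
    if n: "n \<ge> 1" for n
  proof -
    have "ereal_of_enat (?len n) \<le> ereal (real (C * n ^ e))"
      using len[OF n] by (metis ereal_of_enat_le_iff ereal_of_enat_simps(1))
    then have "ereal_of_enat (?len n) / ereal (real n ^ d / fact d) \<le>
        ereal (real (C * n ^ e)) / ereal (real n ^ d / fact d)"
      using n by (intro ereal_divide_right_mono) auto
    also have "\<dots> = ereal (real C * fact d / real n)"
      using n by (simp add: e field_simps del: fact_Suc)
    finally show ?thesis .
  qed
  then have "diff_signature R A M \<le> limsup (\<lambda>n. ereal (real C * fact d / real n))"
    unfolding diff_signature_def Let_def d_def[symmetric]
    by (intro Limsup_mono eventually_sequentiallyI[of 1]) auto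
  also have "\<dots> = 0"
  proof (rule lim_imp_Limsup)
    have "(\<lambda>n. real C * fact d / real n) \<longlonglongrightarrow> 0" by (rule lim_const_over_n)
    then have "(\<lambda>n. ereal (real C * fact d / real n)) \<longlonglongrightarrow> ereal 0" by (rule tendsto_ereal)
    then show "(\<lambda>n. ereal (real C * fact d / real n)) \<longlonglongrightarrow> 0" by (simp add: zero_ereal_def)
  qed simp
  finally show False using sig by simp
qed

end

lemma (in ring) diff_op_le_zero: "A \<subseteq> carrier R \<Longrightarrow> (\<lambda>x. \<zero>) \<in> diff_op_le R A n"
proof (induction n)
  case 0
  show ?case unfolding diff_op_le.simps by (intro lin_endI) auto
next
  case (Suc n)
  have "(\<lambda>x. \<zero>) \<in> lin_end R A" using Suc.prems by (intro lin_endI) (auto simp: subset_iff)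
  moreover have "(\<lambda>x. \<zero> \<ominus> r \<otimes> \<zero>) \<in> diff_op_le R A n" if "r \<in> carrier R" for r
    using Suc that by (simp add: a_minus_def)
  ultimately show ?case by simp
qed

text \<open>Needed to split a commutator with \<open>r\<close> along the homogeneous components of
  \<open>r\<close>.\<close>

lemma (in cring) diff_op_le_add:
  assumes "\<delta> \<in> diff_op_le R A n" "\<epsilon> \<in> diff_op_le R A n" and A: "A \<subseteq> carrier R"
  shows "(\<lambda>x. \<delta> x \<oplus> \<epsilon> x) \<in> diff_op_le R A n"
  using assms(1,2)
proof (induction n arbitrary: \<delta> \<epsilon>)
  case 0
  then have "\<delta> \<in> lin_end R (carrier R)" "\<epsilon> \<in> lin_end R (carrier R)" by auto
  note L = lin_end_simps[OF this(1)] and L' = lin_end_simps[OF this(2)]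
  show ?case unfolding diff_op_le.simps
    by (intro lin_endI) (auto simp: L(1,2) L'(1,2) L(3) L'(3) r_distr a_ac)
next
  case (Suc n)
  note L = lin_end_simps[OF diff_op_le_lin_end[OF Suc.prems(1) A]]
    and L' = lin_end_simps[OF diff_op_le_lin_end[OF Suc.prems(2) A]]
  have "(\<lambda>x. \<delta> x \<oplus> \<epsilon> x) \<in> lin_end R A"
  proof (rule lin_endI)
    fix a x assume ax: "a \<in> A" "x \<in> carrier R"
    then have "a \<in> carrier R" using A by blast
    then show "\<delta> (a \<otimes> x) \<oplus> \<epsilon> (a \<otimes> x) = a \<otimes> (\<delta> x \<oplus> \<epsilon> x)"
      using ax L(1) L'(1) by (simp add: L(3) L'(3) r_distr)
  qed (use L(1) L'(1) in \<open>auto simp: L(2) L'(2) a_ac\<close>)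
  moreover have "(\<lambda>x. (\<delta> (r \<otimes> x) \<oplus> \<epsilon> (r \<otimes> x)) \<ominus> r \<otimes> (\<delta> x \<oplus> \<epsilon> x)) \<in> diff_op_le R A n"
    if r: "r \<in> carrier R" for r
  proof (rule diff_op_le_ext[OF Suc.IH[of "\<lambda>x. \<delta> (r \<otimes> x) \<ominus> r \<otimes> \<delta> x" "\<lambda>x. \<epsilon> (r \<otimes> x) \<ominus> r \<otimes> \<epsilon> x"] A])
    show "(\<delta> (r \<otimes> x) \<oplus> \<epsilon> (r \<otimes> x)) \<ominus> r \<otimes> (\<delta> x \<oplus> \<epsilon> x) =
      (\<delta> (r \<otimes> x) \<ominus> r \<otimes> \<delta> x) \<oplus> (\<epsilon> (r \<otimes> x) \<ominus> r \<otimes> \<epsilon> x)" if x: "x \<in> carrier R" for x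
    proof -
      have "\<delta> (r \<otimes> x) \<in> carrier R" "\<epsilon> (r \<otimes> x) \<in> carrier R" "\<delta> x \<in> carrier R" "\<epsilon> x \<in> carrier R"
        using L(1) L'(1) r x by auto
      then show ?thesis using r by algebra
    qed
  qed (use Suc.prems r in auto)
  ultimately show ?case by simp
qed

section \<open>Graded rings\<close>

lemma (in ring) finsum_induct:
  assumes "finite S" "\<And>i. i \<in> S \<Longrightarrow> f i \<in> carrier R \<and> Q (f i)" "Q \<zero>"
    and "\<And>x y. x \<in> carrier R \<Longrightarrow> y \<in> carrier R \<Longrightarrow> Q x \<Longrightarrow> Q y \<Longrightarrow> Q (x \<oplus> y)"
  shows "Q (\<Oplus>i\<in>S. f i)"
  using assms(1,2)
proof (induction S)
  case empty
  then show ?case using assms(3) by simp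
next
  case (insert i S)
  then have "(\<Oplus>j\<in>insert i S. f j) = f i \<oplus> (\<Oplus>j\<in>S. f j)" by (intro finsum_insert) auto
  moreover have "(\<Oplus>j\<in>S. f j) \<in> carrier R" using insert by (intro finsum_closed) auto
  ultimately show ?case using insert assms(4) by simp
qed

context noetherian_graded_ring
begin

abbreviation hc :: "'a \<Rightarrow> nat \<Rightarrow> 'a" where "hc \<equiv> hcomp R G"

lemma degree_simps:
  "x \<in> G i \<Longrightarrow> x \<in> carrier R" "\<zero> \<in> G i" "x \<in> G i \<Longrightarrow> y \<in> G i \<Longrightarrow> x \<oplus> y \<in> G i"
  using subgroup.mem_carrier[OF degree_subgroup] subgroup.one_closed[OF degree_subgroup]
    subgroup.m_closed[OF degree_subgroup] by auto

lemma hdecomp_hcomp: "r \<in> carrier R \<Longrightarrow> hdecomp R G r (hc r)"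
  unfolding hcomp_def by (rule theI'[OF direct_sum])

lemma hcomp_unique: "r \<in> carrier R \<Longrightarrow> hdecomp R G r f \<Longrightarrow> hc r = f"
  unfolding hcomp_def by (rule the1_equality[OF direct_sum])

lemma hcomp_mem: "r \<in> carrier R \<Longrightarrow> hc r i \<in> G i"
  using hdecomp_hcomp by (auto simp: hdecomp_def)

lemma hcomp_closed: "r \<in> carrier R \<Longrightarrow> hc r i \<in> carrier R"
  using hcomp_mem degree_simps(1) by blast

text \<open>Only components of the given \<open>r\<close> are tested, so that special knowledge of
  them, such as membership in a homogeneous subring, can be used.\<close>

lemma hcomp_sum_induct:
  assumes r: "r \<in> carrier R" and "Q \<zero>"
    and "\<And>x y. x \<in> carrier R \<Longrightarrow> y \<in> carrier R \<Longrightarrow> Q x \<Longrightarrow> Q y \<Longrightarrow> Q (x \<oplus> y)"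
    and "\<And>i. Q (hc r i)"
  shows "Q r"
proof -
  have h: "finite {i. hc r i \<noteq> \<zero>}" "r = (\<Oplus>i\<in>{i. hc r i \<noteq> \<zero>}. hc r i)"
    using hdecomp_hcomp[OF r] by (auto simp: hdecomp_def)
  have "Q (\<Oplus>i\<in>{i. hc r i \<noteq> \<zero>}. hc r i)"
    by (rule finsum_induct[OF h(1)]) (use assms hcomp_closed[OF r] in auto)
  then show ?thesis using h(2) by simp
qed

text \<open>\<open>hdecomp\<close> sums over the exact support, which is unwieldy when terms may
  cancel; here any finite set containing the support will do.\<close>

lemma hdecomp_finsum:
  assumes "\<And>i. f i \<in> G i" "finite S" "{i. f i \<noteq> \<zero>} \<subseteq> S"
  shows "hdecomp R G (\<Oplus>i\<in>S. f i) f"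
proof -
  have "(\<Oplus>i\<in>{i. f i \<noteq> \<zero>}. f i) = (\<Oplus>i\<in>S. f i)"
    by (rule add.finprod_mono_neutral_cong_left) (use assms degree_simps(1) in auto)
  then show ?thesis using assms finite_subset by (auto simp: hdecomp_def)
qed

lemma hcomp_finite: "r \<in> carrier R \<Longrightarrow> finite {i. hc r i \<noteq> \<zero>}"
  using hdecomp_hcomp by (auto simp: hdecomp_def)

lemma hcomp_finsum:
  assumes "r \<in> carrier R" "finite S" "{i. hc r i \<noteq> \<zero>} \<subseteq> S"
  shows "r = (\<Oplus>i\<in>S. hc r i)"
proof -
  have "r = (\<Oplus>i\<in>{i. hc r i \<noteq> \<zero>}. hc r i)"
    using hdecomp_hcomp[OF assms(1)] by (auto simp: hdecomp_def)
  also have "\<dots> = (\<Oplus>i\<in>S. hc r i)"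
    by (rule add.finprod_mono_neutral_cong_left) (use assms hcomp_closed in auto)
  finally show ?thesis .
qed

lemma hcomp_add:
  assumes x: "x \<in> carrier R" and y: "y \<in> carrier R"
  shows "hc (x \<oplus> y) i = hc x i \<oplus> hc y i"
proof -
  let ?S = "{i. hc x i \<noteq> \<zero>} \<union> {i. hc y i \<noteq> \<zero>}"
  let ?f = "\<lambda>i. hc x i \<oplus> hc y i"
  have S: "finite ?S" using hcomp_finite x y by simp
  have "x \<oplus> y = (\<Oplus>i\<in>?S. hc x i) \<oplus> (\<Oplus>i\<in>?S. hc y i)"
    using hcomp_finsum[OF x S] hcomp_finsum[OF y S] by auto
  also have "\<dots> = (\<Oplus>i\<in>?S. ?f i)"
    using hcomp_closed x y by (intro finsum_addf[symmetric]) auto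
  finally have eq: "x \<oplus> y = (\<Oplus>i\<in>?S. ?f i)" .
  have "hdecomp R G (\<Oplus>i\<in>?S. ?f i) ?f"
    using hcomp_mem x y by (intro hdecomp_finsum S degree_simps(3)) auto
  then have "hdecomp R G (x \<oplus> y) ?f" by (subst eq)
  then have "hc (x \<oplus> y) = ?f" using x y by (intro hcomp_unique) auto
  then show ?thesis by simp
qed

lemma hcomp_homogeneous:
  assumes "x \<in> G i"
  shows "hc x j = (if j = i then x else \<zero>)"
proof -
  let ?f = "\<lambda>j. if j = i then x else \<zero>"
  have xc: "x \<in> carrier R" using assms degree_simps(1) by blast
  have "hdecomp R G (\<Oplus>j\<in>{i}. ?f j) ?f"
    using assms degree_simps(2) by (intro hdecomp_finsum) auto
  moreover have "(\<Oplus>j\<in>{i}. ?f j) = x" using xc by simp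
  ultimately show ?thesis using hcomp_unique[OF xc, of ?f] by simp
qed

lemma hcomp_zero: "hc \<zero> j = \<zero>"
  using hcomp_homogeneous[OF degree_simps(2), of j j] by simp

lemma hcomp_minus: "x \<in> carrier R \<Longrightarrow> hc (\<ominus> x) i = \<ominus> hc x i"
proof -
  assume x: "x \<in> carrier R"
  then have "hc (\<ominus> x) i \<oplus> hc x i = \<zero>"
    using hcomp_add[of "\<ominus> x" x i] by (simp add: l_neg hcomp_zero)
  then show ?thesis using minus_equality[of "hc (\<ominus> x) i" "hc x i"] hcomp_closed x by simp
qed

lemma hcomp_diff: "x \<in> carrier R \<Longrightarrow> y \<in> carrier R \<Longrightarrow> hc (x \<ominus> y) i = hc x i \<ominus> hc y i"
  by (simp add: a_minus_def hcomp_add hcomp_minus)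

lemma hcomp_eq_zero:
  assumes "x \<in> carrier R" "\<And>i. hc x i = \<zero>"
  shows "x = \<zero>"
  by (rule hcomp_sum_induct[OF assms(1), where Q = "\<lambda>x. x = \<zero>"]) (use assms(2) in auto)

lemma hcomp_ext:
  assumes "x \<in> carrier R" "y \<in> carrier R" "\<And>i. hc x i = hc y i"
  shows "x = y"
proof -
  have "hc (x \<ominus> y) i = \<zero>" for i
    using assms(3)[of i] hcomp_closed[OF assms(1)] hcomp_closed[OF assms(2)]
    by (simp add: hcomp_diff[OF assms(1,2)])
  then have "x \<ominus> y = \<zero>" using hcomp_eq_zero[of "x \<ominus> y"] assms(1,2) by simp
  then show ?thesis using assms(1,2) by simp
qed

text \<open>The case \<open>j < t\<close> is split off because on naturals \<open>j - t\<close>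
  would become 0.\<close>

lemma hcomp_mult_homogeneous:
  assumes a: "a \<in> G t" and x: "x \<in> carrier R"
  shows "hc (a \<otimes> x) j = (if j < t then \<zero> else a \<otimes> hc x (j - t))"
proof (rule hcomp_sum_induct[OF x, where Q = "\<lambda>x. hc (a \<otimes> x) j = (if j < t then \<zero> else a \<otimes> hc x (j - t))"])
  have ac: "a \<in> carrier R" using a degree_simps(1) by blast
  show "hc (a \<otimes> \<zero>) j = (if j < t then \<zero> else a \<otimes> hc \<zero> (j - t))" using ac by (simp add: hcomp_zero)
  show "hc (a \<otimes> (x \<oplus> y)) j = (if j < t then \<zero> else a \<otimes> hc (x \<oplus> y) (j - t))"
    if "x \<in> carrier R" "y \<in> carrier R" "hc (a \<otimes> x) j = (if j < t then \<zero> else a \<otimes> hc x (j - t))"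
      "hc (a \<otimes> y) j = (if j < t then \<zero> else a \<otimes> hc y (j - t))" for x y
    using that ac hcomp_closed by (simp add: r_distr hcomp_add)
  fix i
  have "hc (a \<otimes> hc x i) j = (if j = t + i then a \<otimes> hc x i else \<zero>)"
    by (rule hcomp_homogeneous[OF degree_mult[OF a hcomp_mem[OF x]]])
  moreover have "hc (hc x i) (j - t) = (if j - t = i then hc x i else \<zero>)"
    by (rule hcomp_homogeneous[OF hcomp_mem[OF x]])
  ultimately show "hc (a \<otimes> hc x i) j = (if j < t then \<zero> else a \<otimes> hc (hc x i) (j - t))"
    using ac by auto
qed

section \<open>Filtration by degree and the maximal ideal\<close>

definition deg_ge :: "nat \<Rightarrow> 'a set" where
  "deg_ge d = {r \<in> carrier R. \<forall>i<d. hc r i = \<zero>}"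

definition deg_le :: "nat \<Rightarrow> 'a set" where
  "deg_le d = {r \<in> carrier R. \<forall>i>d. hc r i = \<zero>}"

lemma deg_ge_add: "x \<in> deg_ge d \<Longrightarrow> y \<in> deg_ge d \<Longrightarrow> x \<oplus> y \<in> deg_ge d"
  by (auto simp: deg_ge_def hcomp_add)

lemma deg_le_add: "x \<in> deg_le d \<Longrightarrow> y \<in> deg_le d \<Longrightarrow> x \<oplus> y \<in> deg_le d"
  by (auto simp: deg_le_def hcomp_add)

lemma deg_ge_mult:
  assumes a: "a \<in> deg_ge m" and x: "x \<in> deg_ge n"
  shows "a \<otimes> x \<in> deg_ge (m + n)"
proof (rule hcomp_sum_induct[where r = a and Q = "\<lambda>a. a \<otimes> x \<in> deg_ge (m + n)"])
  have c: "a \<in> carrier R" "x \<in> carrier R" using a x by (auto simp: deg_ge_def)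
  show "a \<in> carrier R" by fact
  show "\<zero> \<otimes> x \<in> deg_ge (m + n)" using c by (simp add: deg_ge_def hcomp_zero)
  show "(y \<oplus> z) \<otimes> x \<in> deg_ge (m + n)"
    if "y \<in> carrier R" "z \<in> carrier R" "y \<otimes> x \<in> deg_ge (m + n)" "z \<otimes> x \<in> deg_ge (m + n)" for y z
    using that c deg_ge_add by (simp add: l_distr)
  fix t
  show "hc a t \<otimes> x \<in> deg_ge (m + n)"
    unfolding deg_ge_def
  proof (intro CollectI conjI allI impI)
    show "hc a t \<otimes> x \<in> carrier R" using c hcomp_closed by simp
    fix j assume j: "j < m + n"
    show "hc (hc a t \<otimes> x) j = \<zero>"
    proof (cases "t < m")
      case True
      then show ?thesis using a c by (simp add: deg_ge_def hcomp_zero)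
    next
      case False
      then show ?thesis
        using x j hcomp_closed[OF c(1)] by (simp add: hcomp_mult_homogeneous[OF hcomp_mem[OF c(1)] c(2)] deg_ge_def)
    qed
  qed
qed

lemma deg_le_mult:
  assumes a: "a \<in> deg_le m" and x: "x \<in> deg_le n"
  shows "a \<otimes> x \<in> deg_le (m + n)"
proof (rule hcomp_sum_induct[where r = a and Q = "\<lambda>a. a \<otimes> x \<in> deg_le (m + n)"])
  have c: "a \<in> carrier R" "x \<in> carrier R" using a x by (auto simp: deg_le_def)
  show "a \<in> carrier R" by fact
  show "\<zero> \<otimes> x \<in> deg_le (m + n)" using c by (simp add: deg_le_def hcomp_zero)
  show "(y \<oplus> z) \<otimes> x \<in> deg_le (m + n)"
    if "y \<in> carrier R" "z \<in> carrier R" "y \<otimes> x \<in> deg_le (m + n)" "z \<otimes> x \<in> deg_le (m + n)" for y z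
    using that c deg_le_add by (simp add: l_distr)
  fix t
  show "hc a t \<otimes> x \<in> deg_le (m + n)"
    unfolding deg_le_def
  proof (intro CollectI conjI allI impI)
    show "hc a t \<otimes> x \<in> carrier R" using c hcomp_closed by simp
    fix j assume j: "j > m + n"
    show "hc (hc a t \<otimes> x) j = \<zero>"
    proof (cases "t > m")
      case True
      then show ?thesis using a c by (simp add: deg_le_def hcomp_zero)
    next
      case False
      then show ?thesis
        using x j hcomp_closed[OF c(1)] by (simp add: hcomp_mult_homogeneous[OF hcomp_mem[OF c(1)] c(2)] deg_le_def)
    qed
  qed
qed

lemma deg_ge_ideal: "ideal (deg_ge d) R"
proof (rule idealI')
  show "a \<otimes> x \<in> deg_ge d" if "a \<in> carrier R" "x \<in> deg_ge d" for a x
    using deg_ge_mult[of a 0 x d] that by (simp add: deg_ge_def)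
  then show "x \<otimes> a \<in> deg_ge d" if "a \<in> carrier R" "x \<in> deg_ge d" for a x
    using that m_comm[of x a] by (auto simp: deg_ge_def)
qed (use deg_ge_add in \<open>auto simp: deg_ge_def hcomp_zero\<close>)

lemma M_eq: "M = deg_ge (Suc 0)"
  by (auto simp: positive_part deg_ge_def)

lemma M_ideal: "ideal M R"
  unfolding M_eq by (rule deg_ge_ideal)

lemma ideal_pow_subset_deg_ge: "ideal_pow R M n \<subseteq> deg_ge n"
proof (induction n)
  case 0
  then show ?case by (auto simp: deg_ge_def)
next
  case (Suc n)
  show ?case unfolding ideal_pow.simps
  proof (rule ideal_prod_least[OF deg_ge_ideal])
    fix a x assume "a \<in> M" "x \<in> ideal_pow R M n"
    then show "a \<otimes> x \<in> deg_ge (Suc n)" using deg_ge_mult[of a "Suc 0" x n] Suc M_eq by auto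
  qed
qed

lemma one_mem: "\<one> \<in> G 0"
proof -
  interpret K: subfield "G 0" R by (rule degree_zero_field)
  show ?thesis by (rule K.one_closed)
qed

lemma degree_zero_inverse:
  assumes "c \<in> G 0" "c \<noteq> \<zero>"
  shows "inv c \<in> G 0" "inv c \<otimes> c = \<one>" "inv c \<in> carrier R"
  using subfield_m_inv[OF degree_zero_field, of c] assms degree_simps(1) by auto

lemma degree_zero_cancel:
  assumes c: "c \<in> G 0" "c \<noteq> \<zero>" and x: "x \<in> carrier R" and "c \<otimes> x = \<zero>"
  shows "x = \<zero>"
proof -
  have "x = (inv c \<otimes> c) \<otimes> x" using degree_zero_inverse[OF c] x by simp
  also have "\<dots> = inv c \<otimes> (c \<otimes> x)"
    by (rule m_assoc[OF degree_zero_inverse(3)[OF c] degree_simps(1)[OF c(1)] x])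
  also have "\<dots> = \<zero>" using assms(4) degree_zero_inverse[OF c] by simp
  finally show ?thesis .
qed

lemma one_neq_zero: "\<one> \<noteq> \<zero>"
  using subdomain.sub_one_not_zero[OF subfield.axioms(1)[OF degree_zero_field]] by simp

lemma hcomp_zero_of_not_mem: "b \<in> carrier R - M \<Longrightarrow> hc b 0 \<noteq> \<zero>"
  by (auto simp: positive_part)

lemma ideal_eq_carrier:
  assumes J: "ideal J R" and c: "c \<in> J" "c \<in> G 0" "c \<noteq> \<zero>"
  shows "J = carrier R"
  using ideal.one_imp_carrier[OF J] ideal_simps(6)[OF J c(1), of "inv c"] degree_zero_inverse[OF c(2,3)] by simp

text \<open>An element outside \<open>M\<close> differs by an element of \<open>M\<close> from its
  constant term, which is invertible.\<close>

lemma M_maximal: "maximalideal M R"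
proof (rule maximalidealI[OF M_ideal])
  show "carrier R \<noteq> M"
  proof -
    have "\<one> \<notin> M" using hcomp_homogeneous[OF one_mem, of 0] one_neq_zero by (simp add: positive_part)
    then show ?thesis using one_closed by blast
  qed
  fix J assume J: "ideal J R" "M \<subseteq> J" "J \<subseteq> carrier R"
  show "J = M \<or> J = carrier R"
  proof (cases "J = M")
    case False
    then obtain b where b: "b \<in> J" "b \<notin> M" "b \<in> carrier R" using J by blast
    let ?c = "hc b 0"
    have c: "?c \<in> G 0" "?c \<in> carrier R" using b(3) hcomp_mem hcomp_closed by auto
    have "hc (b \<ominus> ?c) 0 = \<zero>"
      using b(3) c by (simp add: hcomp_diff hcomp_homogeneous[OF c(1)])
    then have "b \<ominus> ?c \<in> J" using J(2) b(3) c by (auto simp: positive_part)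
    then have "b \<ominus> (b \<ominus> ?c) \<in> J" using b(1) ideal_simps(5)[OF J(1)] by blast
    moreover have "b \<ominus> (b \<ominus> ?c) = ?c" using b(3) c(2) by algebra
    ultimately show ?thesis using ideal_eq_carrier[OF J(1) _ c(1)] hcomp_zero_of_not_mem b by auto
  qed simp
qed

text \<open>The components of \<open>y\<close> vanish one after the other: if those below
  \<open>i\<close> do, the component of \<open>s y\<close> in degree \<open>i\<close> is that of
  \<open>y\<close> times the constant term of \<open>s\<close>, which is invertible.\<close>

lemma graded_torsion_free:
  assumes s: "s \<in> carrier R - M" and y: "y \<in> carrier R" and 0: "s \<otimes> y = \<zero>"
  shows "y = \<zero>"
proof (rule hcomp_eq_zero[OF y])
  fix i
  show "hc y i = \<zero>"
  proof (induction i rule: less_induct)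
    case (less i)
    let ?c = "hc s 0"
    have sc: "s \<in> carrier R" using s by simp
    have c: "?c \<in> G 0" "?c \<in> carrier R" using sc hcomp_mem hcomp_closed by auto
    have "s \<ominus> ?c \<in> deg_ge (Suc 0)"
      using sc c by (simp add: deg_ge_def hcomp_diff hcomp_homogeneous[OF c(1)])
    moreover have "y \<in> deg_ge i" using less y by (simp add: deg_ge_def)
    ultimately have h: "hc ((s \<ominus> ?c) \<otimes> y) i = \<zero>"
      using deg_ge_mult[of "s \<ominus> ?c" "Suc 0" y i] by (simp add: deg_ge_def)
    have "s \<otimes> y = (s \<ominus> ?c) \<otimes> y \<oplus> ?c \<otimes> y" using sc c y by algebra
    then have "hc \<zero> i = hc ((s \<ominus> ?c) \<otimes> y \<oplus> ?c \<otimes> y) i" using 0 by simp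
    also have "\<dots> = hc ((s \<ominus> ?c) \<otimes> y) i \<oplus> hc (?c \<otimes> y) i" using c sc y by (intro hcomp_add) auto
    finally have "\<zero> = hc (?c \<otimes> y) i"
      using h c y hcomp_closed by (simp add: hcomp_zero)
    also have "\<dots> = ?c \<otimes> hc y i" using hcomp_mult_homogeneous[OF c(1) y, of i] by simp
    finally have z: "?c \<otimes> hc y i = \<zero>" by simp
    then show ?case by (rule degree_zero_cancel[OF c(1) hcomp_zero_of_not_mem[OF s] hcomp_closed[OF y]])
  qed
qed

section \<open>Dimension and differential operators of graded rings\<close>

primrec lspan :: "'a set \<Rightarrow> 'a list \<Rightarrow> 'a set" where
  "lspan P [] = P"
| "lspan P (v # vs) = {c \<otimes> v \<oplus> y | c y. c \<in> G 0 \<and> y \<in> lspan P vs}"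

text \<open>Over the field \<open>G 0\<close>, testing each vector against the later ones only is
  equivalent to linear independence modulo \<open>P\<close>; it makes the spans of final segments
  strictly increasing.\<close>

primrec independent_mod :: "'a set \<Rightarrow> 'a list \<Rightarrow> bool" where
  "independent_mod P [] \<longleftrightarrow> True"
| "independent_mod P (v # vs) \<longleftrightarrow> v \<notin> lspan P vs \<and> independent_mod P vs"

lemma lspan_carrier: "ideal P R \<Longrightarrow> set vs \<subseteq> carrier R \<Longrightarrow> lspan P vs \<subseteq> carrier R"
proof (induction vs)
  case Nil
  then show ?case using ideal_simps(2)[of P] by auto
next
  case (Cons v vs)
  then show ?case using degree_simps(1)[of _ 0] by auto
qed

lemma lspan_supset: "ideal P R \<Longrightarrow> set vs \<subseteq> carrier R \<Longrightarrow> P \<subseteq> lspan P vs"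
proof (induction vs)
  case (Cons v vs)
  have "y \<in> lspan P (v # vs)" if "y \<in> lspan P vs" for y
  proof -
    have "y = \<zero> \<otimes> v \<oplus> y" using Cons.prems lspan_carrier[of P vs] that by auto
    then show ?thesis using that degree_simps(2)[of 0] by auto
  qed
  then show ?case using Cons by auto
qed simp

lemma lspan_Cons_supset:
  assumes "ideal P R" "set vs \<subseteq> carrier R" "v \<in> carrier R"
  shows "lspan P vs \<subseteq> lspan P (v # vs)" "v \<in> lspan P (v # vs)"
proof -
  show "lspan P vs \<subseteq> lspan P (v # vs)"
  proof
    fix y assume y: "y \<in> lspan P vs"
    then have "y = \<zero> \<otimes> v \<oplus> y" using assms lspan_carrier[of P vs] by auto
    then show "y \<in> lspan P (v # vs)" using y degree_simps(2)[of 0] by auto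
  qed
  have "\<zero> \<in> lspan P vs" using lspan_supset[OF assms(1,2)] ideal_simps(1)[OF assms(1)] by blast
  moreover have "v = \<one> \<otimes> v \<oplus> \<zero>" using assms(3) by simp
  ultimately show "v \<in> lspan P (v # vs)" unfolding lspan.simps using one_mem by blast
qed

lemma lspan_add:
  assumes "ideal P R"
  shows "set vs \<subseteq> carrier R \<Longrightarrow> x \<in> lspan P vs \<Longrightarrow> y \<in> lspan P vs \<Longrightarrow> x \<oplus> y \<in> lspan P vs"
proof (induction vs arbitrary: x y)
  case Nil
  then show ?case using ideal_simps(3)[OF assms] by simp
next
  case (Cons v vs)
  obtain c x' d y' where h: "c \<in> G 0" "d \<in> G 0" "x' \<in> lspan P vs" "y' \<in> lspan P vs"
    "x = c \<otimes> v \<oplus> x'" "y = d \<otimes> v \<oplus> y'" using Cons.prems by auto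
  have cl: "c \<in> carrier R" "d \<in> carrier R" "x' \<in> carrier R" "y' \<in> carrier R" "v \<in> carrier R"
    using h degree_simps(1) lspan_carrier[OF assms, of vs] Cons.prems(1) by auto
  have "x \<oplus> y = (c \<oplus> d) \<otimes> v \<oplus> (x' \<oplus> y')" unfolding h using cl by algebra
  moreover have "x' \<oplus> y' \<in> lspan P vs" using Cons.IH h Cons.prems(1) by simp
  ultimately show ?case unfolding lspan.simps using degree_simps(3)[OF h(1,2)] by blast
qed

lemma lspan_smult:
  assumes P: "ideal P R" and b: "b \<in> G 0"
  shows "set vs \<subseteq> carrier R \<Longrightarrow> x \<in> lspan P vs \<Longrightarrow> b \<otimes> x \<in> lspan P vs"
proof (induction vs arbitrary: x)
  case Nil
  then show ?case using ideal_simps(6)[OF P] degree_simps(1)[OF b] by simp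
next
  case (Cons v vs)
  obtain c x' where h: "c \<in> G 0" "x' \<in> lspan P vs" "x = c \<otimes> v \<oplus> x'" using Cons.prems by auto
  have cl: "c \<in> carrier R" "x' \<in> carrier R" "v \<in> carrier R" "b \<in> carrier R"
    using h b degree_simps(1) lspan_carrier[OF P, of vs] Cons.prems(1) by auto
  have "b \<otimes> x = (b \<otimes> c) \<otimes> v \<oplus> b \<otimes> x'" unfolding h using cl by algebra
  moreover have "b \<otimes> x' \<in> lspan P vs" using Cons.IH h Cons.prems(1) by simp
  moreover have "b \<otimes> c \<in> G 0" using degree_mult[OF b h(1)] by simp
  ultimately show ?case unfolding lspan.simps by blast
qed

lemma lspan_zero_add:
  assumes P: "ideal P R"
  shows "set vs \<subseteq> carrier R \<Longrightarrow> x \<in> lspan {\<zero>} vs \<Longrightarrow> q \<in> P \<Longrightarrow> x \<oplus> q \<in> lspan P vs"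
proof (induction vs arbitrary: x)
  case Nil
  then show ?case using ideal_simps(2)[OF P] by simp
next
  case (Cons v vs)
  obtain c x' where h: "c \<in> G 0" "x' \<in> lspan {\<zero>} vs" "x = c \<otimes> v \<oplus> x'" using Cons.prems by auto
  have cl: "c \<in> carrier R" "x' \<in> carrier R" "v \<in> carrier R" "q \<in> carrier R"
    using h degree_simps(1) lspan_carrier[OF zeroideal, of vs] Cons.prems ideal_simps(2)[OF P] by auto
  have "x \<oplus> q = c \<otimes> v \<oplus> (x' \<oplus> q)" unfolding h using cl by algebra
  moreover have "x' \<oplus> q \<in> lspan P vs" using Cons.IH h Cons.prems by simp
  ultimately show ?case unfolding lspan.simps using h(1) by blast
qed

lemma lspan_decompose:
  assumes P: "ideal P R"
  shows "set vs \<subseteq> carrier R \<Longrightarrow> x \<in> lspan P vs \<Longrightarrow> \<exists>w\<in>lspan {\<zero>} vs. \<exists>q\<in>P. x = w \<oplus> q"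
proof (induction vs arbitrary: x)
  case Nil
  then show ?case using ideal_simps(2)[OF P] by auto
next
  case (Cons v vs)
  obtain c x' where h: "c \<in> G 0" "x' \<in> lspan P vs" "x = c \<otimes> v \<oplus> x'" using Cons.prems by auto
  obtain w q where w: "w \<in> lspan {\<zero>} vs" "q \<in> P" "x' = w \<oplus> q" using Cons.IH[OF _ h(2)] Cons.prems by auto
  have cl: "c \<in> carrier R" "w \<in> carrier R" "v \<in> carrier R" "q \<in> carrier R"
    using h w degree_simps(1) lspan_carrier[OF zeroideal, of vs] Cons.prems ideal_simps(2)[OF P] by auto
  have "x = (c \<otimes> v \<oplus> w) \<oplus> q" unfolding h w using cl by algebra
  then show ?case using w h(1) by auto
qed

lemma lspan_deg_le: "set vs \<subseteq> deg_le D \<Longrightarrow> lspan {\<zero>} vs \<subseteq> deg_le D"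
proof (induction vs)
  case Nil
  then show ?case by (simp add: deg_le_def hcomp_zero)
next
  case (Cons v vs)
  have "c \<otimes> v \<in> deg_le D" if "c \<in> G 0" for c
    using deg_le_mult[of c 0 v D] that Cons.prems degree_simps(1)[OF that]
    by (auto simp: deg_le_def hcomp_homogeneous)
  then show ?case using Cons deg_le_add by auto
qed

text \<open>A relation modulo \<open>deg_ge (Suc D)\<close> between elements of degree at most
  \<open>D\<close> has an error term without any nonzero component. It is exact, hence a relation
  modulo \<open>P\<close>.\<close>

lemma independent_mod_deg_ge:
  assumes P: "ideal P R"
  shows "set vs \<subseteq> deg_le D \<Longrightarrow> independent_mod P vs \<Longrightarrow> independent_mod (deg_ge (Suc D)) vs"
proof (induction vs)
  case (Cons v vs)
  have c: "set vs \<subseteq> carrier R" "v \<in> carrier R" using Cons.prems(1) by (auto simp: deg_le_def)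
  have "v \<notin> lspan (deg_ge (Suc D)) vs"
  proof
    assume "v \<in> lspan (deg_ge (Suc D)) vs"
    then obtain w q where w: "w \<in> lspan {\<zero>} vs" "q \<in> deg_ge (Suc D)" "v = w \<oplus> q"
      using lspan_decompose[OF deg_ge_ideal c(1)] by blast
    have wD: "w \<in> deg_le D" using w(1) lspan_deg_le[of vs D] Cons.prems(1) by auto
    have qc: "q \<in> carrier R" "w \<in> carrier R" using w(2) wD by (auto simp: deg_ge_def deg_le_def)
    have "q = \<zero>"
    proof (rule hcomp_eq_zero[OF qc(1)])
      fix i
      show "hc q i = \<zero>"
      proof (cases "i \<le> D")
        case True
        then show ?thesis using w(2) by (simp add: deg_ge_def)
      next
        case False
        then have "hc v i = \<zero>" "hc w i = \<zero>" using Cons.prems(1) wD by (auto simp: deg_le_def)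
        then show ?thesis using hcomp_add[OF qc(2,1), of i] w(3) hcomp_closed[OF qc(1)] by simp
      qed
    qed
    then have "v \<in> lspan P vs"
      using lspan_zero_add[OF P c(1) w(1)] w(3) ideal_simps(1)[OF P] by simp
    then show False using Cons.prems(2) by simp
  qed
  then show ?case using Cons by simp
qed simp

lemma independent_mod_drop: "independent_mod P vs \<Longrightarrow> independent_mod P (drop k vs)"
  by (induction vs arbitrary: k) (auto simp: drop_Cons split: nat.split)

text \<open>Suppose \<open>x^i v = x^i (u + x w) + p\<close> with \<open>u\<close> in the span of
  \<open>vs\<close>. As \<open>P\<close> is prime and \<open>x\<close> outside it,
  \<open>v - u - x w\<close> is in \<open>P\<close>; since \<open>x\<close> is in \<open>Q\<close>,
  this puts \<open>v\<close> into \<open>u + Q\<close>, against independence modulo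
  \<open>Q\<close>. The inclusion of spans is carried along to bring relations into this
  shape.\<close>

lemma independent_mod_map_append:
  assumes P: "primeideal P R" and q: "ideal Q R" "P \<subseteq> Q" and x: "x \<in> Q" "x \<notin> P"
    and Y: "independent_mod P ys" "lspan P ys \<subseteq> {x [^] Suc i \<otimes> w \<oplus> p | w p. w \<in> carrier R \<and> p \<in> P}"
      (is "_ \<subseteq> ?Z (Suc i)")
  shows "set vs \<subseteq> carrier R \<Longrightarrow> independent_mod Q vs \<Longrightarrow>
    independent_mod P (map (\<lambda>v. x [^] i \<otimes> v) vs @ ys) \<and>
    lspan P (map (\<lambda>v. x [^] i \<otimes> v) vs @ ys) \<subseteq>
      {x [^] i \<otimes> (v \<oplus> x \<otimes> w) \<oplus> p | v w p. v \<in> lspan {\<zero>} vs \<and> w \<in> carrier R \<and> p \<in> P}"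
proof (induction vs)
  case Nil
  have xc: "x \<in> carrier R" by (rule ideal_simps(2)[OF q(1) x(1)])
  have "y \<in> {x [^] i \<otimes> (v \<oplus> x \<otimes> w) \<oplus> p | v w p. v \<in> lspan {\<zero>} [] \<and> w \<in> carrier R \<and> p \<in> P}"
    if y: "y \<in> lspan P ys" for y
  proof -
    obtain w p where h: "w \<in> carrier R" "p \<in> P" "y = x [^] Suc i \<otimes> w \<oplus> p" using subsetD[OF Y(2) y] by blast
    then have "y = x [^] i \<otimes> (\<zero> \<oplus> x \<otimes> w) \<oplus> p" using xc by (simp add: m_assoc)
    then show ?thesis using h by auto
  qed
  then show ?case using Y(1) by auto
next
  case (Cons v vs)
  let ?f = "\<lambda>v. x [^] i \<otimes> v"
  let ?L = "map ?f vs @ ys"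
  have PI: "ideal P R" using P primeideal.axioms(1) by blast
  have c: "x \<in> carrier R" "v \<in> carrier R" "set vs \<subseteq> carrier R"
    using ideal_simps(2)[OF q(1) x(1)] Cons.prems by auto
  have xi: "x [^] i \<in> carrier R" using c by simp
  have IH: "independent_mod P ?L"
    "\<And>y. y \<in> lspan P ?L \<Longrightarrow> \<exists>v w p. y = x [^] i \<otimes> (v \<oplus> x \<otimes> w) \<oplus> p \<and> v \<in> lspan {\<zero>} vs \<and> w \<in> carrier R \<and> p \<in> P"
    using Cons by auto
  have "?f v \<notin> lspan P ?L"
  proof
    assume "?f v \<in> lspan P ?L"
    then obtain u w p where h: "?f v = x [^] i \<otimes> (u \<oplus> x \<otimes> w) \<oplus> p" "u \<in> lspan {\<zero>} vs" "w \<in> carrier R" "p \<in> P"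
      using IH(2) by blast
    have cl: "u \<in> carrier R" "p \<in> carrier R"
      using h lspan_carrier[OF zeroideal c(3)] ideal_simps(2)[OF PI] by auto
    let ?d = "v \<ominus> (u \<oplus> x \<otimes> w)"
    have dc: "?d \<in> carrier R" using cl c h by simp
    have "x [^] i \<otimes> ?d = x [^] i \<otimes> v \<ominus> x [^] i \<otimes> (u \<oplus> x \<otimes> w)"
      using xi c cl h(3) by algebra
    also have "\<dots> = p" unfolding h(1) using xi c cl h(3) by algebra
    finally have "x [^] i \<otimes> ?d \<in> P" using h(4) by simp
    moreover have "x [^] i \<notin> P" using prime_nat_pow[OF P c(1)] x(2) by blast
    ultimately have "?d \<in> P" using primeideal.I_prime[OF P xi dc] by blast
    then have "?d \<oplus> x \<otimes> w \<in> Q"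
      using q ideal_simps(3)[OF q(1)] ideal_simps(7)[OF q(1) x(1) h(3)] by blast
    then have "u \<oplus> (?d \<oplus> x \<otimes> w) \<in> lspan Q vs" by (rule lspan_zero_add[OF q(1) c(3) h(2)])
    moreover have "u \<oplus> (?d \<oplus> x \<otimes> w) = v" using cl c h(3) by algebra
    ultimately show False using Cons.prems(2) by simp
  qed
  moreover have "lspan P (map ?f (v # vs) @ ys) \<subseteq>
      {x [^] i \<otimes> (v' \<oplus> x \<otimes> w) \<oplus> p | v' w p. v' \<in> lspan {\<zero>} (v # vs) \<and> w \<in> carrier R \<and> p \<in> P}"
  proof
    fix y assume "y \<in> lspan P (map ?f (v # vs) @ ys)"
    then obtain a z where az: "a \<in> G 0" "z \<in> lspan P ?L" "y = a \<otimes> ?f v \<oplus> z" by auto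
    then obtain u w p where h: "z = x [^] i \<otimes> (u \<oplus> x \<otimes> w) \<oplus> p" "u \<in> lspan {\<zero>} vs" "w \<in> carrier R" "p \<in> P"
      using IH(2) by blast
    have cl: "u \<in> carrier R" "p \<in> carrier R" "a \<in> carrier R"
      using h az lspan_carrier[OF zeroideal c(3)] ideal_simps(2)[OF PI] degree_simps(1) by auto
    have "y = x [^] i \<otimes> ((a \<otimes> v \<oplus> u) \<oplus> x \<otimes> w) \<oplus> p"
      unfolding az(3) h(1) using cl c xi h(3) by algebra
    moreover have "a \<otimes> v \<oplus> u \<in> lspan {\<zero>} (v # vs)" using az(1) h(2) by auto
    ultimately show "y \<in> {x [^] i \<otimes> (v' \<oplus> x \<otimes> w) \<oplus> p | v' w p. v' \<in> lspan {\<zero>} (v # vs) \<and> w \<in> carrier R \<and> p \<in> P}"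
      using h(3,4) by blast
  qed
  ultimately show ?case using IH(1) by simp
qed

text \<open>Each block of multiples by \<open>x^i\<close> is put in front of the blocks with higher
  powers, whose span is divisible by a further \<open>x\<close> modulo \<open>P\<close>. The start
  \<open>k\<close> varies because the induction removes the lowest power.\<close>

lemma independent_mod_powers:
  assumes P: "primeideal P R" and q: "ideal Q R" "P \<subseteq> Q" and x: "x \<in> Q" "x \<notin> P"
    and vs: "set vs \<subseteq> carrier R" "independent_mod Q vs"
  shows "independent_mod P (concat (map (\<lambda>i. map (\<lambda>v. x [^] i \<otimes> v) vs) [k..<k + n])) \<and>
    lspan P (concat (map (\<lambda>i. map (\<lambda>v. x [^] i \<otimes> v) vs) [k..<k + n])) \<subseteq>
      {x [^] k \<otimes> w \<oplus> p | w p. w \<in> carrier R \<and> p \<in> P}"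
proof (induction n arbitrary: k)
  case 0
  have PI: "ideal P R" using P primeideal.axioms(1) by blast
  have xc: "x \<in> carrier R" by (rule ideal_simps(2)[OF q(1) x(1)])
  have "p = x [^] k \<otimes> \<zero> \<oplus> p" if "p \<in> P" for p using that ideal_simps(2)[OF PI] xc by simp
  then show ?case by (simp, blast)
next
  case (Suc n)
  let ?B = "\<lambda>k n. concat (map (\<lambda>i. map (\<lambda>v. x [^] i \<otimes> v) vs) [k..<k + n])"
  have B: "?B k (Suc n) = map (\<lambda>v. x [^] k \<otimes> v) vs @ ?B (Suc k) n"
    by (simp add: upt_conv_Cons del: upt_Suc)
  have xc: "x \<in> carrier R" by (rule ideal_simps(2)[OF q(1) x(1)])
  have *: "independent_mod P (?B k (Suc n)) \<and> lspan P (?B k (Suc n)) \<subseteq>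
    {x [^] k \<otimes> (v \<oplus> x \<otimes> w) \<oplus> p | v w p. v \<in> lspan {\<zero>} vs \<and> w \<in> carrier R \<and> p \<in> P}"
    unfolding B using Suc.IH[of "Suc k"] by (intro independent_mod_map_append[OF P q x _ _ vs]) auto
  have "v \<oplus> x \<otimes> w \<in> carrier R" if "v \<in> lspan {\<zero>} vs" "w \<in> carrier R" for v w
    using that xc lspan_carrier[OF zeroideal vs(1)] by auto
  then show ?case using * by blast
qed

text \<open>For \<open>x i\<close> in \<open>P i\<close> but not in \<open>P (i - 1)\<close>, the monomials in \<open>x 1, \<dots>, x m\<close> with exponents below
  \<open>n\<close> are linearly independent modulo \<open>P 0\<close> over the degree zero part.\<close>

lemma independent_monomials:
  assumes "\<And>i. i \<le> m \<Longrightarrow> primeideal (P i) R" "\<And>i. i < m \<Longrightarrow> P i \<subset> P (Suc i)"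
  shows "\<exists>c. \<forall>n. \<exists>vs. length vs = n ^ m \<and> set vs \<subseteq> deg_le (c * n) \<and> independent_mod (P 0) vs"
  using assms
proof (induction m arbitrary: P)
  case 0
  have "\<one> \<notin> P 0" using prime_compl(2)[of "P 0"] 0 by simp
  moreover have "\<one> \<in> deg_le 0" using hcomp_homogeneous[OF one_mem] by (simp add: deg_le_def)
  ultimately show ?case by (intro exI[of _ 0] allI exI[of _ "[\<one>]"]) simp
next
  case (Suc m)
  \<comment> \<open>The chain without \<open>P 0\<close> supplies monomials independent modulo
    \<open>P (Suc 0)\<close>; multiplying them by powers of an \<open>x\<close> from
    \<open>P (Suc 0)\<close> outside \<open>P 0\<close> gives those for the whole chain.\<close>
  have "\<exists>c. \<forall>n. \<exists>vs. length vs = n ^ m \<and> set vs \<subseteq> deg_le (c * n) \<and> independent_mod (P (Suc 0)) vs"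
    using Suc.IH[of "\<lambda>i. P (Suc i)"] Suc.prems by auto
  then obtain c where c: "\<And>n. \<exists>vs. length vs = n ^ m \<and> set vs \<subseteq> deg_le (c * n) \<and> independent_mod (P (Suc 0)) vs"
    by blast
  have P0: "primeideal (P 0) R" and P1: "ideal (P (Suc 0)) R"
    using Suc.prems(1)[of 0] Suc.prems(1)[of "Suc 0"] primeideal.axioms(1) by auto
  obtain x where x: "x \<in> P (Suc 0)" "x \<notin> P 0" using Suc.prems(2)[of 0] by auto
  have sub: "P 0 \<subseteq> P (Suc 0)" using Suc.prems(2)[of 0] by auto
  have xc: "x \<in> carrier R" using x ideal_simps(2)[OF P1] by blast
  obtain b where b: "x \<in> deg_le b"
  proof -
    have "finite {i. hc x i \<noteq> \<zero>}" by (rule hcomp_finite[OF xc])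
    then obtain b where "\<forall>i\<in>{i. hc x i \<noteq> \<zero>}. i \<le> b" using finite_nat_set_iff_bounded_le by blast
    then show thesis using that[of b] xc by (force simp: deg_le_def)
  qed
  have xi: "x [^] i \<in> deg_le (b * i)" for i :: nat
  proof (induction i)
    case 0
    then show ?case using hcomp_homogeneous[OF one_mem] by (simp add: deg_le_def)
  next
    case (Suc i)
    then show ?case using deg_le_mult[OF Suc b] by (simp add: add.commute)
  qed
  have mono: "deg_le a \<subseteq> deg_le a'" if "a \<le> a'" for a a' using that by (auto simp: deg_le_def)
  show ?case
  \<comment> \<open>Here \<open>b\<close> bounds the degree of \<open>x\<close>, so a factor
    \<open>x^i\<close> with \<open>i < n\<close> adds at most \<open>b n\<close>.\<close>
  proof (rule exI[of _ "b + c"], rule allI)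
    fix n
    obtain vs where vs: "length vs = n ^ m" "set vs \<subseteq> deg_le (c * n)" "independent_mod (P (Suc 0)) vs"
      using c by blast
    let ?L = "concat (map (\<lambda>i. map (\<lambda>v. x [^] i \<otimes> v) vs) [0..<0 + n])"
    have vc: "set vs \<subseteq> carrier R" using vs(2) by (auto simp: deg_le_def)
    have "length ?L = n ^ Suc m" using vs(1) by (simp add: length_concat comp_def sum_list_triv)
    moreover have "x [^] i \<otimes> v \<in> deg_le ((b + c) * n)" if "i < n" "v \<in> set vs" for i v
    proof -
      have "x [^] i \<otimes> v \<in> deg_le (b * i + c * n)" by (rule deg_le_mult[OF xi]) (use that vs(2) in auto)
      moreover have "b * i + c * n \<le> (b + c) * n" using that(1) by (simp add: add_mult_distrib)
      ultimately show ?thesis using mono by blast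
    qed
    then have "set ?L \<subseteq> deg_le ((b + c) * n)" by auto
    moreover have "independent_mod (P 0) ?L"
      using independent_mod_powers[OF P0 P1 sub x vc vs(3), of 0 n] by blast
    ultimately show "\<exists>vs. length vs = n ^ Suc m \<and> set vs \<subseteq> deg_le ((b + c) * n) \<and> independent_mod (P 0) vs"
      by blast
  qed
qed

text \<open>The spans of final segments of \<open>vs\<close>, enlarged by \<open>deg_ge D\<close>,
  form a strict chain of \<open>G 0\<close>-subspaces containing \<open>M^D\<close>, whose length
  \<open>T\<close> bounds.\<close>

lemma independent_length_le:
  assumes ind: "independent_mod (deg_ge D) vs" "set vs \<subseteq> carrier R"
    and st: "residue_steps R M (ideal_pow R M D) (carrier R) T"
  shows "length vs \<le> T"
proof -
  define H where "H j = lspan (deg_ge D) (drop (length vs - j) vs)" for j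
  have sc: "set (drop k vs) \<subseteq> carrier R" for k using ind(2) set_drop_subset by (metis subset_trans)
  show ?thesis
  proof (rule residue_steps_chain[OF st ideal_pow_ideal[OF M_ideal] M_ideal, where B = "G 0" and S = "G 0 - {\<zero>}" and H = H])
    show "G 0 \<subseteq> carrier R" using degree_simps(1) by blast
    show "\<exists>s\<in>G 0 - {\<zero>}. \<exists>c\<in>G 0. s \<otimes> a \<ominus> c \<otimes> b \<in> M"
      if a: "a \<in> carrier R" and b: "b \<in> carrier R - M" for a b
    proof (intro bexI)
      have bc: "b \<in> carrier R" using b by simp
      have cl: "hc a 0 \<in> carrier R" "hc b 0 \<in> carrier R" using a bc hcomp_closed by auto
      \<comment> \<open>Cross-multiplying by the constant terms cancels the component of degree
        0.\<close>
      show "hc b 0 \<otimes> a \<ominus> hc a 0 \<otimes> b \<in> M"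
        using a bc cl hcomp_mult_homogeneous[OF hcomp_mem[OF bc] a, of 0]
          hcomp_mult_homogeneous[OF hcomp_mem[OF a] bc, of 0]
        by (simp add: positive_part hcomp_diff m_comm)
      show "hc a 0 \<in> G 0" using a hcomp_mem by blast
      show "hc b 0 \<in> G 0 - {\<zero>}" using hcomp_mem[OF bc] hcomp_zero_of_not_mem[OF b] by blast
    qed
    show "saturated_sub R (G 0) (G 0 - {\<zero>}) (H j)" for j
      unfolding saturated_sub_def
    proof (intro conjI ballI impI)
      let ?vs = "drop (length vs - j) vs"
      note sub = lspan_carrier[OF deg_ge_ideal sc, of D "length vs - j"]
      have sm: "b \<otimes> h \<in> H j" if "b \<in> G 0" "h \<in> H j" for b h
        using that lspan_smult[OF deg_ge_ideal that(1) sc] by (simp add: H_def)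
      then show "b \<otimes> h \<in> H j" if "b \<in> G 0" "h \<in> H j" for b h using that .
      have m1: "\<ominus> \<one> \<in> G 0"
        using subgroup.m_inv_closed[OF degree_subgroup one_mem] by (simp add: a_inv_def)
      have Hc: "H j \<subseteq> carrier R" using sub by (simp add: H_def)
      have "\<zero> \<in> H j"
        unfolding H_def by (rule subsetD[OF lspan_supset[OF deg_ge_ideal sc] ideal_simps(1)[OF deg_ge_ideal]])
      moreover have "\<ominus> a \<in> H j" if "a \<in> H j" for a
      proof -
        have "\<ominus> \<one> \<otimes> a = \<ominus> a" using that Hc by (simp add: l_minus subset_iff)
        then show ?thesis using sm[OF m1 that] by simp
      qed
      moreover have "a \<oplus> b \<in> H j" if "a \<in> H j" "b \<in> H j" for a b
        using lspan_add[OF deg_ge_ideal sc] that by (simp add: H_def)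
      ultimately show "additive_subgroup (H j) R"
        using Hc by (intro additive_subgroupI) (auto intro!: add.subgroupI simp: a_inv_def)
      show "r \<in> H j" if s: "s \<in> G 0 - {\<zero>}" and r: "r \<in> carrier R" and "s \<otimes> r \<in> H j" for s r
      proof -
        have s': "s \<in> G 0" "s \<noteq> \<zero>" using s by auto
        have "inv s \<otimes> (s \<otimes> r) \<in> H j" by (rule sm[OF degree_zero_inverse(1)[OF s'] that(3)])
        moreover have "inv s \<otimes> (s \<otimes> r) = r"
          using m_assoc[OF degree_zero_inverse(3)[OF s'] degree_simps(1)[OF s'(1)] r, symmetric]
            degree_zero_inverse(2)[OF s'] r by simp
        ultimately show ?thesis by simp
      qed
    qed
    show "ideal_pow R M D \<subseteq> H j" for j
      using ideal_pow_subset_deg_ge lspan_supset[OF deg_ge_ideal sc] unfolding H_def by (meson subset_trans)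
    show "H j \<subset> H (Suc j)" if j: "j < length vs" for j
    proof -
      let ?k = "length vs - Suc j"
      have k: "drop ?k vs = vs ! ?k # drop (length vs - j) vs"
        using j Cons_nth_drop_Suc[of ?k vs] by (simp add: Suc_diff_Suc)
      have "vs ! ?k \<notin> H j" using independent_mod_drop[OF ind(1), of ?k] unfolding k H_def by simp
      moreover have "vs ! ?k \<in> carrier R" using ind(2) j by (simp add: subset_iff)
      ultimately show ?thesis
        using lspan_Cons_supset[OF deg_ge_ideal sc, of "vs ! ?k" D "length vs - j"] unfolding H_def k by blast
    qed
  qed auto
qed

lemma graded_krull_dim_finite: "\<exists>r. krull_dim R \<le> enat r"
proof -
  interpret noetherian_cring R ..
  obtain A where A: "A \<subseteq> carrier R" "finite A" "M = Idl A" using finetely_gen[OF M_ideal] by blast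
  obtain xs where xs: "set xs = A" using finite_list[OF A(2)] by blast
  have xsM: "set xs \<subseteq> M" using A xs genideal_self by blast
  obtain C where C: "residue_steps R M (ideal_pow R M (Suc 0)) (carrier R) C" using residue_steps_pow[OF M_ideal] by blast
  \<comment> \<open>The generators of \<open>M\<close> serve as the list for every \<open>n\<close>,
    with \<open>C\<close> the number of steps for \<open>R/M\<close>.\<close>
  have st: "residue_steps R M (ideal_pow R M n) (carrier R) (C * n ^ length xs)" for n
  proof (rule residue_steps_pow_le[OF M_ideal C ideal_pow_ideal[OF M_ideal] subset_refl xsM])
    have c: "set xs \<subseteq> carrier R" using xs A by blast
    note a = adjoin_list_ideal[OF ideal_pow_ideal[OF M_ideal, of n] c]
    have "x \<in> adjoin_list J ys" if "x \<in> set ys" "set ys \<subseteq> carrier R" "ideal J R" for x ys J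
      using that
    proof (induction ys arbitrary: J)
      case (Cons y ys)
      have y: "y \<in> carrier R" using Cons.prems by simp
      note J = adjoin_ideal[OF Cons.prems(3) y]
      show ?case
      proof (cases "x = y")
        case True
        then show ?thesis
          using adjoin_supset(2)[OF Cons.prems(3) y] adjoin_list_ideal[OF J, of ys] Cons.prems(2) by auto
      next
        case False
        then show ?thesis using Cons.IH[OF _ _ J] Cons.prems by auto
      qed
    qed simp
    then have "A \<subseteq> adjoin_list (ideal_pow R M n) xs" using xs c ideal_pow_ideal[OF M_ideal] by blast
    then have "Idl A \<subseteq> adjoin_list (ideal_pow R M n) xs" using a by (intro genideal_minimal) auto
    then have "M \<subseteq> adjoin_list (ideal_pow R M n) xs" unfolding A(3)[symmetric] .
    then show "ideal_pow R M (Suc 0) \<subseteq> adjoin_list (ideal_pow R M n) xs" using ideal_pow_one[OF M_ideal] by simp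
  qed
  let ?r = "length xs"
  have "m \<le> ?r"
    if P: "\<And>i. i \<le> m \<Longrightarrow> primeideal (P i) R" "\<And>i. i < m \<Longrightarrow> P i \<subset> P (Suc i)" for m and P :: "nat \<Rightarrow> 'a set"
  proof (rule ccontr)
    assume "\<not> m \<le> ?r"
    then have m: "Suc ?r \<le> m" by simp
    obtain c where c: "\<And>n. \<exists>vs. length vs = n ^ m \<and> set vs \<subseteq> deg_le (c * n) \<and> independent_mod (P 0) vs"
      using independent_monomials[of m P, OF P] by blast
    have P0: "ideal (P 0) R" using P(1)[of 0] primeideal.axioms(1) by auto
    \<comment> \<open>The \<open>n^m\<close> monomials of degree at most \<open>c n\<close> need as
      many of the at most \<open>C (c n + 1)^?r\<close> steps; with \<open>m > ?r\<close> this
      bounds every \<open>n\<close>, which is absurd.\<close>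
    have le: "n \<le> C * Suc c ^ ?r" if n: "n \<ge> 1" for n
    proof -
      obtain vs where vs: "length vs = n ^ m" "set vs \<subseteq> deg_le (c * n)" "independent_mod (P 0) vs"
        using c by blast
      have "length vs \<le> C * Suc (c * n) ^ ?r"
        using independent_length_le[OF independent_mod_deg_ge[OF P0 vs(2,3)] _ st] vs(2)
        by (auto simp: deg_le_def)
      also have "\<dots> \<le> C * (Suc c * n) ^ ?r" using n by (intro mult_le_mono2 power_mono) auto
      finally have "n ^ m \<le> (C * Suc c ^ ?r) * n ^ ?r" using vs(1) by (simp only: power_mult_distrib mult.assoc)
      moreover have "n ^ Suc ?r \<le> n ^ m" using n m by (intro power_increasing) auto
      ultimately have "n ^ Suc ?r \<le> (C * Suc c ^ ?r) * n ^ ?r" by (meson order_trans)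
      then show ?thesis using n by simp
    qed
    have "Suc (C * Suc c ^ ?r) \<le> C * Suc c ^ ?r" by (rule le) simp
    then show False by simp
  qed
  then have "krull_dim R \<le> enat ?r" by (rule krull_dim_leI)
  then show ?thesis by blast
qed

section \<open>Degree parts of differential operators\<close>

definition hcz :: "'a \<Rightarrow> int \<Rightarrow> 'a" where
  "hcz x k = (if k < 0 then \<zero> else hc x (nat k))"

lemma hcz_simps:
  "x \<in> carrier R \<Longrightarrow> hcz x k \<in> carrier R"
  "x \<in> carrier R \<Longrightarrow> y \<in> carrier R \<Longrightarrow> hcz (x \<oplus> y) k = hcz x k \<oplus> hcz y k"
  using hcomp_closed by (auto simp: hcz_def hcomp_add)

text \<open>With integer degrees the shift formula has no case distinction. Negative degrees enter
  because operators may lower degrees.\<close>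

lemma hcz_mult:
  assumes a: "a \<in> G t" and x: "x \<in> carrier R"
  shows "hcz (a \<otimes> x) k = a \<otimes> hcz x (k - int t)"
proof -
  have ac: "a \<in> carrier R" using a degree_simps(1) by blast
  consider "k < 0" | "0 \<le> k" "k < int t" | "int t \<le> k" by linarith
  then show ?thesis
  proof cases
    case 3
    then have "nat k - t = nat (k - int t)" "\<not> nat k < t" by linarith+
    then show ?thesis using 3 by (simp add: hcz_def hcomp_mult_homogeneous[OF a x])
  qed (use ac hcomp_mult_homogeneous[OF a x] in \<open>auto simp: hcz_def nat_less_iff\<close>)
qed

text \<open>The homogeneous part of \<open>\<delta>\<close> of degree \<open>j\<close>: in degree
  \<open>k\<close> its value comes from the component of \<open>x\<close> of degree
  \<open>k - j\<close>.\<close>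

definition degree_part :: "('a \<Rightarrow> 'a) \<Rightarrow> int \<Rightarrow> 'a \<Rightarrow> 'a" where
  "degree_part \<delta> j x =
     (let f = (\<lambda>k. hc (\<delta> (hcz x (int k - j))) k) in \<Oplus>k\<in>{k. f k \<noteq> \<zero>}. f k)"

lemma degree_part_hcomp:
  assumes \<delta>: "\<delta> \<in> lin_end R A" and x: "x \<in> carrier R"
  shows "degree_part \<delta> j x \<in> carrier R" "hc (degree_part \<delta> j x) k = hc (\<delta> (hcz x (int k - j))) k"
proof -
  note L = lin_end_simps[OF \<delta>]
  let ?f = "\<lambda>k. hc (\<delta> (hcz x (int k - j))) k"
  have mem: "?f k \<in> G k" for k using L(1) hcz_simps(1)[OF x] hcomp_mem by blast
  \<comment> \<open>Only degrees \<open>i + j\<close> with \<open>i\<close> in the support of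
    \<open>x\<close> can contribute, so the sum is finite.\<close>
  have "{k. ?f k \<noteq> \<zero>} \<subseteq> (\<lambda>i. nat (int i + j)) ` {i. hc x i \<noteq> \<zero>}"
  proof
    fix k assume "k \<in> {k. ?f k \<noteq> \<zero>}"
    then have "hcz x (int k - j) \<noteq> \<zero>" using L(4) hcomp_zero by auto
    then have "int k - j \<ge> 0" "hc x (nat (int k - j)) \<noteq> \<zero>" by (auto simp: hcz_def split: if_splits)
    then show "k \<in> (\<lambda>i. nat (int i + j)) ` {i. hc x i \<noteq> \<zero>}"
      by (intro image_eqI[of _ _ "nat (int k - j)"]) auto
  qed
  then have fin: "finite {k. ?f k \<noteq> \<zero>}" using hcomp_finite[OF x] finite_surj by blast
  have eq: "degree_part \<delta> j x = (\<Oplus>k\<in>{k. ?f k \<noteq> \<zero>}. ?f k)" by (simp add: degree_part_def)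
  show c: "degree_part \<delta> j x \<in> carrier R"
    unfolding eq using mem degree_simps(1) by (intro finsum_closed) blast
  have "hdecomp R G (degree_part \<delta> j x) ?f"
    unfolding eq by (rule hdecomp_finsum[OF mem fin]) simp
  then show "hc (degree_part \<delta> j x) k = ?f k" using hcomp_unique[OF c] by metis
qed

lemma degree_part_add:
  assumes \<delta>: "\<delta> \<in> lin_end R A" and x: "x \<in> carrier R" and y: "y \<in> carrier R"
  shows "degree_part \<delta> j (x \<oplus> y) = degree_part \<delta> j x \<oplus> degree_part \<delta> j y"
proof (rule hcomp_ext)
  note L = lin_end_simps[OF \<delta>] and D = degree_part_hcomp[OF \<delta>]
  show "hc (degree_part \<delta> j (x \<oplus> y)) k = hc (degree_part \<delta> j x \<oplus> degree_part \<delta> j y) k" for k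
    using x y L(1) by (simp add: D hcomp_add hcz_simps L(2))
qed (use x y degree_part_hcomp(1)[OF \<delta>] in auto)

text \<open>Linearity is checked on the homogeneous components of \<open>a\<close>. Homogeneity of
  \<open>A\<close> puts them into \<open>A\<close>, where \<open>\<delta>\<close> is linear over
  them.\<close>

lemma degree_part_lin_end:
  assumes \<delta>: "\<delta> \<in> lin_end R A" and A: "A \<subseteq> carrier R" "homogeneous R G A"
  shows "degree_part \<delta> j \<in> lin_end R A"
proof (rule lin_endI)
  note L = lin_end_simps[OF \<delta>] and D = degree_part_hcomp[OF \<delta>]
  fix a x assume a: "a \<in> A" and x: "x \<in> carrier R"
  have ac: "a \<in> carrier R" using a A by blast
  show "degree_part \<delta> j (a \<otimes> x) = a \<otimes> degree_part \<delta> j x"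
  proof (rule hcomp_sum_induct[OF ac, where Q = "\<lambda>a. degree_part \<delta> j (a \<otimes> x) = a \<otimes> degree_part \<delta> j x"])
    have "degree_part \<delta> j \<zero> = \<zero>"
      using degree_part_add[OF \<delta>, of \<zero> \<zero> j] D(1)[of \<zero> j] by (simp add: add.l_cancel_one)
    then show "degree_part \<delta> j (\<zero> \<otimes> x) = \<zero> \<otimes> degree_part \<delta> j x" using x D(1) by simp
    show "degree_part \<delta> j ((b \<oplus> c) \<otimes> x) = (b \<oplus> c) \<otimes> degree_part \<delta> j x"
      if "b \<in> carrier R" "c \<in> carrier R" "degree_part \<delta> j (b \<otimes> x) = b \<otimes> degree_part \<delta> j x"
        "degree_part \<delta> j (c \<otimes> x) = c \<otimes> degree_part \<delta> j x" for b c
      using that x D(1) by (simp add: l_distr degree_part_add[OF \<delta>])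
    fix t
    let ?a = "hc a t"
    have at: "?a \<in> G t" "?a \<in> carrier R" using hcomp_mem[OF ac] hcomp_closed[OF ac] by auto
    have aA: "?a \<in> A" using A(2) a by (simp add: homogeneous_def)
    show "degree_part \<delta> j (?a \<otimes> x) = ?a \<otimes> degree_part \<delta> j x"
    proof (rule hcomp_ext)
      fix k
      have "hc (degree_part \<delta> j (?a \<otimes> x)) k = hc (?a \<otimes> \<delta> (hcz x (int k - j - int t))) k"
        using at x by (simp add: D hcz_mult[OF at(1) x] L(3)[OF aA hcz_simps(1)[OF x]])
      also have "\<dots> = hc (?a \<otimes> degree_part \<delta> j x) k"
      proof -
        have e: "hcz x (int k - j - int t) = hcz x (int k - int t - j)" by (rule arg_cong) simp
        show ?thesis
          using x L(1) hcz_simps(1)[OF x] D(1)[OF x]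
          by (simp add: e hcomp_mult_homogeneous[OF at(1)] D(2)[OF x])
      qed
      finally show "hc (degree_part \<delta> j (?a \<otimes> x)) k = hc (?a \<otimes> degree_part \<delta> j x) k" .
    qed (use at x D(1) in auto)
  qed
qed (use degree_part_hcomp(1)[OF \<delta>] degree_part_add[OF \<delta>] in auto)

text \<open>For \<open>r\<close> of degree \<open>t\<close>, both sides have the same component in
  each degree by the shift formula. So taking degree parts does not raise the order.\<close>

lemma degree_part_commutator:
  assumes \<delta>: "\<delta> \<in> lin_end R A" and r: "r \<in> G t" and x: "x \<in> carrier R"
    and \<epsilon>: "(\<lambda>x. \<delta> (r \<otimes> x) \<ominus> r \<otimes> \<delta> x) \<in> lin_end R B"
  shows "degree_part \<delta> j (r \<otimes> x) \<ominus> r \<otimes> degree_part \<delta> j x =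
    degree_part (\<lambda>x. \<delta> (r \<otimes> x) \<ominus> r \<otimes> \<delta> x) (j + int t) x"
proof (rule hcomp_ext)
  note L = lin_end_simps[OF \<delta>] and D = degree_part_hcomp[OF \<delta>] and E = degree_part_hcomp[OF \<epsilon> x]
  have rc: "r \<in> carrier R" using r degree_simps(1) by blast
  show "degree_part \<delta> j (r \<otimes> x) \<ominus> r \<otimes> degree_part \<delta> j x \<in> carrier R" using rc x D(1) by simp
  show "degree_part (\<lambda>x. \<delta> (r \<otimes> x) \<ominus> r \<otimes> \<delta> x) (j + int t) x \<in> carrier R" by (rule E(1))
  fix k
  let ?z = "hcz x (int k - (j + int t))"
  have z: "?z \<in> carrier R" using hcz_simps(1)[OF x] .
  have "hc (degree_part \<delta> j (r \<otimes> x)) k = hc (\<delta> (r \<otimes> ?z)) k"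
    using rc x by (simp add: D hcz_mult[OF r x] diff_diff_add)
  moreover have "hc (r \<otimes> degree_part \<delta> j x) k = hc (r \<otimes> \<delta> ?z) k"
  proof -
    have e: "?z = hcz x (int k - int t - j)" by (rule arg_cong) simp
    show ?thesis
      using L(1)[OF z] D(1)[OF x] by (simp add: e hcomp_mult_homogeneous[OF r] D(2)[OF x])
  qed
  ultimately show "hc (degree_part \<delta> j (r \<otimes> x) \<ominus> r \<otimes> degree_part \<delta> j x) k =
    hc (degree_part (\<lambda>x. \<delta> (r \<otimes> x) \<ominus> r \<otimes> \<delta> x) (j + int t) x) k"
    using rc x z D(1) L(1) by (simp add: E(2) hcomp_diff)
qed

text \<open>The commutator is additive in \<open>r\<close>, which reduces it to homogeneous
  \<open>r\<close>, where it is a degree part of a commutator of smaller order.\<close>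

lemma degree_part_diff_op_le:
  assumes "\<delta> \<in> diff_op_le R A n" and A: "A \<subseteq> carrier R" "homogeneous R G A"
  shows "degree_part \<delta> j \<in> diff_op_le R A n"
  using assms(1)
proof (induction n arbitrary: \<delta> j)
  case 0
  \<comment> \<open>At order 0 linearity is over all of \<open>R\<close>, so the homogeneous subring
    used here is \<open>R\<close>.\<close>
  have "homogeneous R G (carrier R)" using hcomp_closed by (simp add: homogeneous_def)
  then show ?case using 0 degree_part_lin_end[of \<delta> "carrier R"] by simp
next
  case (Suc n)
  have \<delta>: "\<delta> \<in> lin_end R A" using Suc.prems by simp
  note D = degree_part_hcomp[OF \<delta>]
  let ?\<epsilon> = "\<lambda>r x. degree_part \<delta> j (r \<otimes> x) \<ominus> r \<otimes> degree_part \<delta> j x"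
  have "?\<epsilon> r \<in> diff_op_le R A n" if r: "r \<in> carrier R" for r
  proof (rule hcomp_sum_induct[OF r, where Q = "\<lambda>r. ?\<epsilon> r \<in> diff_op_le R A n"])
    have "degree_part \<delta> j \<zero> = \<zero>"
      by (rule lin_end_simps(4)[OF degree_part_lin_end[OF \<delta> A]])
    then show "?\<epsilon> \<zero> \<in> diff_op_le R A n"
      using D(1) by (intro diff_op_le_ext[OF diff_op_le_zero[OF A(1)] A(1)]) (simp add: a_minus_def)
    show "?\<epsilon> (y \<oplus> z) \<in> diff_op_le R A n"
      if c: "y \<in> carrier R" "z \<in> carrier R" and h: "?\<epsilon> y \<in> diff_op_le R A n" "?\<epsilon> z \<in> diff_op_le R A n" for y z
    proof (rule diff_op_le_ext[OF diff_op_le_add[OF h A(1)] A(1)])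
      fix x assume x: "x \<in> carrier R"
      have "degree_part \<delta> j (y \<otimes> x) \<in> carrier R" "degree_part \<delta> j (z \<otimes> x) \<in> carrier R"
        "degree_part \<delta> j x \<in> carrier R" using D(1) c x by auto
      moreover have "degree_part \<delta> j ((y \<oplus> z) \<otimes> x) = degree_part \<delta> j (y \<otimes> x) \<oplus> degree_part \<delta> j (z \<otimes> x)"
        using c x by (simp add: l_distr degree_part_add[OF \<delta>])
      ultimately show "?\<epsilon> (y \<oplus> z) x = ?\<epsilon> y x \<oplus> ?\<epsilon> z x" using c by (simp, algebra)
    qed
    fix t
    have c: "(\<lambda>x. \<delta> (hc r t \<otimes> x) \<ominus> hc r t \<otimes> \<delta> x) \<in> diff_op_le R A n"
      using Suc.prems hcomp_closed[OF r] by simp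
    show "?\<epsilon> (hc r t) \<in> diff_op_le R A n"
      by (rule diff_op_le_ext[OF Suc.IH[OF c] A(1)])
        (rule degree_part_commutator[OF \<delta> hcomp_mem[OF r] _ diff_op_le_lin_end[OF c A(1)]])
  qed
  then show ?case using degree_part_lin_end[OF \<delta> A] by simp
qed

lemma diff_stable_ideal_trivial:
  assumes core: "diff_core R A M = {\<zero>}" and A: "A \<subseteq> carrier R"
    and I: "ideal I R" "diff_stable R A I" "I \<noteq> {\<zero>}" and h: "homogeneous R G A \<or> homogeneous R G I"
  shows "I = carrier R"
proof -
  obtain f where f: "f \<in> I" "f \<noteq> \<zero>" using I(3) ideal_simps(1)[OF I(1)] by blast
  have fc: "f \<in> carrier R" using f ideal_simps(2)[OF I(1)] by blast
  from h show ?thesis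
  proof
    assume h: "homogeneous R G I"
    obtain \<delta> where \<delta>: "\<delta> \<in> diff_op R A" "\<delta> f \<notin> M" using core f(2) fc by (auto simp: diff_core_def)
    \<comment> \<open>The constant term of \<open>\<delta> f\<close> is nonzero, and homogeneity
      puts this unit into \<open>I\<close>.\<close>
    have "\<delta> f \<in> I" using I(2) \<delta>(1) f(1) by (auto simp: diff_stable_def)
    then show ?thesis
      using ideal_eq_carrier[OF I(1), of "hc (\<delta> f) 0"] h hcomp_mem[of "\<delta> f" 0] \<delta>(2) ideal_simps(2)[OF I(1)]
      by (auto simp: homogeneous_def positive_part)
  next
    assume h: "homogeneous R G A"
    define e where "e = Max {i. hc f i \<noteq> \<zero>}"
    have ne: "{i. hc f i \<noteq> \<zero>} \<noteq> {}" using hcomp_eq_zero[OF fc] f(2) by auto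
    have e1: "hc f e \<noteq> \<zero>" using Max_in[OF hcomp_finite[OF fc] ne] unfolding e_def by simp
    have e2: "hc f i = \<zero>" if "i > e" for i
      using Max_ge[OF hcomp_finite[OF fc], of i] that unfolding e_def by (cases "hc f i = \<zero>") auto
    have fec: "hc f e \<in> carrier R" using hcomp_closed[OF fc] .
    obtain \<delta> where \<delta>: "\<delta> \<in> diff_op R A" "\<delta> (hc f e) \<notin> M" using core e1 fec by (auto simp: diff_core_def)
    then obtain n where n: "\<delta> \<in> diff_op_le R A n" by (auto simp: diff_op_def)
    note L = diff_op_le_lin_end[OF n A]
    let ?\<epsilon> = "degree_part \<delta> (- int e)"
    have "?\<epsilon> \<in> diff_op R A" using degree_part_diff_op_le[OF n A h] by (auto simp: diff_op_def)
    then have \<epsilon>I: "?\<epsilon> f \<in> I" using I(2) f(1) by (auto simp: diff_stable_def)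
    have d: "\<delta> (hc f e) \<in> carrier R" using lin_end_simps(1)[OF L fec] .
    \<comment> \<open>Components of \<open>f\<close> below \<open>e\<close> would be sent to
      negative degrees, and there are none above \<open>e\<close>; only the leading one survives, in
      degree 0.\<close>
    have comp: "hc (?\<epsilon> f) k = (if k = 0 then hc (\<delta> (hc f e)) 0 else \<zero>)" for k
    proof -
      have "hcz f (int k + int e) = hc f (k + e)" by (simp add: hcz_def nat_add_distrib)
      then show ?thesis
        using degree_part_hcomp(2)[OF L fc, of "- int e" k] e2[of "k + e"] lin_end_simps(4)[OF L] hcomp_zero
        by auto
    qed
    have "?\<epsilon> f = hc (\<delta> (hc f e)) 0"
    proof (rule hcomp_ext)
      show "hc (?\<epsilon> f) i = hc (hc (\<delta> (hc f e)) 0) i" for i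
        by (simp add: comp hcomp_homogeneous[OF hcomp_mem[OF d]])
    qed (use degree_part_hcomp(1)[OF L fc] hcomp_closed[OF d] in auto)
    moreover have "hc (\<delta> (hc f e)) 0 \<noteq> \<zero>" using hcomp_zero_of_not_mem \<delta>(2) d by blast
    ultimately show ?thesis using ideal_eq_carrier[OF I(1) \<epsilon>I] hcomp_mem[OF d] by simp
  qed
qed

lemma graded_local_like: "local_like_ring R M"
proof -
  interpret noetherian_cring R ..
  interpret maximalideal M R by (rule M_maximal)
  show ?thesis
    by unfold_locales (rule graded_torsion_free graded_krull_dim_finite; assumption)+
qed

end

section \<open>The local case and the theorem\<close>

lemma (in noetherian_local_ring) Units_of_not_mem:
  assumes "u \<in> carrier R" "u \<notin> M"
  shows "u \<in> Units R"
proof (rule ccontr)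
  interpret noetherian_cring R ..
  assume u: "u \<notin> Units R"
  have "carrier R \<noteq> PIdl u"
  proof
    assume "carrier R = PIdl u"
    then have "\<one> \<in> PIdl u" using one_closed by simp
    then obtain a where "a \<in> carrier R" "\<one> = a \<otimes> u" by (auto simp: cgenideal_def)
    then have "u \<in> Units R" using assms(1) m_comm[of a u] unfolding Units_def by auto
    then show False using u by simp
  qed
  then have "PIdl u \<subseteq> M"
    using ideal_subset_maximal[OF cgenideal_ideal[OF assms(1)]] maximal_unique by blast
  then show False using cgenideal_self[OF assms(1)] assms(2) by blast
qed

lemma (in noetherian_local_ring) local_local_like: "local_like_ring R M"
proof -
  interpret noetherian_cring R ..
  show ?thesis
  proof unfold_locales
    show "y = \<zero>" if "s \<in> carrier R - M" "y \<in> carrier R" "s \<otimes> y = \<zero>" for s y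
    proof -
      have s: "s \<in> Units R" using Units_of_not_mem that(1) by blast
      have "y = (inv s \<otimes> s) \<otimes> y" using s that(2) by simp
      also have "\<dots> = inv s \<otimes> (s \<otimes> y)" using s that(1,2) by (intro m_assoc) auto
      finally show ?thesis using s that(3) by simp
    qed
    show "\<exists>r. krull_dim R \<le> enat r" by (rule krull_dim_finite)
  qed
qed

lemma (in noetherian_local_ring) local_diff_simple:
  assumes core: "diff_core R A M = {\<zero>}"
  shows "diff_simple R A"
  unfolding diff_simple_def
proof (intro conjI allI impI)
  show "carrier R \<noteq> {\<zero>}"
  proof
    assume "carrier R = {\<zero>}"
    then have "carrier R \<subseteq> M" using ideal_simps(1)[OF is_ideal] by simp
    then show False using I_notcarr a_subset by (metis subset_antisym)
  qed
  fix I assume I: "ideal I R \<and> diff_stable R A I"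
  show "I = {\<zero>} \<or> I = carrier R"
  proof (cases "I = {\<zero>}")
    case False
    have II: "ideal I R" using I by simp
    obtain f where f: "f \<in> I" "f \<noteq> \<zero>" using False ideal_simps(1)[OF II] by blast
    then obtain \<delta> where \<delta>: "\<delta> \<in> diff_op R A" "\<delta> f \<notin> M"
      using core ideal_simps(2)[OF II] by (auto simp: diff_core_def)
    have d: "\<delta> f \<in> I" using I \<delta>(1) f(1) by (auto simp: diff_stable_def)
    have u: "\<delta> f \<in> Units R" using Units_of_not_mem \<delta>(2) d ideal_simps(2)[OF II] by blast
    have "inv (\<delta> f) \<otimes> \<delta> f \<in> I" by (rule ideal_simps(6)[OF II d Units_inv_closed[OF u]])
    then show ?thesis using ideal.one_imp_carrier[OF II] u by simp
  qed simp
qed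

theorem theorem4p26:
  fixes R :: "('a, 'm) ring_scheme" and M A :: "'a set" and G :: "nat \<Rightarrow> 'a set"
  assumes "noetherian_local_ring R M \<or> noetherian_graded_ring R G M"
    and "reduced_ring R"
    and "subring A R"
    and "diff_signature R A M > 0"
  shows "(noetherian_local_ring R M \<or> homogeneous R G A \<longrightarrow> diff_simple R A) \<and>
         (noetherian_graded_ring R G M \<longrightarrow>
            (\<forall>I. ideal I R \<and> homogeneous R G I \<and> diff_stable R A I \<longrightarrow>
                 I = {\<zero>\<^bsub>R\<^esub>} \<or> I = carrier R))"
proof -
  have A: "A \<subseteq> carrier R"
    using subgroup.subset[OF subring.axioms(1)[OF assms(3)]] by simp
  have "local_like_ring R M"
    using assms(1) noetherian_local_ring.local_local_like noetherian_graded_ring.graded_local_like by blast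
  then have core: "diff_core R A M = {\<zero>\<^bsub>R\<^esub>}"
    by (rule local_like_ring.diff_core_eq_zero[OF _ assms(2) A assms(4)])
  have loc: "diff_simple R A" if "noetherian_local_ring R M"
    by (rule noetherian_local_ring.local_diff_simple[OF that core])
  have gr: "I = {\<zero>\<^bsub>R\<^esub>} \<or> I = carrier R"
    if "noetherian_graded_ring R G M" "ideal I R" "diff_stable R A I"
      "homogeneous R G A \<or> homogeneous R G I" for I
    using noetherian_graded_ring.diff_stable_ideal_trivial[OF that(1) core A that(2,3) _ that(4)] by blast
  have "diff_simple R A" if "noetherian_local_ring R M \<or> homogeneous R G A"
  proof (cases "noetherian_local_ring R M")
    case False
    then have g: "noetherian_graded_ring R G M" and h: "homogeneous R G A" using assms(1) that by auto
    interpret noetherian_graded_ring R G M by (rule g)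
    have "carrier R \<noteq> {\<zero>\<^bsub>R\<^esub>}" using one_neq_zero one_closed by blast
    then show ?thesis unfolding diff_simple_def using gr[OF g] h by blast
  qed (rule loc)
  then show ?thesis using gr by blast
qed

end
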